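(* Let $H$ be a finite-dimensional Hopf algebra, $X$ an algebra, $\alpha:X\to H^{\mathrm{op}}\otimes X$ a left coaction of $H^{\mathrm{op}}$ on $X$ and $\beta:X\to\widehat H\otimes X$ a left coaction of $\widehat H$ on $X$. Then $(X,\alpha,\beta)$ is a left-left $(H,\widehat H)$-Yetter--Drinfeld algebra if and only if $(X,\lhd_\beta,\alpha)$ is a (right-left) Yetter--Drinfeld algebra over $H$, where $\lhd_\beta:X\otimes H\to X$, $x\lhd_\beta h=(\mathbf p(h,\cdot)\otimes\mathrm{id}_X)(\beta(x))$, is the right action of $H$ on $X$ induced by $\beta$.
   Context: $\Bbbk$ is a field, algebras are unital $\Bbbk$-algebras. $H$ has structure maps $\Delta,\varepsilon,S$ ($S$ bijective), with Sweedler notation; $\widehat H$ is the dual Hopf algebra and $\mathbf p(h,\theta)=\theta(h)$, with $\mathbf p(h,\theta\theta')=\mathbf p(h_{(1)},\theta)\mathbf p(h_{(2)},\theta')$, $\mathbf p(hh',\theta)=\mathbf p(h,\theta_{(1)})\mathbf p(h',\theta_{(2)})$. $H^{\mathrm{op}}$ is the Hopf algebra with opposite product (elements $h^{\mathrm{op}}$) and the same coproduct. $U=\sum_ih_i\otimes\widehat h_i\in H\otimes\widehat H$ (dual bases), and ${}^{\circ}U=\sum_ih_i^{\mathrm{op}}\otimes\widehat h_i\in H^{\mathrm{op}}\otimes\widehat H$, which is invertible. $\mathrm{Ad}(W)(z)=WzW^{-1}$; $\Sigma$ is the flip. A left coaction of a Hopf algebra $K$ on an algebra $X$ is an algebra homomorphism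 $\alpha:X\to K\otimes X$ with $(\mathrm{id}\otimes\alpha)\alpha=(\Delta_K\otimes\mathrm{id})\alpha$, $(\varepsilon_K\otimes\mathrm{id})\alpha=\mathrm{id}$. A right action of $H$ on $X$ is a right module structure $\lhd$ with $(xy)\lhd h=(x\lhd h_{(1)})(y\lhd h_{(2)})$, $1_X\lhd h=\varepsilon(h)1_X$. $(X,\alpha,\beta)$ is a left-left $(H,\widehat H)$-Yetter--Drinfeld algebra if $(\mathrm{id}_{\widehat H}\otimes\alpha)\beta=(\Sigma\otimes\mathrm{id}_X)(\mathrm{Ad}({}^{\circ}U)\otimes\mathrm{id}_X)(\mathrm{id}_{H^{\mathrm{op}}}\otimes\beta)\alpha$. For a right action $\lhd$ of $H$ and a left coaction $\delta:X\to H^{\mathrm{op}}\otimes X$, $\delta(x)=x_{[-1]}^{\mathrm{op}}\otimes x_{[0]}$, $(X,\lhd,\delta)$ is a (right-left) Yetter--Drinfeld algebra over $H$ if $x_{[-1]}h_{(1)}\otimes(x_{[0]}\lhd h_{(2)})=h_{(2)}(x\lhd h_{(1)})_{[-1]}\otimes(x\lhd h_{(1)})_{[0]}$ for all $h\in H$, $x\in X$. *)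

theory Defs
  imports "HOL-Algebra.Algebra"
begin

section \<open>Algebras over a field\<close>

text \<open>The locale \<^locale>\<open>algebra\<close> of the library is about commutative algebras only.\<close>

locale unital_algebra = K: field K + module K A + A: ring A
  for K :: "('k, 'c) ring_scheme" (structure) and A :: "('k, 'a, 'm) module_scheme" (structure) +
  assumes smult_mult_left:
      "\<lbrakk>r \<in> carrier K; x \<in> carrier A; y \<in> carrier A\<rbrakk>
        \<Longrightarrow> (r \<odot>\<^bsub>A\<^esub> x) \<otimes>\<^bsub>A\<^esub> y = r \<odot>\<^bsub>A\<^esub> (x \<otimes>\<^bsub>A\<^esub> y)"
    and smult_mult_right:
      "\<lbrakk>r \<in> carrier K; x \<in> carrier A; y \<in> carrier A\<rbrakk>
        \<Longrightarrow> x \<otimes>\<^bsub>A\<^esub> (r \<odot>\<^bsub>A\<^esub> y) = r \<odot>\<^bsub>A\<^esub> (x \<otimes>\<^bsub>A\<^esub> y)"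

definition scalar_algebra :: "('k, 'c) ring_scheme \<Rightarrow> ('k, 'k) module" where
  "scalar_algebra K = \<lparr>carrier = carrier K, monoid.mult = monoid.mult K, monoid.one = \<one>\<^bsub>K\<^esub>,
     ring.zero = \<zero>\<^bsub>K\<^esub>, ring.add = ring.add K, smult = monoid.mult K\<rparr>"

definition linear_map ::
  "('k, 'c) ring_scheme \<Rightarrow> ('k, 'a, 'm) module_scheme \<Rightarrow> ('k, 'b, 'n) module_scheme
    \<Rightarrow> ('a \<Rightarrow> 'b) \<Rightarrow> bool" where
  "linear_map K A B f \<longleftrightarrow> f \<in> carrier A \<rightarrow> carrier B \<and>
     (\<forall>x\<in>carrier A. \<forall>y\<in>carrier A. f (x \<oplus>\<^bsub>A\<^esub> y) = f x \<oplus>\<^bsub>B\<^esub> f y) \<and>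
     (\<forall>r\<in>carrier K. \<forall>x\<in>carrier A. f (r \<odot>\<^bsub>A\<^esub> x) = r \<odot>\<^bsub>B\<^esub> f x)"

definition algebra_hom ::
  "('k, 'c) ring_scheme \<Rightarrow> ('k, 'a, 'm) module_scheme \<Rightarrow> ('k, 'b, 'n) module_scheme
    \<Rightarrow> ('a \<Rightarrow> 'b) \<Rightarrow> bool" where
  "algebra_hom K A B f \<longleftrightarrow> linear_map K A B f \<and> f \<in> ring_hom A B"

definition finite_basis ::
  "('k, 'c) ring_scheme \<Rightarrow> ('k, 'a, 'm) module_scheme \<Rightarrow> 'a set \<Rightarrow> bool" where
  "finite_basis K V B \<longleftrightarrow> finite B \<and> B \<subseteq> carrier V \<and>
     (\<forall>x\<in>carrier V. \<exists>!c. c \<in> B \<rightarrow>\<^sub>E carrier K \<and> x = (\<Oplus>\<^bsub>V\<^esub>b\<in>B. c b \<odot>\<^bsub>V\<^esub> b))"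

definition finite_dim :: "('k, 'c) ring_scheme \<Rightarrow> ('k, 'a, 'm) module_scheme \<Rightarrow> bool" where
  "finite_dim K V \<longleftrightarrow> (\<exists>B. finite_basis K V B)"

definition coord_functional ::
  "('k, 'c) ring_scheme \<Rightarrow> ('k, 'a, 'm) module_scheme \<Rightarrow> 'a set \<Rightarrow> 'a \<Rightarrow> 'a \<Rightarrow> 'k" where
  "coord_functional K V B b =
     (\<lambda>x\<in>carrier V. (THE c. c \<in> B \<rightarrow>\<^sub>E carrier K \<and> x = (\<Oplus>\<^bsub>V\<^esub>e\<in>B. c e \<odot>\<^bsub>V\<^esub> e)) b)"


section \<open>Tensor products\<close>

text \<open>
  \<open>A \<otimes> B\<close> is the free abelian group on \<open>A \<times> B\<close> modulo the subgroup generated by the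
  relations below; its elements are cosets.
\<close>

type_synonym ('a, 'b) tens = "('a \<times> 'b \<Rightarrow>\<^sub>0 int) set"

definition tensor_relations ::
  "('k, 'c) ring_scheme \<Rightarrow> ('k, 'a, 'm) module_scheme \<Rightarrow> ('k, 'b, 'n) module_scheme
    \<Rightarrow> ('a \<times> 'b \<Rightarrow>\<^sub>0 int) set" where
  "tensor_relations K A B =
     {frag_of (a \<oplus>\<^bsub>A\<^esub> a', b) - frag_of (a, b) - frag_of (a', b) |a a' b.
        a \<in> carrier A \<and> a' \<in> carrier A \<and> b \<in> carrier B} \<union>
     {frag_of (a, b \<oplus>\<^bsub>B\<^esub> b') - frag_of (a, b) - frag_of (a, b') |a b b'.
        a \<in> carrier A \<and> b \<in> carrier B \<and> b' \<in> carrier B} \<union>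
     {frag_of (r \<odot>\<^bsub>A\<^esub> a, b) - frag_of (a, r \<odot>\<^bsub>B\<^esub> b) |r a b.
        r \<in> carrier K \<and> a \<in> carrier A \<and> b \<in> carrier B}"

definition tensor_kernel ::
  "('k, 'c) ring_scheme \<Rightarrow> ('k, 'a, 'm) module_scheme \<Rightarrow> ('k, 'b, 'n) module_scheme
    \<Rightarrow> ('a \<times> 'b \<Rightarrow>\<^sub>0 int) set" where
  "tensor_kernel K A B =
     generate (free_Abelian_group (carrier A \<times> carrier B)) (tensor_relations K A B)"

definition tensor_class ::
  "('k, 'c) ring_scheme \<Rightarrow> ('k, 'a, 'm) module_scheme \<Rightarrow> ('k, 'b, 'n) module_scheme
    \<Rightarrow> ('a \<times> 'b \<Rightarrow>\<^sub>0 int) \<Rightarrow> ('a, 'b) tens" where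
  "tensor_class K A B u =
     tensor_kernel K A B #>\<^bsub>free_Abelian_group (carrier A \<times> carrier B)\<^esub> u"

definition pure_tensor ::
  "('k, 'c) ring_scheme \<Rightarrow> ('k, 'a, 'm) module_scheme \<Rightarrow> ('k, 'b, 'n) module_scheme
    \<Rightarrow> 'a \<Rightarrow> 'b \<Rightarrow> ('a, 'b) tens" where
  "pure_tensor K A B a b = tensor_class K A B (frag_of (a, b))"

text \<open>
  The tensor product of algebras. In \<open>mult\<close> and \<open>smult\<close> the sets in the union all coincide,
  because the operations do not depend on the chosen representatives.
\<close>

definition tensor ::
  "('k, 'c) ring_scheme \<Rightarrow> ('k, 'a, 'm) module_scheme \<Rightarrow> ('k, 'b, 'n) module_scheme
    \<Rightarrow> ('k, ('a, 'b) tens) module" where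
  "tensor K A B =
    (let Q = free_Abelian_group (carrier A \<times> carrier B) Mod tensor_kernel K A B in
     \<lparr>carrier = carrier Q,
      monoid.mult = (\<lambda>U V. \<Union>u\<in>U. \<Union>v\<in>V. tensor_class K A B
        (frag_extend (\<lambda>(a, b). frag_extend (\<lambda>(a', b').
           frag_of (a \<otimes>\<^bsub>A\<^esub> a', b \<otimes>\<^bsub>B\<^esub> b')) v) u)),
      monoid.one = pure_tensor K A B \<one>\<^bsub>A\<^esub> \<one>\<^bsub>B\<^esub>,
      ring.zero = \<one>\<^bsub>Q\<^esub>,
      ring.add = monoid.mult Q,
      smult = (\<lambda>r U. \<Union>u\<in>U. tensor_class K A B
        (frag_extend (\<lambda>(a, b). frag_of (r \<odot>\<^bsub>A\<^esub> a, b)) u))\<rparr>)"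

text \<open>
  For a bilinear \<open>f\<close> from \<open>A \<times> B\<close> to \<open>M\<close>, \<open>tensor_lift M f\<close> is the induced map
  \<open>A \<otimes> B \<rightarrow> M\<close>. In Sweedler notation, \<open>tensor_lift M f U\<close> is \<open>f(U\<^sub>(\<^sub>1\<^sub>), U\<^sub>(\<^sub>2\<^sub>))\<close>.
\<close>

definition tensor_lift ::
  "('d, 'm) ring_scheme \<Rightarrow> ('a \<Rightarrow> 'b \<Rightarrow> 'd) \<Rightarrow> ('a, 'b) tens \<Rightarrow> 'd" where
  "tensor_lift M f U =
     the_elem ((\<lambda>u. \<Oplus>\<^bsub>M\<^esub>p\<in>Poly_Mapping.keys u.
       add_pow M (Poly_Mapping.lookup u p) (f (fst p) (snd p))) ` U)"

text \<open>\<open>f \<otimes> g\<close>, with values in \<open>C \<otimes> D\<close>.\<close>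

definition tensor_map ::
  "('k, 'c) ring_scheme \<Rightarrow> ('k, 'd, 'm) module_scheme \<Rightarrow> ('k, 'e, 'n) module_scheme
    \<Rightarrow> ('a \<Rightarrow> 'd) \<Rightarrow> ('b \<Rightarrow> 'e) \<Rightarrow> ('a, 'b) tens \<Rightarrow> ('d, 'e) tens" where
  "tensor_map K C D f g =
     tensor_lift (tensor K C D) (\<lambda>a b. pure_tensor K C D (f a) (g b))"

definition tensor_flip ::
  "('k, 'c) ring_scheme \<Rightarrow> ('k, 'a, 'm) module_scheme \<Rightarrow> ('k, 'b, 'n) module_scheme
    \<Rightarrow> ('a, 'b) tens \<Rightarrow> ('b, 'a) tens" where
  "tensor_flip K A B = tensor_lift (tensor K B A) (\<lambda>a b. pure_tensor K B A b a)"

text \<open>The canonical map \<open>A \<otimes> (B \<otimes> C) \<rightarrow> (A \<otimes> B) \<otimes> C\<close>.\<close>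

definition tensor_assoc ::
  "('k, 'c) ring_scheme \<Rightarrow> ('k, 'a, 'm) module_scheme \<Rightarrow> ('k, 'b, 'n) module_scheme
    \<Rightarrow> ('k, 'd, 'o) module_scheme \<Rightarrow> ('a, ('b, 'd) tens) tens \<Rightarrow> (('a, 'b) tens, 'd) tens" where
  "tensor_assoc K A B C =
     tensor_lift (tensor K (tensor K A B) C)
       (\<lambda>a. tensor_lift (tensor K (tensor K A B) C)
         (\<lambda>b c. pure_tensor K (tensor K A B) C (pure_tensor K A B a b) c))"


section \<open>Hopf algebras\<close>

record ('k, 'a) hopf = "('k, 'a) module" +
  comult :: "'a \<Rightarrow> ('a, 'a) tens"
  counit :: "'a \<Rightarrow> 'k"
  antipode :: "'a \<Rightarrow> 'a"

locale hopf_algebra = unital_algebra K H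
  for K :: "('k, 'c) ring_scheme" (structure) and H :: "('k, 'a, 'm) hopf_scheme" (structure) +
  assumes comult_hom: "algebra_hom K H (tensor K H H) (comult H)"
    and counit_hom: "algebra_hom K H (scalar_algebra K) (counit H)"
    and coassoc: "h \<in> carrier H \<Longrightarrow>
      tensor_assoc K H H H (tensor_map K H (tensor K H H) id (comult H) (comult H h))
        = tensor_map K (tensor K H H) H (comult H) id (comult H h)"
    and counit_left: "h \<in> carrier H \<Longrightarrow>
      tensor_lift H (\<lambda>a b. counit H a \<odot>\<^bsub>H\<^esub> b) (comult H h) = h"
    and counit_right: "h \<in> carrier H \<Longrightarrow>
      tensor_lift H (\<lambda>a b. counit H b \<odot>\<^bsub>H\<^esub> a) (comult H h) = h"
    and antipode_linear: "linear_map K H H (antipode H)"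
    and antipode_left: "h \<in> carrier H \<Longrightarrow>
      tensor_lift H (\<lambda>a b. antipode H a \<otimes>\<^bsub>H\<^esub> b) (comult H h) = counit H h \<odot>\<^bsub>H\<^esub> \<one>\<^bsub>H\<^esub>"
    and antipode_right: "h \<in> carrier H \<Longrightarrow>
      tensor_lift H (\<lambda>a b. a \<otimes>\<^bsub>H\<^esub> antipode H b) (comult H h) = counit H h \<odot>\<^bsub>H\<^esub> \<one>\<^bsub>H\<^esub>"
    and antipode_bij: "bij_betw (antipode H) (carrier H) (carrier H)"

text \<open>
  The opposite Hopf algebra lives on the same vector space, so \<open>h\<^sup>o\<^sup>p\<close> is \<open>h\<close> itself,
  and \<open>H\<^sup>o\<^sup>p \<otimes> V\<close> and \<open>H \<otimes> V\<close> have the same elements.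
\<close>

definition op_hopf :: "('k, 'a) hopf \<Rightarrow> ('k, 'a) hopf" where
  "op_hopf H = H\<lparr>monoid.mult := \<lambda>x y. y \<otimes>\<^bsub>H\<^esub> x, antipode := inv_into (carrier H) (antipode H)\<rparr>"

text \<open>
  The dual of a finite-dimensional Hopf algebra, with pairing \<open>p(h,\<theta>) = \<theta> h\<close>.
  Its coproduct is determined by \<open>p(hh',\<theta>) = p(h,\<theta>\<^sub>(\<^sub>1\<^sub>)) p(h',\<theta>\<^sub>(\<^sub>2\<^sub>))\<close>.
\<close>

definition dual_algebra ::
  "('k, 'c) ring_scheme \<Rightarrow> ('k, 'a) hopf \<Rightarrow> ('k, 'a \<Rightarrow> 'k) module" where
  "dual_algebra K H =
     \<lparr>carrier = {\<theta> \<in> extensional (carrier H). linear_map K H (scalar_algebra K) \<theta>},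
      monoid.mult = (\<lambda>\<theta> \<theta>'. \<lambda>h\<in>carrier H. tensor_lift K (\<lambda>a b. \<theta> a \<otimes>\<^bsub>K\<^esub> \<theta>' b) (comult H h)),
      monoid.one = restrict (counit H) (carrier H),
      ring.zero = (\<lambda>h\<in>carrier H. \<zero>\<^bsub>K\<^esub>),
      ring.add = (\<lambda>\<theta> \<theta>'. \<lambda>h\<in>carrier H. \<theta> h \<oplus>\<^bsub>K\<^esub> \<theta>' h),
      smult = (\<lambda>r \<theta>. \<lambda>h\<in>carrier H. r \<otimes>\<^bsub>K\<^esub> \<theta> h)\<rparr>"

definition dual_comult ::
  "('k, 'c) ring_scheme \<Rightarrow> ('k, 'a) hopf \<Rightarrow> ('a \<Rightarrow> 'k) \<Rightarrow> ('a \<Rightarrow> 'k, 'a \<Rightarrow> 'k) tens" where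
  "dual_comult K H \<theta> =
     (THE t. t \<in> carrier (tensor K (dual_algebra K H) (dual_algebra K H)) \<and>
        (\<forall>h\<in>carrier H. \<forall>h'\<in>carrier H.
           tensor_lift K (\<lambda>\<phi> \<psi>. \<phi> h \<otimes>\<^bsub>K\<^esub> \<psi> h') t = \<theta> (h \<otimes>\<^bsub>H\<^esub> h')))"

definition dual_hopf ::
  "('k, 'c) ring_scheme \<Rightarrow> ('k, 'a) hopf \<Rightarrow> ('k, 'a \<Rightarrow> 'k) hopf" where
  "dual_hopf K H = module.extend (dual_algebra K H)
     (hopf.fields (dual_comult K H) (\<lambda>\<theta>. \<theta> \<one>\<^bsub>H\<^esub>) (\<lambda>\<theta>. \<lambda>h\<in>carrier H. \<theta> (antipode H h)))"


section \<open>Coactions, actions and Yetter--Drinfeld algebras\<close>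

definition left_coaction ::
  "('k, 'c) ring_scheme \<Rightarrow> ('k, 'a) hopf \<Rightarrow> ('k, 'x, 'm) module_scheme
    \<Rightarrow> ('x \<Rightarrow> ('a, 'x) tens) \<Rightarrow> bool" where
  "left_coaction K C A \<delta> \<longleftrightarrow>
     algebra_hom K A (tensor K C A) \<delta> \<and>
     (\<forall>x\<in>carrier A.
        tensor_assoc K C C A (tensor_map K C (tensor K C A) id \<delta> (\<delta> x))
          = tensor_map K (tensor K C C) A (comult C) id (\<delta> x)) \<and>
     (\<forall>x\<in>carrier A. tensor_lift A (\<lambda>c y. counit C c \<odot>\<^bsub>A\<^esub> y) (\<delta> x) = x)"

definition right_action ::
  "('k, 'c) ring_scheme \<Rightarrow> ('k, 'a) hopf \<Rightarrow> ('k, 'x, 'm) module_scheme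
    \<Rightarrow> ('x \<Rightarrow> 'a \<Rightarrow> 'x) \<Rightarrow> bool" where
  "right_action K H A act \<longleftrightarrow>
     (\<forall>h\<in>carrier H. linear_map K A A (\<lambda>x. act x h)) \<and>
     (\<forall>x\<in>carrier A. linear_map K H A (act x)) \<and>
     (\<forall>x\<in>carrier A. \<forall>h\<in>carrier H. \<forall>h'\<in>carrier H. act (act x h) h' = act x (h \<otimes>\<^bsub>H\<^esub> h')) \<and>
     (\<forall>x\<in>carrier A. act x \<one>\<^bsub>H\<^esub> = x) \<and>
     (\<forall>x\<in>carrier A. \<forall>y\<in>carrier A. \<forall>h\<in>carrier H.
        act (x \<otimes>\<^bsub>A\<^esub> y) h = tensor_lift A (\<lambda>a b. act x a \<otimes>\<^bsub>A\<^esub> act y b) (comult H h)) \<and>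
     (\<forall>h\<in>carrier H. act \<one>\<^bsub>A\<^esub> h = counit H h \<odot>\<^bsub>A\<^esub> \<one>\<^bsub>A\<^esub>)"

definition induced_action ::
  "('k, 'x, 'm) module_scheme \<Rightarrow> ('x \<Rightarrow> ('a \<Rightarrow> 'k, 'x) tens) \<Rightarrow> 'x \<Rightarrow> 'a \<Rightarrow> 'x" where
  "induced_action A \<beta> x h = tensor_lift A (\<lambda>\<theta> y. \<theta> h \<odot>\<^bsub>A\<^esub> y) (\<beta> x)"

definition Ad :: "('a, 'm) monoid_scheme \<Rightarrow> 'a \<Rightarrow> 'a \<Rightarrow> 'a" where
  "Ad A w z = w \<otimes>\<^bsub>A\<^esub> z \<otimes>\<^bsub>A\<^esub> inv\<^bsub>A\<^esub> w"

text \<open>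
  The element \<open>\<^bold>\<Sum>\<^sub>i h\<^sub>i\<^sup>o\<^sup>p \<otimes> h\<^sub>i\<^sup>*\<close> of \<open>H\<^sup>o\<^sup>p \<otimes> H\<^sup>*\<close>, for dual bases \<open>h\<^sub>i\<close>, \<open>h\<^sub>i\<^sup>*\<close>; it does not
  depend on the chosen basis.
\<close>

definition canonical_op ::
  "('k, 'c) ring_scheme \<Rightarrow> ('k, 'a) hopf \<Rightarrow> ('a, 'a \<Rightarrow> 'k) tens" where
  "canonical_op K H =
     (let B = (SOME B. finite_basis K H B) in
      \<Oplus>\<^bsub>tensor K (op_hopf H) (dual_hopf K H)\<^esub>b\<in>B.
        pure_tensor K (op_hopf H) (dual_hopf K H) b (coord_functional K H B b))"

text \<open>
  Both sides of the compatibility condition are compared in \<open>(H\<^sup>* \<otimes> H\<^sup>o\<^sup>p) \<otimes> A\<close>.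
\<close>

definition left_left_YD_algebra ::
  "('k, 'c) ring_scheme \<Rightarrow> ('k, 'a) hopf \<Rightarrow> ('k, 'x, 'm) module_scheme
    \<Rightarrow> ('x \<Rightarrow> ('a, 'x) tens) \<Rightarrow> ('x \<Rightarrow> ('a \<Rightarrow> 'k, 'x) tens) \<Rightarrow> bool" where
  "left_left_YD_algebra K H A \<alpha> \<beta> \<longleftrightarrow>
     (let P = op_hopf H; D = dual_hopf K H in
      left_coaction K P A \<alpha> \<and> left_coaction K D A \<beta> \<and>
      (\<forall>x\<in>carrier A.
         tensor_assoc K D P A (tensor_map K D (tensor K P A) id \<alpha> (\<beta> x))
         = tensor_map K (tensor K D P) A (tensor_flip K P D) id
             (tensor_map K (tensor K P D) A (Ad (tensor K P D) (canonical_op K H)) id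
               (tensor_assoc K P D A (tensor_map K P (tensor K D A) id \<beta> (\<alpha> x))))))"

text \<open>
  With \<open>\<delta> x = x\<^sub>[\<^sub>-\<^sub>1\<^sub>] \<otimes> x\<^sub>[\<^sub>0\<^sub>]\<close>, the compatibility condition reads
  \<open>x\<^sub>[\<^sub>-\<^sub>1\<^sub>] h\<^sub>(\<^sub>1\<^sub>) \<otimes> x\<^sub>[\<^sub>0\<^sub>] \<lhd> h\<^sub>(\<^sub>2\<^sub>) = h\<^sub>(\<^sub>2\<^sub>) (x \<lhd> h\<^sub>(\<^sub>1\<^sub>))\<^sub>[\<^sub>-\<^sub>1\<^sub>] \<otimes> (x \<lhd> h\<^sub>(\<^sub>1\<^sub>))\<^sub>[\<^sub>0\<^sub>]\<close>,
  with products taken in \<open>H\<close>.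
\<close>

definition right_left_YD_algebra ::
  "('k, 'c) ring_scheme \<Rightarrow> ('k, 'a) hopf \<Rightarrow> ('k, 'x, 'm) module_scheme
    \<Rightarrow> ('x \<Rightarrow> 'a \<Rightarrow> 'x) \<Rightarrow> ('x \<Rightarrow> ('a, 'x) tens) \<Rightarrow> bool" where
  "right_left_YD_algebra K H A act \<delta> \<longleftrightarrow>
     right_action K H A act \<and> left_coaction K (op_hopf H) A \<delta> \<and>
     (\<forall>h\<in>carrier H. \<forall>x\<in>carrier A.
        tensor_lift (tensor K H A)
          (\<lambda>y x0. tensor_lift (tensor K H A)
             (\<lambda>h1 h2. pure_tensor K H A (y \<otimes>\<^bsub>H\<^esub> h1) (act x0 h2)) (comult H h)) (\<delta> x)
        = tensor_lift (tensor K H A)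
          (\<lambda>h1 h2. tensor_lift (tensor K H A)
             (\<lambda>y x0. pure_tensor K H A (h2 \<otimes>\<^bsub>H\<^esub> y) x0) (\<delta> (act x h1))) (comult H h))"

end

theory Submission
  imports Defs
begin

text \<open>
  Let \<open>D\<close> be the dual of \<open>H\<close> and \<open>P\<close> its opposite. Since \<open>H\<close> is finite-dimensional, pairing the
  second factor with elements of \<open>H\<close> identifies \<open>V \<otimes> D\<close> with the linear maps \<open>H \<rightarrow> V\<close>
  (\<open>ev_eqI\<close>), and the product of \<open>V \<otimes> D\<close> becomes the convolution
  \<open>(f * g)(h) = f(h\<^sub>1) g(h\<^sub>2)\<close> (\<open>ev_mult\<close>). The canonical element \<open>w\<close> of \<open>P \<otimes> D\<close> becomes
  the identity \<open>H \<rightarrow> P\<close>. It is a unit (\<open>canonical_op_unit\<close>): the antipode \<open>S\<close> reverses products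
  (\<open>antipode_mult\<close>), hence its inverse is an antipode of \<open>P\<close>, which is the same as a convolution
  inverse of the identity.

  Write \<open>Z\<close> for \<open>(id \<otimes> \<beta>)(\<alpha> x)\<close>, an element of \<open>(P \<otimes> D) \<otimes> A\<close>, and \<open>T\<close> for
  \<open>(id \<otimes> \<alpha>)(\<beta> x)\<close> with its first two factors flipped. The left-left condition is
  \<open>T = (Ad w \<otimes> id) Z\<close>. As \<open>w\<close> is a unit this says \<open>T (w \<otimes> 1) = (w \<otimes> 1) Z\<close>, and no inverse
  is left. Now pair the factor \<open>D\<close> with \<open>h\<close>. The pairing takes \<open>T\<close> to \<open>\<alpha>(x \<lhd> h)\<close>
  (\<open>ev_id_assoc_left\<close>) and \<open>Z\<close> to \<open>x\<^sub>[\<^sub>-\<^sub>1\<^sub>] \<otimes> (x\<^sub>[\<^sub>0\<^sub>] \<lhd> h)\<close> (\<open>ev_id_assoc_right\<close>), and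
  the products with \<open>w\<close> become convolutions with the identity (\<open>ev_id_mult\<close>). In terms of the product
  of \<open>H\<close> the equation reads
  \<open>h\<^sub>2 (x \<lhd> h\<^sub>1)\<^sub>[\<^sub>-\<^sub>1\<^sub>] \<otimes> (x \<lhd> h\<^sub>1)\<^sub>[\<^sub>0\<^sub>] = x\<^sub>[\<^sub>-\<^sub>1\<^sub>] h\<^sub>1 \<otimes> (x\<^sub>[\<^sub>0\<^sub>] \<lhd> h\<^sub>2)\<close>, which is
  the right-left condition (\<open>compatibility_iff\<close>). The remaining part of the right-left notion, that
  \<open>\<lhd>\<close> is an action compatible with the algebra structure, follows from the coaction axioms for \<open>\<beta>\<close>
  by duality (\<open>right_action_induced\<close>).

  Tensor products are quotients of free abelian groups. Once their universal property and their product
  are derived from representatives, identities between tensors are proved by observing that both sides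
  are linear and agree on pure tensors (\<open>tensor_map_eqI\<close>).
\<close>

section \<open>The universal property of the tensor product\<close>

text \<open>
  The homomorphism from the free abelian group to \<open>M\<close> that extends \<open>f\<close>; \<open>tensor_lift\<close> takes
  its common value on the representatives of a tensor.
\<close>

definition frag_eval :: "('d, 'm) ring_scheme \<Rightarrow> ('a \<Rightarrow> 'd) \<Rightarrow> ('a \<Rightarrow>\<^sub>0 int) \<Rightarrow> 'd" where
  "frag_eval M f u = (\<Oplus>\<^bsub>M\<^esub>p\<in>Poly_Mapping.keys u. add_pow M (Poly_Mapping.lookup u p) (f p))"

context abelian_group
begin

lemma int_pow_zero: "add_pow G (0::int) x = \<zero>"
  by (simp add: add_pow_def int_pow_def nat_pow_def)

lemma frag_eval_superset:
  assumes "finite T" "Poly_Mapping.keys u \<subseteq> T" "f \<in> T \<rightarrow> carrier G"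
  shows "frag_eval G f u = (\<Oplus>p\<in>T. add_pow G (Poly_Mapping.lookup u p) (f p))"
  unfolding frag_eval_def
  by (rule add.finprod_mono_neutral_cong_left)
    (use assms in \<open>auto simp: in_keys_iff Pi_iff add.int_pow_closed int_pow_zero\<close>)

lemma frag_eval_closed:
  assumes "Poly_Mapping.keys u \<subseteq> S" "f \<in> S \<rightarrow> carrier G"
  shows "frag_eval G f u \<in> carrier G"
  unfolding frag_eval_def by (rule finsum_closed) (use assms in \<open>auto simp: Pi_iff add.int_pow_closed\<close>)

lemma frag_eval_diff:
  assumes u: "Poly_Mapping.keys u \<subseteq> S" and v: "Poly_Mapping.keys v \<subseteq> S" and f: "f \<in> S \<rightarrow> carrier G"
  shows "frag_eval G f (u - v) = frag_eval G f u \<ominus> frag_eval G f v"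
proof -
  let ?T = "Poly_Mapping.keys u \<union> Poly_Mapping.keys v"
  have T: "finite ?T" "f \<in> ?T \<rightarrow> carrier G" using assms by auto
  have w: "Poly_Mapping.keys (u - v) \<subseteq> ?T" by (rule keys_diff)
  have e1: "frag_eval G f (u - v) = (\<Oplus>p\<in>?T. add_pow G (Poly_Mapping.lookup (u - v) p) (f p))"
    using frag_eval_superset[OF T(1) w T(2)] .
  have e2: "frag_eval G f u = (\<Oplus>p\<in>?T. add_pow G (Poly_Mapping.lookup u p) (f p))"
    using frag_eval_superset[OF T(1) _ T(2)] by auto
  have e3: "frag_eval G f v = (\<Oplus>p\<in>?T. add_pow G (Poly_Mapping.lookup v p) (f p))"
    using frag_eval_superset[OF T(1) _ T(2)] by auto
  have cl: "add_pow G (n::int) (f p) \<in> carrier G" if "p \<in> ?T" for p n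
    using T that by (auto simp: Pi_iff add.int_pow_closed)
  have "frag_eval G f (u - v) \<oplus> frag_eval G f v = frag_eval G f u"
    unfolding e1 e2 e3
    apply (subst finsum_addf[symmetric])
    subgoal using cl by auto
    subgoal using cl by auto
    apply (rule finsum_cong')
    subgoal by simp
    subgoal using cl by auto
    subgoal for p using T(2) by (auto simp: lookup_minus add.int_pow_mult[symmetric] Pi_iff)
    done
  moreover have "frag_eval G f (u - v) \<in> carrier G" "frag_eval G f v \<in> carrier G" "frag_eval G f u \<in> carrier G"
    using frag_eval_closed[OF u f] frag_eval_closed[OF v f] frag_eval_closed[OF w T(2)] by auto
  ultimately show ?thesis
    by (metis add.inv_solve_right a_minus_def)
qed

lemma frag_eval_zero: "frag_eval G f 0 = \<zero>"
  by (simp add: frag_eval_def)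

lemma frag_eval_of: "f p \<in> carrier G \<Longrightarrow> frag_eval G f (frag_of p) = f p"
  by (simp add: frag_eval_def keys_frag_of)

lemma frag_eval_uminus:
  assumes "Poly_Mapping.keys v \<subseteq> S" "f \<in> S \<rightarrow> carrier G"
  shows "frag_eval G f (- v) = \<ominus> frag_eval G f v"
  using frag_eval_diff[of 0 S v f] frag_eval_closed[OF assms] assms
  by (simp add: frag_eval_zero a_minus_def)

lemma frag_eval_add:
  assumes "Poly_Mapping.keys u \<subseteq> S" "Poly_Mapping.keys v \<subseteq> S" "f \<in> S \<rightarrow> carrier G"
  shows "frag_eval G f (u + v) = frag_eval G f u \<oplus> frag_eval G f v"
  using frag_eval_diff[of u S "- v" f] frag_eval_uminus[of v S f] frag_eval_closed[of v S f] assms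
  by (simp add: a_minus_def)

end

definition bilinear_map where
  "bilinear_map K A B M f \<longleftrightarrow>
     (\<forall>a\<in>carrier A. linear_map K B M (f a)) \<and> (\<forall>b\<in>carrier B. linear_map K A M (\<lambda>a. f a b))"

locale module_pair = A: module K A + B: module K B
  for K :: "('k, 'c) ring_scheme" (structure) and A :: "('k, 'a, 'm) module_scheme"
    and B :: "('k, 'b, 'n) module_scheme"

lemma module_pairI [simp, intro]: "module K A \<Longrightarrow> module K B \<Longrightarrow> module_pair K A B"
  by (simp add: module_pair_def)

context module_pair
begin

abbreviation "F \<equiv> free_Abelian_group (carrier A \<times> carrier B)"
abbreviation "N \<equiv> tensor_kernel K A B"
abbreviation "cls \<equiv> tensor_class K A B"
abbreviation "T \<equiv> tensor K A B"

lemma keys_relation_subset: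
  "x \<in> S \<Longrightarrow> y \<in> S \<Longrightarrow> z \<in> S \<Longrightarrow> Poly_Mapping.keys (frag_of x - frag_of y - frag_of z) \<subseteq> S"
  "x \<in> S \<Longrightarrow> y \<in> S \<Longrightarrow> Poly_Mapping.keys (frag_of x - frag_of y) \<subseteq> S"
  using keys_diff[of "frag_of x - frag_of y" "frag_of z"] keys_diff[of "frag_of x" "frag_of y"]
  by (auto simp: keys_frag_of)

lemma relations_subset: "tensor_relations K A B \<subseteq> carrier F"
proof
  fix x assume "x \<in> tensor_relations K A B"
  then show "x \<in> carrier F"
    unfolding tensor_relations_def carrier_free_Abelian_group_iff
    by (elim UnE CollectE exE conjE; hypsubst; intro keys_relation_subset) auto
qed

lemma subgroup_N: "subgroup N F"
  unfolding tensor_kernel_def by (rule group.generate_is_subgroup) (use relations_subset in auto)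

lemma N_zero: "0 \<in> N" using subgroup.one_closed[OF subgroup_N] by simp
lemma N_keys: "x \<in> N \<Longrightarrow> Poly_Mapping.keys x \<subseteq> carrier A \<times> carrier B"
  using subgroup.mem_carrier[OF subgroup_N] by simp
lemma N_add: "x \<in> N \<Longrightarrow> y \<in> N \<Longrightarrow> x + y \<in> N" using subgroup.m_closed[OF subgroup_N] by simp
lemma N_uminus: "x \<in> N \<Longrightarrow> - x \<in> N" using subgroup.m_inv_closed[OF subgroup_N, of x] N_keys by simp
lemma N_diff: "x \<in> N \<Longrightarrow> y \<in> N \<Longrightarrow> x - y \<in> N"
  using N_add[of x "- y"] N_uminus[of y] by simp

lemma N_relation:
  "a \<in> carrier A \<Longrightarrow> a' \<in> carrier A \<Longrightarrow> b \<in> carrier B \<Longrightarrow>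
    frag_of (a \<oplus>\<^bsub>A\<^esub> a', b) - frag_of (a, b) - frag_of (a', b) \<in> N"
  "a \<in> carrier A \<Longrightarrow> b \<in> carrier B \<Longrightarrow> b' \<in> carrier B \<Longrightarrow>
    frag_of (a, b \<oplus>\<^bsub>B\<^esub> b') - frag_of (a, b) - frag_of (a, b') \<in> N"
  "r \<in> carrier K \<Longrightarrow> a \<in> carrier A \<Longrightarrow> b \<in> carrier B \<Longrightarrow>
    frag_of (r \<odot>\<^bsub>A\<^esub> a, b) - frag_of (a, r \<odot>\<^bsub>B\<^esub> b) \<in> N"
  unfolding tensor_kernel_def tensor_relations_def by (rule generate.incl, blast)+

text \<open>
  Inverses and products in the generated subgroup are both differences: \<open>-h = 0 - h\<close> and
  \<open>h\<^sub>1 + h\<^sub>2 = h\<^sub>1 - (0 - h\<^sub>2)\<close>.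
\<close>

lemma N_induct [consumes 1, case_names zero left right scalar diff]:
  assumes "x \<in> N" and "P 0"
    and "\<And>a a' b. a \<in> carrier A \<Longrightarrow> a' \<in> carrier A \<Longrightarrow> b \<in> carrier B \<Longrightarrow>
      P (frag_of (a \<oplus>\<^bsub>A\<^esub> a', b) - frag_of (a, b) - frag_of (a', b))"
    and "\<And>a b b'. a \<in> carrier A \<Longrightarrow> b \<in> carrier B \<Longrightarrow> b' \<in> carrier B \<Longrightarrow>
      P (frag_of (a, b \<oplus>\<^bsub>B\<^esub> b') - frag_of (a, b) - frag_of (a, b'))"
    and "\<And>r a b. r \<in> carrier K \<Longrightarrow> a \<in> carrier A \<Longrightarrow> b \<in> carrier B \<Longrightarrow>
      P (frag_of (r \<odot>\<^bsub>A\<^esub> a, b) - frag_of (a, r \<odot>\<^bsub>B\<^esub> b))"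
    and diff: "\<And>u v. u \<in> N \<Longrightarrow> v \<in> N \<Longrightarrow> P u \<Longrightarrow> P v \<Longrightarrow> P (u - v)"
  shows "P x"
proof -
  have rel: "P r" if "r \<in> tensor_relations K A B" for r
    using that unfolding tensor_relations_def
    by (elim UnE CollectE exE conjE; hypsubst; intro assms(3-5))
  have "x \<in> generate F (tensor_relations K A B)" using assms(1) by (simp add: tensor_kernel_def)
  then show ?thesis
  proof induction
    case one then show ?case using assms(2) by simp
  next
    case (incl h) then show ?case by (rule rel)
  next
    case (inv h)
    have "h \<in> N" using inv unfolding tensor_kernel_def by (rule generate.incl)
    moreover have "Poly_Mapping.keys h \<subseteq> carrier A \<times> carrier B" using subsetD[OF relations_subset inv] by simp
    moreover have "P (0 - h)" by (rule diff[OF N_zero \<open>h \<in> N\<close> assms(2) rel[OF inv]])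
    ultimately show ?case by simp
  next
    case (eng h1 h2)
    then have "h1 \<in> N" "h2 \<in> N" by (simp_all add: tensor_kernel_def)
    have 1: "P (0 - h2)" by (rule diff[OF N_zero \<open>h2 \<in> N\<close> assms(2)]) (rule eng.IH)
    have 2: "0 - h2 \<in> N" using N_uminus[OF \<open>h2 \<in> N\<close>] by simp
    have "P (h1 - (0 - h2))" by (rule diff[OF \<open>h1 \<in> N\<close> 2 eng.IH(1) 1])
    then show ?case by simp
  qed
qed

lemma mem_cls: "v \<in> cls u \<longleftrightarrow> v - u \<in> N"
proof
  assume "v - u \<in> N"
  then show "v \<in> cls u" unfolding tensor_class_def r_coset_def
    by (auto intro!: bexI[of _ "v - u"])
qed (auto simp: tensor_class_def r_coset_def)

lemma cls_eq: "cls u = cls v \<longleftrightarrow> u - v \<in> N"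
proof
  assume "cls u = cls v"
  then show "u - v \<in> N" using mem_cls[of u u] mem_cls[of u v] N_zero by simp
next
  assume *: "u - v \<in> N"
  show "cls u = cls v"
  proof (rule Set.set_eqI)
    fix x
    show "x \<in> cls u \<longleftrightarrow> x \<in> cls v"
      using N_add[OF _ *, of "x - u"] N_diff[OF _ *, of "x - v"] by (auto simp: mem_cls)
  qed
qed

lemma cls_self: "u \<in> cls u" by (simp add: mem_cls N_zero)

lemma mem_cls_keys: "Poly_Mapping.keys u \<subseteq> carrier A \<times> carrier B \<Longrightarrow> v \<in> cls u
    \<Longrightarrow> Poly_Mapping.keys v \<subseteq> carrier A \<times> carrier B"
  using N_keys[of "v - u"] keys_add[of "v - u" u] by (auto simp: mem_cls)

lemma carrier_tensor: "carrier T = {cls u |u. Poly_Mapping.keys u \<subseteq> carrier A \<times> carrier B}"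
  unfolding tensor_def FactGroup_def RCOSETS_def tensor_class_def by auto

lemma tensor_cases:
  assumes "U \<in> carrier T"
  obtains u where "U = cls u" "Poly_Mapping.keys u \<subseteq> carrier A \<times> carrier B"
  using assms unfolding carrier_tensor by blast

lemma cls_closed: "Poly_Mapping.keys u \<subseteq> carrier A \<times> carrier B \<Longrightarrow> cls u \<in> carrier T"
  unfolding carrier_tensor by blast

lemma zero_tensor: "\<zero>\<^bsub>T\<^esub> = cls 0"
  unfolding tensor_def FactGroup_def by (auto simp: tensor_class_def r_coset_def)

lemma add_cls: "cls u \<oplus>\<^bsub>T\<^esub> cls v = cls (u + v)"
proof -
  have "cls u \<oplus>\<^bsub>T\<^esub> cls v = {x + y |x y. x \<in> cls u \<and> y \<in> cls v}"
    unfolding tensor_def FactGroup_def set_mult_def by auto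
  also have "\<dots> = cls (u + v)"
  proof (intro Set.set_eqI iffI)
    fix x assume "x \<in> cls (u + v)"
    then have "x = (x - v) + v" "x - v \<in> cls u" by (simp_all add: mem_cls algebra_simps)
    then show "x \<in> {x + y |x y. x \<in> cls u \<and> y \<in> cls v}" using cls_self by blast
  next
    fix z assume "z \<in> {x + y |x y. x \<in> cls u \<and> y \<in> cls v}"
    then obtain x y where z: "z = x + y" "x - u \<in> N" "y - v \<in> N" by (auto simp: mem_cls)
    show "z \<in> cls (u + v)" using N_add[OF z(2,3)] z(1) by (simp add: mem_cls algebra_simps)
  qed
  finally show ?thesis .
qed

text \<open>
  The scalar multiplication of \<open>tensor\<close> is a union over representatives; this is why all of them
  give the same coset.
\<close>

lemma smult_kernel:
  assumes "n \<in> N" "r \<in> carrier K"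
  shows "frag_extend (\<lambda>(a, b). frag_of (r \<odot>\<^bsub>A\<^esub> a, b)) n \<in> N"
  using assms(1)
proof (induction rule: N_induct)
  case (scalar s a b)
  have "r \<odot>\<^bsub>A\<^esub> (s \<odot>\<^bsub>A\<^esub> a) = s \<odot>\<^bsub>A\<^esub> (r \<odot>\<^bsub>A\<^esub> a)"
    using scalar assms(2) by (simp add: A.smult_assoc1[symmetric] A.R.m_comm)
  then show ?case using scalar assms(2) N_relation(3)[of s "r \<odot>\<^bsub>A\<^esub> a" b] by (simp add: frag_extend_diff)
next
  case (left a a' b)
  then show ?case using assms(2) N_relation(1)[of "r \<odot>\<^bsub>A\<^esub> a" "r \<odot>\<^bsub>A\<^esub> a'" b]
    by (simp add: frag_extend_diff A.smult_r_distr)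
next
  case (right a b b')
  then show ?case using assms(2) N_relation(2)[of "r \<odot>\<^bsub>A\<^esub> a" b b'] by (simp add: frag_extend_diff)
qed (simp_all add: N_zero N_diff frag_extend_diff)

lemma smult_cls:
  assumes "r \<in> carrier K"
  shows "r \<odot>\<^bsub>T\<^esub> cls u = cls (frag_extend (\<lambda>(a, b). frag_of (r \<odot>\<^bsub>A\<^esub> a, b)) u)"
proof -
  have "cls (frag_extend (\<lambda>(a, b). frag_of (r \<odot>\<^bsub>A\<^esub> a, b)) v) = cls (frag_extend (\<lambda>(a, b). frag_of (r \<odot>\<^bsub>A\<^esub> a, b)) u)"
    if "v \<in> cls u" for v
    using smult_kernel[OF that[unfolded mem_cls] assms] by (simp add: cls_eq frag_extend_diff)
  then have "(\<Union>v\<in>cls u. cls (frag_extend (\<lambda>(a, b). frag_of (r \<odot>\<^bsub>A\<^esub> a, b)) v))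
      = (\<Union>v\<in>cls u. cls (frag_extend (\<lambda>(a, b). frag_of (r \<odot>\<^bsub>A\<^esub> a, b)) u))"
    by (intro SUP_cong refl)
  also have "\<dots> = cls (frag_extend (\<lambda>(a, b). frag_of (r \<odot>\<^bsub>A\<^esub> a, b)) u)"
    by (rule cSUP_const) (use cls_self in blast)
  finally show ?thesis by (simp add: tensor_def Let_def)
qed

lemma pure_tensor_closed [simp, intro]:
  "a \<in> carrier A \<Longrightarrow> b \<in> carrier B \<Longrightarrow> pure_tensor K A B a b \<in> carrier T"
  unfolding pure_tensor_def by (rule cls_closed) (simp add: keys_frag_of)

lemma abelian_group_tensor: "abelian_group T"
proof (rule abelian_groupI)
  show "\<zero>\<^bsub>T\<^esub> \<in> carrier T" by (simp add: zero_tensor cls_closed)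
next
  fix x y assume "x \<in> carrier T" "y \<in> carrier T"
  then show "x \<oplus>\<^bsub>T\<^esub> y \<in> carrier T"
    by (elim tensor_cases) (auto simp: add_cls intro!: cls_closed dest!: subsetD[OF keys_add])
next
  fix x assume "x \<in> carrier T"
  then show "\<exists>y\<in>carrier T. y \<oplus>\<^bsub>T\<^esub> x = \<zero>\<^bsub>T\<^esub>"
  proof (rule tensor_cases)
    fix u assume "x = cls u" "Poly_Mapping.keys u \<subseteq> carrier A \<times> carrier B"
    then show ?thesis by (intro bexI[of _ "cls (- u)"]) (auto simp: add_cls zero_tensor intro!: cls_closed)
  qed
qed (elim tensor_cases; simp add: zero_tensor add_cls ac_simps)+

text \<open>
  Every element is a sum of pure tensors, because \<open>-(a \<otimes> b) = (-a) \<otimes> b\<close> and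
  \<open>0 = 0 \<otimes> 0\<close>.
\<close>

lemma tensor_induct [consumes 1, case_names pure add]:
  assumes "U \<in> carrier T"
    and pure: "\<And>a b. a \<in> carrier A \<Longrightarrow> b \<in> carrier B \<Longrightarrow> P (pure_tensor K A B a b)"
    and add: "\<And>U V. U \<in> carrier T \<Longrightarrow> V \<in> carrier T \<Longrightarrow> P U \<Longrightarrow> P V
      \<Longrightarrow> P (U \<oplus>\<^bsub>T\<^esub> V)"
  shows "P U"
proof -
  obtain u where u: "U = cls u" "Poly_Mapping.keys u \<subseteq> carrier A \<times> carrier B"
    using tensor_cases[OF assms(1)] .
  have zero_l: "frag_of (\<zero>\<^bsub>A\<^esub>, b) \<in> N" if "b \<in> carrier B" for b
    using N_uminus[OF N_relation(1)[of "\<zero>\<^bsub>A\<^esub>" "\<zero>\<^bsub>A\<^esub>" b]] that by simp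
  have minus: "cls (- frag_of (a, b)) = cls (frag_of (\<ominus>\<^bsub>A\<^esub> a, b))" if "a \<in> carrier A" "b \<in> carrier B" for a b
    using N_diff[OF N_relation(1)[of "\<ominus>\<^bsub>A\<^esub> a" a b] zero_l[of b]] that
    by (simp add: cls_eq A.M.l_neg algebra_simps)
  have Z: "P (cls 0)"
    using pure[of "\<zero>\<^bsub>A\<^esub>" "\<zero>\<^bsub>B\<^esub>"] zero_l[of "\<zero>\<^bsub>B\<^esub>"] cls_eq[of "frag_of (\<zero>\<^bsub>A\<^esub>, \<zero>\<^bsub>B\<^esub>)" 0]
    by (simp add: pure_tensor_def)
  have "Poly_Mapping.keys u \<subseteq> carrier A \<times> carrier B \<and> P (cls u) \<and> P (cls (- u))"
    using u(2)
  proof (induction u rule: frag_induction)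
    case zero then show ?case using Z by simp
  next
    case (one x)
    then obtain a b where x: "x = (a, b)" "a \<in> carrier A" "b \<in> carrier B" by auto
    then show ?case using pure[of a b] pure[of "\<ominus>\<^bsub>A\<^esub> a" b] minus[of a b]
      by (simp add: pure_tensor_def keys_frag_of)
  next
    case (diff u v)
    then have "P (cls u \<oplus>\<^bsub>T\<^esub> cls (- v))" "P (cls v \<oplus>\<^bsub>T\<^esub> cls (- u))"
      by (auto intro!: add cls_closed)
    moreover have "Poly_Mapping.keys (u - v) \<subseteq> carrier A \<times> carrier B"
      using diff keys_diff[of u v] by auto
    ultimately show ?case by (simp add: add_cls)
  qed
  then show ?thesis using u by simp
qed

lemma pure_add_left:
  "a \<in> carrier A \<Longrightarrow> a' \<in> carrier A \<Longrightarrow> b \<in> carrier B \<Longrightarrow>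
    pure_tensor K A B (a \<oplus>\<^bsub>A\<^esub> a') b = pure_tensor K A B a b \<oplus>\<^bsub>T\<^esub> pure_tensor K A B a' b"
  using N_relation(1)[of a a' b] by (simp add: pure_tensor_def add_cls cls_eq algebra_simps)

lemma pure_add_right:
  "a \<in> carrier A \<Longrightarrow> b \<in> carrier B \<Longrightarrow> b' \<in> carrier B \<Longrightarrow>
    pure_tensor K A B a (b \<oplus>\<^bsub>B\<^esub> b') = pure_tensor K A B a b \<oplus>\<^bsub>T\<^esub> pure_tensor K A B a b'"
  using N_relation(2)[of a b b'] by (simp add: pure_tensor_def add_cls cls_eq algebra_simps)

lemma pure_smult_left:
  "r \<in> carrier K \<Longrightarrow> a \<in> carrier A \<Longrightarrow> b \<in> carrier B \<Longrightarrow>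
    pure_tensor K A B (r \<odot>\<^bsub>A\<^esub> a) b = r \<odot>\<^bsub>T\<^esub> pure_tensor K A B a b"
  by (simp add: pure_tensor_def smult_cls)

lemma pure_smult_right:
  "r \<in> carrier K \<Longrightarrow> a \<in> carrier A \<Longrightarrow> b \<in> carrier B \<Longrightarrow>
    pure_tensor K A B a (r \<odot>\<^bsub>B\<^esub> b) = r \<odot>\<^bsub>T\<^esub> pure_tensor K A B a b"
  using N_relation(3)[of r a b] cls_eq[of "frag_of (r \<odot>\<^bsub>A\<^esub> a, b)" "frag_of (a, r \<odot>\<^bsub>B\<^esub> b)"]
    pure_smult_left[of r a b]
  by (simp add: pure_tensor_def)

lemma smult_add_tensor:
  "r \<in> carrier K \<Longrightarrow> U \<in> carrier T \<Longrightarrow> V \<in> carrier T \<Longrightarrow>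
   r \<odot>\<^bsub>T\<^esub> (U \<oplus>\<^bsub>T\<^esub> V) = r \<odot>\<^bsub>T\<^esub> U \<oplus>\<^bsub>T\<^esub> r \<odot>\<^bsub>T\<^esub> V"
  by (elim tensor_cases) (simp add: add_cls smult_cls frag_extend_add)

lemma smult_closed_tensor:
  assumes "r \<in> carrier K" "U \<in> carrier T"
  shows "r \<odot>\<^bsub>T\<^esub> U \<in> carrier T"
  using assms(2)
proof (induction rule: tensor_induct)
  case (pure a b) then show ?case using assms(1) by (simp flip: pure_smult_left)
next
  case (add U V) then show ?case
    using assms(1) abelian_group.axioms(1)[OF abelian_group_tensor] by (simp add: smult_add_tensor abelian_monoid.a_closed)
qed

lemma module_tensor: "module K T"
proof (rule moduleI)
  interpret T: abelian_group T by (rule abelian_group_tensor)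
  show "cring K" ..
  show "abelian_group T" ..
  fix a x assume a: "a \<in> carrier K" and x: "x \<in> carrier T"
  show "a \<odot>\<^bsub>T\<^esub> x \<in> carrier T" using a x by (rule smult_closed_tensor)
next
  fix a b x assume a: "a \<in> carrier K" "b \<in> carrier K" and x: "x \<in> carrier T"
  interpret T: abelian_group T by (rule abelian_group_tensor)
  show "(a \<oplus> b) \<odot>\<^bsub>T\<^esub> x = a \<odot>\<^bsub>T\<^esub> x \<oplus>\<^bsub>T\<^esub> b \<odot>\<^bsub>T\<^esub> x"
    using x
  proof (induction rule: tensor_induct)
    case (pure u v) then show ?case using a by (simp flip: pure_smult_left pure_add_left add: A.smult_l_distr)
  next
    case (add U V) then show ?case using a
      by (simp add: smult_add_tensor smult_closed_tensor T.a_ac)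
  qed
  show "(a \<otimes> b) \<odot>\<^bsub>T\<^esub> x = a \<odot>\<^bsub>T\<^esub> (b \<odot>\<^bsub>T\<^esub> x)"
    using x
  proof (induction rule: tensor_induct)
    case (pure u v) then show ?case using a by (simp flip: pure_smult_left add: A.smult_assoc1)
  next
    case (add U V) then show ?case using a by (simp add: smult_add_tensor smult_closed_tensor)
  qed
next
  fix x assume "x \<in> carrier T"
  then show "\<one> \<odot>\<^bsub>T\<^esub> x = x"
  proof (induction rule: tensor_induct)
    case (pure u v) then show ?case by (simp flip: pure_smult_left)
  next
    case (add U V) then show ?case by (simp add: smult_add_tensor)
  qed
qed (use smult_add_tensor in auto)

end

lemma linear_mapD:
  assumes "linear_map K A B f"
  shows "x \<in> carrier A \<Longrightarrow> f x \<in> carrier B"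
    and "x \<in> carrier A \<Longrightarrow> y \<in> carrier A \<Longrightarrow> f (x \<oplus>\<^bsub>A\<^esub> y) = f x \<oplus>\<^bsub>B\<^esub> f y"
    and "r \<in> carrier K \<Longrightarrow> x \<in> carrier A \<Longrightarrow> f (r \<odot>\<^bsub>A\<^esub> x) = r \<odot>\<^bsub>B\<^esub> f x"
  using assms by (auto simp: linear_map_def)

lemma linear_mapI:
  assumes "\<And>x. x \<in> carrier A \<Longrightarrow> f x \<in> carrier B"
    and "\<And>x y. x \<in> carrier A \<Longrightarrow> y \<in> carrier A \<Longrightarrow> f (x \<oplus>\<^bsub>A\<^esub> y) = f x \<oplus>\<^bsub>B\<^esub> f y"
    and "\<And>r x. r \<in> carrier K \<Longrightarrow> x \<in> carrier A \<Longrightarrow> f (r \<odot>\<^bsub>A\<^esub> x) = r \<odot>\<^bsub>B\<^esub> f x"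
  shows "linear_map K A B f"
  using assms by (auto simp: linear_map_def)

lemma bilinear_mapD:
  assumes "bilinear_map K A B M f"
  shows "a \<in> carrier A \<Longrightarrow> linear_map K B M (f a)"
    and "b \<in> carrier B \<Longrightarrow> linear_map K A M (\<lambda>a. f a b)"
    and "a \<in> carrier A \<Longrightarrow> b \<in> carrier B \<Longrightarrow> f a b \<in> carrier M"
  using assms linear_mapD(1) unfolding bilinear_map_def by fastforce+

context module_pair
begin

context
  fixes M :: "('k, 'd, 'o) module_scheme" and f
  assumes M: "module K M" and f: "bilinear_map K A B M f"
begin

interpretation M: module K M by (rule M)

lemma lift_funcset: "(\<lambda>p. f (fst p) (snd p)) \<in> carrier A \<times> carrier B \<rightarrow> carrier M"
  using bilinear_mapD(3)[OF f] by auto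

lemmas eval_diff = M.M.frag_eval_diff[OF _ _ lift_funcset]
lemmas eval_add = M.M.frag_eval_add[OF _ _ lift_funcset]
lemmas eval_closed = M.M.frag_eval_closed[OF _ lift_funcset]

text \<open>
  A bilinear map annihilates the three kinds of relations. So \<open>frag_eval\<close> is constant on cosets, and the
  set whose unique element \<open>tensor_lift\<close> picks is indeed a singleton.
\<close>

lemma eval_kernel:
  assumes "n \<in> N" shows "frag_eval M (\<lambda>p. f (fst p) (snd p)) n = \<zero>\<^bsub>M\<^esub>"
  using assms
proof (induction rule: N_induct)
  case (left a a' b)
  note l = bilinear_mapD(2)[OF f \<open>b \<in> carrier B\<close>]
  show ?case using left bilinear_mapD(3)[OF f]
    by (simp add: eval_diff keys_relation_subset keys_frag_of M.M.frag_eval_of linear_mapD(2)[OF l]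
      a_minus_def M.M.a_ac M.M.r_neg M.M.r_neg1 M.M.r_neg2)
next
  case (right a b b')
  note l = bilinear_mapD(1)[OF f \<open>a \<in> carrier A\<close>]
  show ?case using right bilinear_mapD(3)[OF f]
    by (simp add: eval_diff keys_relation_subset keys_frag_of M.M.frag_eval_of linear_mapD(2)[OF l]
      a_minus_def M.M.a_ac M.M.r_neg M.M.r_neg1 M.M.r_neg2)
next
  case (scalar r a b)
  show ?case using scalar bilinear_mapD(3)[OF f]
    linear_mapD(3)[OF bilinear_mapD(1)[OF f \<open>a \<in> carrier A\<close>]] linear_mapD(3)[OF bilinear_mapD(2)[OF f \<open>b \<in> carrier B\<close>]]
    by (simp add: eval_diff keys_relation_subset keys_frag_of M.M.frag_eval_of a_minus_def M.M.r_neg)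
qed (auto simp: M.M.frag_eval_zero eval_diff N_keys a_minus_def)

lemma tensor_lift_cls:
  assumes u: "Poly_Mapping.keys u \<subseteq> carrier A \<times> carrier B"
  shows "tensor_lift M f (cls u) = frag_eval M (\<lambda>p. f (fst p) (snd p)) u"
proof -
  have "frag_eval M (\<lambda>p. f (fst p) (snd p)) v = frag_eval M (\<lambda>p. f (fst p) (snd p)) u" if "v \<in> cls u" for v
    using eval_add[of "v - u" u] N_keys[of "v - u"] u that eval_kernel[of "v - u"] eval_closed[OF u] by (simp add: mem_cls)
  then have "frag_eval M (\<lambda>p. f (fst p) (snd p)) ` cls u
      = (\<lambda>_. frag_eval M (\<lambda>p. f (fst p) (snd p)) u) ` cls u"
    by (intro image_cong refl)
  also have "\<dots> = {frag_eval M (\<lambda>p. f (fst p) (snd p)) u}"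
    by (rule image_constant[OF cls_self])
  finally have "frag_eval M (\<lambda>p. f (fst p) (snd p)) ` cls u = {frag_eval M (\<lambda>p. f (fst p) (snd p)) u}" .
  then show ?thesis unfolding tensor_lift_def frag_eval_def by simp
qed

lemma tensor_lift_pure:
  "a \<in> carrier A \<Longrightarrow> b \<in> carrier B \<Longrightarrow> tensor_lift M f (pure_tensor K A B a b) = f a b"
  unfolding pure_tensor_def using bilinear_mapD(3)[OF f]
  by (subst tensor_lift_cls) (auto simp: keys_frag_of M.M.frag_eval_of)

lemma tensor_lift_add:
  "U \<in> carrier T \<Longrightarrow> V \<in> carrier T \<Longrightarrow>
    tensor_lift M f (U \<oplus>\<^bsub>T\<^esub> V) = tensor_lift M f U \<oplus>\<^bsub>M\<^esub> tensor_lift M f V"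
  by (elim tensor_cases)
    (simp add: add_cls tensor_lift_cls eval_add order_trans[OF keys_add])

lemma tensor_lift_linear: "linear_map K T M (tensor_lift M f)"
proof (rule linear_mapI)
  interpret T: module K T by (rule module_tensor)
  show cl: "tensor_lift M f U \<in> carrier M" if "U \<in> carrier T" for U
    using that by (elim tensor_cases) (simp add: tensor_lift_cls eval_closed)
  show "tensor_lift M f (r \<odot>\<^bsub>T\<^esub> U) = r \<odot>\<^bsub>M\<^esub> tensor_lift M f U"
    if r: "r \<in> carrier K" and U: "U \<in> carrier T" for r U
    using U
  proof (induction rule: tensor_induct)
    case (pure a b)
    then show ?case using r linear_mapD(3)[OF bilinear_mapD(2)[OF f \<open>b \<in> carrier B\<close>]]
      by (simp flip: pure_smult_left add: tensor_lift_pure)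
  next
    case (add U V)
    then show ?case using r by (simp add: smult_add_tensor tensor_lift_add cl M.smult_r_distr)
  qed
qed (rule tensor_lift_add)

end

lemma tensor_lift_cong:
  assumes "U \<in> carrier T" and M: "module K M"
    and "\<And>a b. a \<in> carrier A \<Longrightarrow> b \<in> carrier B \<Longrightarrow> f a b = g a b"
    and "\<And>a b. a \<in> carrier A \<Longrightarrow> b \<in> carrier B \<Longrightarrow> g a b \<in> carrier M"
  shows "tensor_lift M f U = tensor_lift M g U"
proof -
  interpret M: module K M by (rule M)
  obtain u where u: "U = cls u" "Poly_Mapping.keys u \<subseteq> carrier A \<times> carrier B"
    using tensor_cases[OF assms(1)] .
  have "(\<lambda>v. \<Oplus>\<^bsub>M\<^esub>p\<in>Poly_Mapping.keys v. add_pow M (Poly_Mapping.lookup v p) (f (fst p) (snd p))) ` U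
      = (\<lambda>v. \<Oplus>\<^bsub>M\<^esub>p\<in>Poly_Mapping.keys v. add_pow M (Poly_Mapping.lookup v p) (g (fst p) (snd p))) ` U"
  proof (rule image_cong)
    fix v assume "v \<in> U"
    then have kv: "Poly_Mapping.keys v \<subseteq> carrier A \<times> carrier B" using mem_cls_keys u by simp
    have sub: "fst p \<in> carrier A \<and> snd p \<in> carrier B" if "p \<in> Poly_Mapping.keys v" for p
      using subsetD[OF kv that] by (auto simp: mem_Times_iff)
    have *: "f (fst p) (snd p) = g (fst p) (snd p)" "g (fst p) (snd p) \<in> carrier M"
      if "p \<in> Poly_Mapping.keys v" for p
      using sub[OF that] assms(3,4) by simp_all
    show "(\<Oplus>\<^bsub>M\<^esub>p\<in>Poly_Mapping.keys v. add_pow M (Poly_Mapping.lookup v p) (f (fst p) (snd p)))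
      = (\<Oplus>\<^bsub>M\<^esub>p\<in>Poly_Mapping.keys v. add_pow M (Poly_Mapping.lookup v p) (g (fst p) (snd p)))"
      by (rule M.M.finsum_cong') (simp_all add: * M.M.add.int_pow_closed Pi_iff)
  qed simp
  then show ?thesis by (simp add: tensor_lift_def)
qed

text \<open>
  The uniqueness half of the universal property.
\<close>

lemma tensor_map_eqI:
  assumes f: "linear_map K T M f" and g: "linear_map K T M g"
    and pure: "\<And>a b. a \<in> carrier A \<Longrightarrow> b \<in> carrier B \<Longrightarrow> f (pure_tensor K A B a b) = g (pure_tensor K A B a b)"
    and U: "U \<in> carrier T"
  shows "f U = g U"
  using U by (induction rule: tensor_induct) (simp_all add: pure linear_mapD[OF f] linear_mapD[OF g])

end

section \<open>Linear maps between tensor products\<close>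

lemmas module_tensor = module_pair.module_tensor[OF module_pairI]
lemmas pure_tensor_closed = module_pair.pure_tensor_closed[OF module_pairI]
lemmas tensor_map_eqI = module_pair.tensor_map_eqI[OF module_pairI]
lemmas tensor_lift_pure = module_pair.tensor_lift_pure[OF module_pairI]
lemmas tensor_lift_linear = module_pair.tensor_lift_linear[OF module_pairI]
lemmas tensor_lift_cong = module_pair.tensor_lift_cong[OF module_pairI]

lemma unital_algebra_module: "unital_algebra K A \<Longrightarrow> module K A"
  by (simp add: unital_algebra_def)

lemma scalar_algebra_simps [simp]:
  "carrier (scalar_algebra K) = carrier K"
  "x \<otimes>\<^bsub>scalar_algebra K\<^esub> y = x \<otimes>\<^bsub>K\<^esub> y"
  "\<one>\<^bsub>scalar_algebra K\<^esub> = \<one>\<^bsub>K\<^esub>" "\<zero>\<^bsub>scalar_algebra K\<^esub> = \<zero>\<^bsub>K\<^esub>"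
  "x \<oplus>\<^bsub>scalar_algebra K\<^esub> y = x \<oplus>\<^bsub>K\<^esub> y"
  "x \<odot>\<^bsub>scalar_algebra K\<^esub> y = x \<otimes>\<^bsub>K\<^esub> y"
  by (simp_all add: scalar_algebra_def)

lemma unital_algebra_scalar:
  assumes "field K" shows "unital_algebra K (scalar_algebra K)"
proof -
  interpret K: field K by fact
  have "ring (scalar_algebra K)"
  proof (rule ringI)
    show "abelian_group (scalar_algebra K)"
      by (rule abelian_groupI) (auto simp: K.a_ac intro: K.add.l_inv_ex)
    show "Group.monoid (scalar_algebra K)"
      by (rule Group.monoid.intro) (auto simp: K.m_assoc)
  qed (auto simp: K.l_distr K.r_distr)
  moreover have "module K (scalar_algebra K)"
    by (rule moduleI) (use calculation in \<open>auto simp: ring_def K.l_distr K.r_distr K.m_assoc K.cring_axioms\<close>)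
  ultimately show ?thesis
    by (auto simp: unital_algebra_def unital_algebra_axioms_def assms K.m_ac)
qed

text \<open>
  A lift uses only the additive group of its target. So the field may be a ring or a module over itself,
  which are records of different types, and \<open>H\<close> may be replaced by its opposite.
\<close>

lemma tensor_lift_target_cong:
  assumes "carrier M = carrier M'" "ring.add M = ring.add M'" "\<zero>\<^bsub>M\<^esub> = \<zero>\<^bsub>M'\<^esub>"
  shows "tensor_lift M = tensor_lift M'"
  using assms by (intro ext) (simp add: tensor_lift_def finsum_def add_pow_def
    finprod_def int_pow_def nat_pow_def m_inv_def Let_def cong: if_cong)

lemma tensor_lift_scalar: "tensor_lift K = tensor_lift (scalar_algebra K)"
  by (rule tensor_lift_target_cong) (simp_all add: scalar_algebra_def)

lemma linear_id: "linear_map K A A (\<lambda>x. x)"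
  by (simp add: linear_map_def)

lemma linear_compose: "linear_map K B C g \<Longrightarrow> linear_map K A B f \<Longrightarrow> linear_map K A C (\<lambda>x. g (f x))"
  by (auto simp: linear_map_def Pi_iff)

lemma linear_cong:
  assumes "module K A" "linear_map K A B f" "\<And>x. x \<in> carrier A \<Longrightarrow> g x = f x"
  shows "linear_map K A B g"
proof -
  interpret module K A by fact
  show ?thesis using assms(2,3) by (auto simp: linear_map_def Pi_iff)
qed

lemma linear_smult_right:
  assumes "module K M" "r \<in> carrier K" "linear_map K A M f"
  shows "linear_map K A M (\<lambda>x. r \<odot>\<^bsub>M\<^esub> f x)"
proof -
  interpret M: module K M by fact
  show ?thesis using assms(2,3)
    by (auto simp: linear_map_def Pi_iff M.smult_r_distr M.smult_assoc1[symmetric] M.R.m_comm)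
qed

lemma linear_smult_left:
  assumes "module K M" "m \<in> carrier M" "linear_map K A (scalar_algebra K) f"
  shows "linear_map K A M (\<lambda>x. f x \<odot>\<^bsub>M\<^esub> m)"
proof -
  interpret M: module K M by fact
  show ?thesis using assms(2,3)
    by (auto simp: linear_map_def Pi_iff M.smult_l_distr M.smult_assoc1)
qed

lemma linear_mult:
  assumes "unital_algebra K B" "b \<in> carrier B" "linear_map K A B f"
  shows "linear_map K A B (\<lambda>x. f x \<otimes>\<^bsub>B\<^esub> b)" "linear_map K A B (\<lambda>x. b \<otimes>\<^bsub>B\<^esub> f x)"
proof -
  interpret B: unital_algebra K B by fact
  show "linear_map K A B (\<lambda>x. f x \<otimes>\<^bsub>B\<^esub> b)" "linear_map K A B (\<lambda>x. b \<otimes>\<^bsub>B\<^esub> f x)" using assms(2,3)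
    by (auto simp: linear_map_def Pi_iff B.A.l_distr B.A.r_distr B.smult_mult_left B.smult_mult_right)
qed

lemma linear_scalar_mult:
  assumes "field K" "b \<in> carrier K" "linear_map K A (scalar_algebra K) f"
  shows "linear_map K A (scalar_algebra K) (\<lambda>x. f x \<otimes>\<^bsub>K\<^esub> b)"
    "linear_map K A (scalar_algebra K) (\<lambda>x. b \<otimes>\<^bsub>K\<^esub> f x)"
  using linear_mult[OF unital_algebra_scalar[OF assms(1)], of b A f] assms by auto

lemma linear_pure:
  assumes "module K A" "module K B"
  shows "b \<in> carrier B \<Longrightarrow> linear_map K C A f \<Longrightarrow> linear_map K C (tensor K A B) (\<lambda>x. pure_tensor K A B (f x) b)"
    and "a \<in> carrier A \<Longrightarrow> linear_map K C B g \<Longrightarrow> linear_map K C (tensor K A B) (\<lambda>x. pure_tensor K A B a (g x))"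
proof -
  interpret module_pair K A B using assms by simp
  show "b \<in> carrier B \<Longrightarrow> linear_map K C A f \<Longrightarrow> linear_map K C (tensor K A B) (\<lambda>x. pure_tensor K A B (f x) b)"
    "a \<in> carrier A \<Longrightarrow> linear_map K C B g \<Longrightarrow> linear_map K C (tensor K A B) (\<lambda>x. pure_tensor K A B a (g x))"
    by (auto simp: linear_map_def Pi_iff pure_add_left pure_add_right pure_smult_left pure_smult_right)
qed

lemma bilinear_mapI:
  assumes "\<And>a. a \<in> carrier A \<Longrightarrow> linear_map K B M (\<lambda>b. f a b)"
    and "\<And>b. b \<in> carrier B \<Longrightarrow> linear_map K A M (\<lambda>a. f a b)"
  shows "bilinear_map K A B M f"
  using assms by (simp add: bilinear_map_def)

lemma bilinear_compose:
  "bilinear_map K A B M f \<Longrightarrow> linear_map K C A u \<Longrightarrow> linear_map K D B v \<Longrightarrow>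
    bilinear_map K C D M (\<lambda>c d. f (u c) (v d))"
  by (intro bilinear_mapI)
    (blast intro: linear_compose[OF bilinear_mapD(1)] linear_compose[OF bilinear_mapD(2)] linear_mapD(1))+

lemma linear_bilinear_compose:
  "linear_map K M M' g \<Longrightarrow> bilinear_map K A B M f \<Longrightarrow> bilinear_map K A B M' (\<lambda>a b. g (f a b))"
  by (intro bilinear_mapI) (auto intro!: linear_compose[of K M M' g] dest: bilinear_mapD)

lemma bilinear_pure: "module K A \<Longrightarrow> module K B \<Longrightarrow> bilinear_map K A B (tensor K A B) (pure_tensor K A B)"
  by (intro bilinear_mapI linear_pure linear_id)

lemma linear_lift:
  "module K A \<Longrightarrow> module K B \<Longrightarrow> module K M \<Longrightarrow> bilinear_map K A B M f \<Longrightarrow> linear_map K C (tensor K A B) g \<Longrightarrow>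
    linear_map K C M (\<lambda>x. tensor_lift M f (g x))"
  by (rule linear_compose[OF tensor_lift_linear])

lemma tensor_lift_closed:
  "module K A \<Longrightarrow> module K B \<Longrightarrow> module K M \<Longrightarrow> bilinear_map K A B M f \<Longrightarrow> U \<in> carrier (tensor K A B) \<Longrightarrow>
    tensor_lift M f U \<in> carrier M"
  by (rule linear_mapD(1)[OF tensor_lift_linear])

text \<open>
  In iterated Sweedler sums the inner sum depends on the outer summation variables; this lemma supplies
  the linearity in those variables.
\<close>

lemma linear_lift_param:
  assumes A: "module K A" and B: "module K B" and M: "module K M" and C: "module K C"
    and bil: "\<And>x. x \<in> carrier C \<Longrightarrow> bilinear_map K A B M (F x)"
    and lin: "\<And>a b. a \<in> carrier A \<Longrightarrow> b \<in> carrier B \<Longrightarrow> linear_map K C M (\<lambda>x. F x a b)"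
    and U: "U \<in> carrier (tensor K A B)"
  shows "linear_map K C M (\<lambda>x. tensor_lift M (F x) U)"
proof -
  interpret module_pair K A B using A B by simp
  interpret M: module K M by fact
  interpret C: module K C by fact
  note l = tensor_lift_linear[OF M bil]
  note p = tensor_lift_pure[OF M bil]
  show ?thesis
  proof (rule linear_mapI)
    show "tensor_lift M (F x) U \<in> carrier M" if "x \<in> carrier C" for x
      by (rule linear_mapD(1)[OF l[OF that] U])
    show "tensor_lift M (F (x \<oplus>\<^bsub>C\<^esub> y)) U = tensor_lift M (F x) U \<oplus>\<^bsub>M\<^esub> tensor_lift M (F y) U"
      if x: "x \<in> carrier C" and y: "y \<in> carrier C" for x y
      using U
    proof (induction rule: tensor_induct)
      case (pure a b)
      then show ?case using x y by (simp add: p linear_mapD(2)[OF lin])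
    next
      case (add U V)
      then show ?case using x y
        by (simp add: linear_mapD(1,2)[OF l] M.M.a_ac)
    qed
    show "tensor_lift M (F (r \<odot>\<^bsub>C\<^esub> x)) U = r \<odot>\<^bsub>M\<^esub> tensor_lift M (F x) U"
      if x: "x \<in> carrier C" and r: "r \<in> carrier K" for x r
      using U
    proof (induction rule: tensor_induct)
      case (pure a b)
      then show ?case using x r by (simp add: p linear_mapD(3)[OF lin])
    next
      case (add U V)
      then show ?case using x r
        by (simp add: linear_mapD(1,2)[OF l] M.smult_r_distr)
    qed
  qed
qed

text \<open>
  A linear map may be applied inside a Sweedler sum.
\<close>

lemma linear_tensor_lift:
  assumes "module K A" "module K B" "module K M" "module K M'" "bilinear_map K A B M f"
    "linear_map K M M' g" "U \<in> carrier (tensor K A B)"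
  shows "g (tensor_lift M f U) = tensor_lift M' (\<lambda>a b. g (f a b)) U"
  by (rule tensor_map_eqI[OF assms(1,2) _ _ _ assms(7)])
    (use assms in \<open>auto intro!: linear_compose[OF assms(6)] tensor_lift_linear linear_bilinear_compose[OF assms(6)]
      simp: tensor_lift_pure linear_bilinear_compose\<close>)

lemma tensor_map_linear:
  assumes "module K A" "module K B" "module K C" "module K D" "linear_map K A C f" "linear_map K B D g"
  shows "linear_map K (tensor K A B) (tensor K C D) (tensor_map K C D f g)"
  unfolding tensor_map_def
  by (intro tensor_lift_linear module_tensor bilinear_compose[OF bilinear_pure] assms)

lemma tensor_map_pure:
  assumes "module K A" "module K B" "module K C" "module K D" "linear_map K A C f" "linear_map K B D g"
    and "a \<in> carrier A" "b \<in> carrier B"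
  shows "tensor_map K C D f g (pure_tensor K A B a b) = pure_tensor K C D (f a) (g b)"
  unfolding tensor_map_def
  by (intro tensor_lift_pure module_tensor bilinear_compose[OF bilinear_pure] assms)

lemma tensor_lift_tensor_map:
  assumes "module K A" "module K B" "module K C" "module K D" "module K M" "linear_map K A C f" "linear_map K B D g"
    and "bilinear_map K C D M k" and U: "U \<in> carrier (tensor K A B)"
  shows "tensor_lift M k (tensor_map K C D f g U) = tensor_lift M (\<lambda>a b. k (f a) (g b)) U"
  unfolding tensor_map_def
  by (subst linear_tensor_lift[where M'=M and K=K and g="tensor_lift M k" and A=A and B=B])
    (use assms in \<open>auto intro!: module_tensor bilinear_compose[OF bilinear_pure] tensor_lift_linear
      module_pair.tensor_lift_cong[where K=K and A=A and B=B] simp: tensor_lift_pure linear_mapD bilinear_mapD\<close>)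

lemma flip_bilinear: "module K A \<Longrightarrow> module K B \<Longrightarrow> bilinear_map K A B (tensor K B A) (\<lambda>a b. pure_tensor K B A b a)"
  by (intro bilinear_mapI linear_pure linear_id)

lemma tensor_flip_linear:
  "module K A \<Longrightarrow> module K B \<Longrightarrow> linear_map K (tensor K A B) (tensor K B A) (tensor_flip K A B)"
  unfolding tensor_flip_def by (intro tensor_lift_linear module_tensor flip_bilinear)

lemma tensor_flip_pure:
  "module K A \<Longrightarrow> module K B \<Longrightarrow> a \<in> carrier A \<Longrightarrow> b \<in> carrier B \<Longrightarrow>
    tensor_flip K A B (pure_tensor K A B a b) = pure_tensor K B A b a"
  unfolding tensor_flip_def by (intro tensor_lift_pure module_tensor flip_bilinear)

lemma tensor_assoc_bilinear:
  assumes "module K A" "module K B" "module K C"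
  shows "a \<in> carrier A \<Longrightarrow> bilinear_map K B C (tensor K (tensor K A B) C)
      (\<lambda>b c. pure_tensor K (tensor K A B) C (pure_tensor K A B a b) c)"
    and "bilinear_map K A (tensor K B C) (tensor K (tensor K A B) C)
      (\<lambda>a. tensor_lift (tensor K (tensor K A B) C) (\<lambda>b c. pure_tensor K (tensor K A B) C (pure_tensor K A B a b) c))"
proof -
  show *: "bilinear_map K B C (tensor K (tensor K A B) C)
      (\<lambda>b c. pure_tensor K (tensor K A B) C (pure_tensor K A B a b) c)" if "a \<in> carrier A" for a
    using that by (intro bilinear_mapI linear_pure linear_id module_tensor pure_tensor_closed assms)
  show "bilinear_map K A (tensor K B C) (tensor K (tensor K A B) C)
      (\<lambda>a. tensor_lift (tensor K (tensor K A B) C) (\<lambda>b c. pure_tensor K (tensor K A B) C (pure_tensor K A B a b) c))"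
  proof (rule bilinear_mapI)
    fix U assume "U \<in> carrier (tensor K B C)"
    then show "linear_map K A (tensor K (tensor K A B) C) (\<lambda>a. tensor_lift (tensor K (tensor K A B) C)
        (\<lambda>b c. pure_tensor K (tensor K A B) C (pure_tensor K A B a b) c) U)"
      by (intro linear_lift_param[where A=B and B=C] * linear_pure linear_id module_tensor pure_tensor_closed assms)
  qed (intro * tensor_lift_linear module_tensor assms)
qed

lemma tensor_assoc_linear:
  "module K A \<Longrightarrow> module K B \<Longrightarrow> module K C \<Longrightarrow>
    linear_map K (tensor K A (tensor K B C)) (tensor K (tensor K A B) C) (tensor_assoc K A B C)"
  unfolding tensor_assoc_def by (intro tensor_lift_linear module_tensor tensor_assoc_bilinear)

lemma tensor_assoc_pure_lift:
  "module K A \<Longrightarrow> module K B \<Longrightarrow> module K C \<Longrightarrow> a \<in> carrier A \<Longrightarrow> U \<in> carrier (tensor K B C) \<Longrightarrow>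
    tensor_assoc K A B C (pure_tensor K A (tensor K B C) a U) =
    tensor_lift (tensor K (tensor K A B) C) (\<lambda>b c. pure_tensor K (tensor K A B) C (pure_tensor K A B a b) c) U"
  unfolding tensor_assoc_def by (intro tensor_lift_pure module_tensor tensor_assoc_bilinear)

lemma tensor_assoc_pure:
  "module K A \<Longrightarrow> module K B \<Longrightarrow> module K C \<Longrightarrow> a \<in> carrier A \<Longrightarrow> b \<in> carrier B \<Longrightarrow> c \<in> carrier C \<Longrightarrow>
    tensor_assoc K A B C (pure_tensor K A (tensor K B C) a (pure_tensor K B C b c)) =
    pure_tensor K (tensor K A B) C (pure_tensor K A B a b) c"
  by (simp add: tensor_assoc_pure_lift pure_tensor_closed tensor_lift_pure module_tensor tensor_assoc_bilinear)

lemma linear_map_finsum: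
  assumes A: "module K A" and M: "module K M" and f: "linear_map K A M f" and "g \<in> I \<rightarrow> carrier A"
  shows "f (\<Oplus>\<^bsub>A\<^esub>i\<in>I. g i) = (\<Oplus>\<^bsub>M\<^esub>i\<in>I. f (g i))"
proof -
  interpret A: module K A by fact
  interpret M: module K M by fact
  have "f (\<zero>\<^bsub>K\<^esub> \<odot>\<^bsub>A\<^esub> \<zero>\<^bsub>A\<^esub>) = \<zero>\<^bsub>K\<^esub> \<odot>\<^bsub>M\<^esub> f \<zero>\<^bsub>A\<^esub>"
    by (rule linear_mapD(3)[OF f]) simp_all
  then have zero: "f \<zero>\<^bsub>A\<^esub> = \<zero>\<^bsub>M\<^esub>" using linear_mapD(1)[OF f, of "\<zero>\<^bsub>A\<^esub>"] by simp
  show ?thesis using assms(4)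
  proof (induction I rule: infinite_finite_induct)
    case (insert x F)
    then show ?case
      by (simp add: Pi_iff linear_mapD[OF f] A.M.finsum_insert A.M.finsum_closed M.M.finsum_insert)
  qed (simp_all add: zero)
qed

lemma linear_finsum:
  assumes A: "module K A" and M: "module K M" and F: "\<And>i. i \<in> I \<Longrightarrow> linear_map K A M (F i)" and "finite I"
  shows "linear_map K A M (\<lambda>x. \<Oplus>\<^bsub>M\<^esub>i\<in>I. F i x)"
proof -
  interpret A: module K A by fact
  interpret M: module K M by fact
  show ?thesis
  proof (rule linear_mapI)
    fix x assume x: "x \<in> carrier A"
    show "(\<Oplus>\<^bsub>M\<^esub>i\<in>I. F i x) \<in> carrier M" using x linear_mapD(1)[OF F] by (intro M.M.finsum_closed) auto
    fix y assume y: "y \<in> carrier A"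
    have "(\<Oplus>\<^bsub>M\<^esub>i\<in>I. F i (x \<oplus>\<^bsub>A\<^esub> y)) = (\<Oplus>\<^bsub>M\<^esub>i\<in>I. F i x \<oplus>\<^bsub>M\<^esub> F i y)"
      using x y linear_mapD(1)[OF F] by (intro M.M.finsum_cong') (auto simp: linear_mapD(2)[OF F])
    then show "(\<Oplus>\<^bsub>M\<^esub>i\<in>I. F i (x \<oplus>\<^bsub>A\<^esub> y)) = (\<Oplus>\<^bsub>M\<^esub>i\<in>I. F i x) \<oplus>\<^bsub>M\<^esub> (\<Oplus>\<^bsub>M\<^esub>i\<in>I. F i y)"
      using x y linear_mapD(1)[OF F] by (simp add: M.M.finsum_addf)
  next
    fix r x assume r: "r \<in> carrier K" and x: "x \<in> carrier A"
    have "(\<Oplus>\<^bsub>M\<^esub>i\<in>I. F i (r \<odot>\<^bsub>A\<^esub> x)) = (\<Oplus>\<^bsub>M\<^esub>i\<in>I. r \<odot>\<^bsub>M\<^esub> F i x)"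
      using x r linear_mapD(1)[OF F] by (intro M.M.finsum_cong') (auto simp: linear_mapD(3)[OF F])
    also have "\<dots> = r \<odot>\<^bsub>M\<^esub> (\<Oplus>\<^bsub>M\<^esub>i\<in>I. F i x)"
      using x r linear_mapD(1)[OF F] by (intro M.finsum_smult_ldistr[symmetric] \<open>finite I\<close>) auto
    finally show "(\<Oplus>\<^bsub>M\<^esub>i\<in>I. F i (r \<odot>\<^bsub>A\<^esub> x)) = r \<odot>\<^bsub>M\<^esub> (\<Oplus>\<^bsub>M\<^esub>i\<in>I. F i x)" .
  qed
qed

definition trilinear_map where
  "trilinear_map K A B C M g \<longleftrightarrow>
     (\<forall>a\<in>carrier A. bilinear_map K B C M (g a)) \<and> (\<forall>c\<in>carrier C. bilinear_map K A B M (\<lambda>a b. g a b c))"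

lemma trilinear_mapI:
  assumes "\<And>a b. a \<in> carrier A \<Longrightarrow> b \<in> carrier B \<Longrightarrow> linear_map K C M (\<lambda>c. g a b c)"
    and "\<And>a c. a \<in> carrier A \<Longrightarrow> c \<in> carrier C \<Longrightarrow> linear_map K B M (\<lambda>b. g a b c)"
    and "\<And>b c. b \<in> carrier B \<Longrightarrow> c \<in> carrier C \<Longrightarrow> linear_map K A M (\<lambda>a. g a b c)"
  shows "trilinear_map K A B C M g"
  using assms by (simp add: trilinear_map_def bilinear_map_def)

context
  fixes K :: "('k, 'c) ring_scheme" and A :: "('k, 'a, 'm) module_scheme" and B :: "('k, 'b, 'n) module_scheme"
    and C :: "('k, 'e, 'o) module_scheme" and M :: "('k, 'd, 'p) module_scheme" and g
  assumes A: "module K A" and B: "module K B" and C: "module K C" and M: "module K M"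
    and g: "trilinear_map K A B C M g"
begin

lemma trilinear_left_bilinear:
  "bilinear_map K (tensor K A B) C M (\<lambda>u c. tensor_lift M (\<lambda>a b. g a b c) u)"
  using g unfolding trilinear_map_def
  by (intro bilinear_mapI linear_lift_param[OF A B M C] tensor_lift_linear A B M)
    (auto dest: bilinear_mapD)

lemma trilinear_right_bilinear:
  "bilinear_map K A (tensor K B C) M (\<lambda>a v. tensor_lift M (g a) v)"
  using g unfolding trilinear_map_def
  by (intro bilinear_mapI linear_lift_param[OF B C M A] tensor_lift_linear B C M)
    (auto dest: bilinear_mapD)

lemma tensor_lift_assoc:
  assumes t: "t \<in> carrier (tensor K A (tensor K B C))"
  shows "tensor_lift M (\<lambda>u c. tensor_lift M (\<lambda>a b. g a b c) u) (tensor_assoc K A B C t) =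
    tensor_lift M (\<lambda>a v. tensor_lift M (g a) v) t"
proof -
  note AB = module_tensor[OF A B] and BC = module_tensor[OF B C]
  note l1 = tensor_lift_linear[OF AB C M trilinear_left_bilinear]
  note l2 = tensor_lift_linear[OF A BC M trilinear_right_bilinear]
  show ?thesis
  proof (rule tensor_map_eqI[OF A BC linear_compose[OF l1 tensor_assoc_linear[OF A B C]] l2 _ t])
    fix a v assume a: "a \<in> carrier A" and v: "v \<in> carrier (tensor K B C)"
    have ga: "bilinear_map K B C M (g a)" using g a by (simp add: trilinear_map_def)
    have gc: "c \<in> carrier C \<Longrightarrow> bilinear_map K A B M (\<lambda>a b. g a b c)" for c using g by (simp add: trilinear_map_def)
    have "tensor_lift M (\<lambda>u c. tensor_lift M (\<lambda>a b. g a b c) u) (tensor_assoc K A B C (pure_tensor K A (tensor K B C) a v))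
      = tensor_lift M (\<lambda>b c. tensor_lift M (\<lambda>u c. tensor_lift M (\<lambda>a b. g a b c) u)
          (pure_tensor K (tensor K A B) C (pure_tensor K A B a b) c)) v"
      unfolding tensor_assoc_pure_lift[OF A B C a v]
      by (rule linear_tensor_lift[OF B C module_tensor[OF AB C] M tensor_assoc_bilinear(1)[OF A B C a] l1 v])
    also have "\<dots> = tensor_lift M (g a) v"
      by (rule tensor_lift_cong[OF B C v M])
        (use a bilinear_mapD(3)[OF ga] in \<open>auto simp: tensor_lift_pure[OF AB C M trilinear_left_bilinear]
          tensor_lift_pure[OF A B M gc] pure_tensor_closed A B\<close>)
    also have "\<dots> = tensor_lift M (\<lambda>a v. tensor_lift M (g a) v) (pure_tensor K A (tensor K B C) a v)"
      by (rule tensor_lift_pure[OF A BC M trilinear_right_bilinear a v, symmetric])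
    finally show "tensor_lift M (\<lambda>u c. tensor_lift M (\<lambda>a b. g a b c) u) (tensor_assoc K A B C (pure_tensor K A (tensor K B C) a v))
      = tensor_lift M (\<lambda>a v. tensor_lift M (g a) v) (pure_tensor K A (tensor K B C) a v)" .
  qed
qed

text \<open>
  Coassociativity in the form in which it is used in computations: with
  \<open>s = s\<^sub>1 \<otimes> s\<^sub>2\<close> and \<open>t = t\<^sub>1 \<otimes> t\<^sub>2\<close>, the equation between the iterated coproducts becomes
  \<open>g(u(s\<^sub>1)\<^sub>1, u(s\<^sub>1)\<^sub>2, s\<^sub>2) = g(t\<^sub>1, v(t\<^sub>2)\<^sub>1, v(t\<^sub>2)\<^sub>2)\<close>. It covers the coproduct of a Hopf
  algebra as well as coactions.
\<close>

lemma coassociative_lift: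
  assumes V: "module K V" and u: "linear_map K V (tensor K A B) u" and v: "linear_map K Y (tensor K B C) v"
    and Y: "module K Y"
    and s: "s \<in> carrier (tensor K V C)" and t: "t \<in> carrier (tensor K A Y)"
    and eq: "tensor_assoc K A B C (tensor_map K A (tensor K B C) id v t) = tensor_map K (tensor K A B) C u id s"
  shows "tensor_lift M (\<lambda>x c. tensor_lift M (\<lambda>a b. g a b c) (u x)) s
    = tensor_lift M (\<lambda>a y. tensor_lift M (g a) (v y)) t"
proof -
  note AB = module_tensor[OF A B] and BC = module_tensor[OF B C]
  have idC: "linear_map K C C id" and idA: "linear_map K A A id" using linear_id by (simp_all add: id_def)
  have "tensor_lift M (\<lambda>x c. tensor_lift M (\<lambda>a b. g a b c) (u x)) s
    = tensor_lift M (\<lambda>u c. tensor_lift M (\<lambda>a b. g a b c) u) (tensor_map K (tensor K A B) C u id s)"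
    by (subst tensor_lift_tensor_map[OF V C AB C M u idC trilinear_left_bilinear s]) simp
  also have "\<dots> = tensor_lift M (\<lambda>a v. tensor_lift M (g a) v) (tensor_map K A (tensor K B C) id v t)"
    unfolding eq[symmetric]
    by (rule tensor_lift_assoc[OF linear_mapD(1)[OF tensor_map_linear[OF A Y A BC idA v] t]])
  also have "\<dots> = tensor_lift M (\<lambda>a y. tensor_lift M (g a) (v y)) t"
    by (subst tensor_lift_tensor_map[OF A Y A BC M idA v trilinear_right_bilinear t]) simp
  finally show ?thesis .
qed

end

lemma tensor_map_cong:
  assumes "module K A" "module K B" "module K C" "module K D"
    and "linear_map K A C f'" "linear_map K B D g'" "U \<in> carrier (tensor K A B)"
    and "\<And>a. a \<in> carrier A \<Longrightarrow> f a = f' a" "\<And>b. b \<in> carrier B \<Longrightarrow> g b = g' b"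
  shows "tensor_map K C D f g U = tensor_map K C D f' g' U"
  unfolding tensor_map_def
  by (rule tensor_lift_cong[where A=A and B=B])
    (use assms in \<open>auto intro!: module_tensor pure_tensor_closed dest: linear_mapD(1)\<close>)

lemma tensor_map_compose:
  assumes "module K A" "module K B" "module K C" "module K D" "module K C'" "module K D'"
    and "linear_map K A C f" "linear_map K B D g" "linear_map K C C' f'" "linear_map K D D' g'"
    and U: "U \<in> carrier (tensor K A B)"
  shows "tensor_map K C' D' f' g' (tensor_map K C D f g U) = tensor_map K C' D' (\<lambda>a. f' (f a)) (\<lambda>b. g' (g b)) U"
  unfolding tensor_map_def[of K C' D']
  by (rule tensor_lift_tensor_map[where A=A and B=B])
    (use assms in \<open>auto intro!: module_tensor bilinear_compose[OF bilinear_pure]\<close>)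

lemma tensor_map_id:
  assumes "module K A" "module K B" and U: "U \<in> carrier (tensor K A B)"
  shows "tensor_map K A B (\<lambda>a. a) (\<lambda>b. b) U = U"
  by (rule tensor_map_eqI[OF assms(1,2) tensor_map_linear linear_id _ U])
    (simp_all add: assms linear_id tensor_map_pure[OF assms(1,2,1,2) linear_id linear_id])

lemma linear_map_id: "linear_map K A A id"
  using linear_id by (simp add: id_def)

text \<open>
  Two independent Sweedler sums may be exchanged.
\<close>

lemma tensor_lift_swap:
  assumes A: "module K A" and B: "module K B" and C: "module K C" and D: "module K D" and M: "module K M"
    and cd: "\<And>a b. a \<in> carrier A \<Longrightarrow> b \<in> carrier B \<Longrightarrow> bilinear_map K C D M (f a b)"
    and ab: "\<And>c d. c \<in> carrier C \<Longrightarrow> d \<in> carrier D \<Longrightarrow> bilinear_map K A B M (\<lambda>a b. f a b c d)"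
    and U: "U \<in> carrier (tensor K A B)" and V: "V \<in> carrier (tensor K C D)"
  shows "tensor_lift M (\<lambda>a b. tensor_lift M (f a b) V) U = tensor_lift M (\<lambda>c d. tensor_lift M (\<lambda>a b. f a b c d) U) V"
proof -
  have bil: "bilinear_map K A B M (\<lambda>a b. tensor_lift M (f a b) V)" if V: "V \<in> carrier (tensor K C D)" for V
    by (intro bilinear_mapI linear_lift_param[OF C D M] A B cd V; (assumption | rule bilinear_mapD[OF ab]))
  have bil2: "bilinear_map K C D M (\<lambda>c d. tensor_lift M (\<lambda>a b. f a b c d) U)"
    by (intro bilinear_mapI linear_lift_param[OF A B M] C D ab U; (assumption | rule bilinear_mapD[OF cd]))
  show ?thesis
  proof (rule tensor_map_eqI[OF C D _ _ _ V])
    show "linear_map K (tensor K C D) M (\<lambda>V. tensor_lift M (\<lambda>a b. tensor_lift M (f a b) V) U)"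
      by (intro linear_lift_param[OF A B M] module_tensor C D bil U tensor_lift_linear M cd)
    show "linear_map K (tensor K C D) M (tensor_lift M (\<lambda>c d. tensor_lift M (\<lambda>a b. f a b c d) U))"
      by (intro tensor_lift_linear C D M bil2)
    show "tensor_lift M (\<lambda>a b. tensor_lift M (f a b) (pure_tensor K C D c d)) U
      = tensor_lift M (\<lambda>c d. tensor_lift M (\<lambda>a b. f a b c d) U) (pure_tensor K C D c d)"
      if "c \<in> carrier C" "d \<in> carrier D" for c d
      unfolding tensor_lift_pure[OF C D M bil2 that]
      by (rule tensor_lift_cong[OF A B U M]) (use that in \<open>auto simp: tensor_lift_pure[OF C D M cd] bilinear_mapD(3)[OF cd]\<close>)
  qed
qed

lemma tensor_flip_flip:
  assumes "module K A" "module K B" "U \<in> carrier (tensor K A B)"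
  shows "tensor_flip K B A (tensor_flip K A B U) = U"
  by (rule tensor_map_eqI[OF assms(1,2) linear_compose[OF tensor_flip_linear tensor_flip_linear] linear_id _ assms(3)])
    (simp_all add: assms tensor_flip_pure)

section \<open>The tensor product of two algebras\<close>

lemma unital_algebraI:
  assumes "field K" and module: "module K A"
    and closed: "\<And>x y. x \<in> carrier A \<Longrightarrow> y \<in> carrier A \<Longrightarrow> x \<otimes>\<^bsub>A\<^esub> y \<in> carrier A" "\<one>\<^bsub>A\<^esub> \<in> carrier A"
    and assoc: "\<And>x y z. x \<in> carrier A \<Longrightarrow> y \<in> carrier A \<Longrightarrow> z \<in> carrier A \<Longrightarrow>
      (x \<otimes>\<^bsub>A\<^esub> y) \<otimes>\<^bsub>A\<^esub> z = x \<otimes>\<^bsub>A\<^esub> (y \<otimes>\<^bsub>A\<^esub> z)"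
    and unit: "\<And>x. x \<in> carrier A \<Longrightarrow> \<one>\<^bsub>A\<^esub> \<otimes>\<^bsub>A\<^esub> x = x" "\<And>x. x \<in> carrier A \<Longrightarrow> x \<otimes>\<^bsub>A\<^esub> \<one>\<^bsub>A\<^esub> = x"
    and linear: "\<And>x. x \<in> carrier A \<Longrightarrow> linear_map K A A (\<lambda>y. x \<otimes>\<^bsub>A\<^esub> y)"
      "\<And>y. y \<in> carrier A \<Longrightarrow> linear_map K A A (\<lambda>x. x \<otimes>\<^bsub>A\<^esub> y)"
  shows "unital_algebra K A"
proof -
  have "Group.monoid A" by (rule Group.monoid.intro) (use closed assoc unit in auto)
  with module have "ring A"
    by (intro ringI) (simp_all add: module_def linear_mapD(2)[OF linear(1)] linear_mapD(2)[OF linear(2)])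
  then show ?thesis
    by (simp add: unital_algebra_def unital_algebra_axioms_def assms(1) module
        linear_mapD(3)[OF linear(1)] linear_mapD(3)[OF linear(2)])
qed

lemma module_cong:
  assumes V: "module K V"
    and eq: "carrier W = carrier V" "ring.zero W = ring.zero V" "ring.add W = ring.add V" "smult W = smult V"
  shows "module K W"
proof -
  interpret V: module K V by fact
  have "abelian_group W"
    by (rule abelian_groupI) (use V.M.add.l_inv_ex in \<open>auto simp: eq V.M.a_ac\<close>)
  then show ?thesis
    by (intro moduleI V.R.cring_axioms) (auto simp: eq V.smult_l_distr V.smult_r_distr V.smult_assoc1)
qed

text \<open>
  Used for the dual Hopf algebra, whose record extends that of the dual algebra.
\<close>

lemma unital_algebra_cong:
  assumes V: "unital_algebra K V"
    and eq: "carrier W = carrier V" "ring.zero W = ring.zero V" "ring.add W = ring.add V" "smult W = smult V"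
      "monoid.mult W = monoid.mult V" "\<one>\<^bsub>W\<^esub> = \<one>\<^bsub>V\<^esub>"
  shows "unital_algebra K W"
proof -
  interpret V: unital_algebra K V by fact
  show ?thesis
    by (rule unital_algebraI[OF V.K.field_axioms module_cong[OF V.module_axioms eq(1-4)]])
      (auto simp: eq V.A.m_assoc linear_map_def V.A.l_distr V.A.r_distr V.smult_mult_left V.smult_mult_right)
qed

lemma unital_algebra_opposite:
  assumes V: "unital_algebra K V"
    and eq: "carrier W = carrier V" "ring.zero W = ring.zero V" "ring.add W = ring.add V" "smult W = smult V"
      "monoid.mult W = (\<lambda>x y. y \<otimes>\<^bsub>V\<^esub> x)" "\<one>\<^bsub>W\<^esub> = \<one>\<^bsub>V\<^esub>"
  shows "unital_algebra K W"
proof -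
  interpret V: unital_algebra K V by fact
  show ?thesis
    by (rule unital_algebraI[OF V.K.field_axioms module_cong[OF V.module_axioms eq(1-4)]])
      (auto simp: eq V.A.m_assoc linear_map_def V.A.l_distr V.A.r_distr V.smult_mult_left V.smult_mult_right)
qed

locale algebra_pair = A: unital_algebra K A + B: unital_algebra K B
  for K :: "('k, 'c) ring_scheme" (structure) and A :: "('k, 'a, 'm) module_scheme"
    and B :: "('k, 'b, 'n) module_scheme"

sublocale algebra_pair \<subseteq> module_pair K A B
  by (simp add: A.module_axioms B.module_axioms)

context algebra_pair
begin

text \<open>
  The product of two representatives; \<open>tensor\<close> multiplies tensors by taking the union of the
  classes of these products.
\<close>

definition frag_mult :: "('a \<times> 'b \<Rightarrow>\<^sub>0 int) \<Rightarrow> ('a \<times> 'b \<Rightarrow>\<^sub>0 int) \<Rightarrow> ('a \<times> 'b \<Rightarrow>\<^sub>0 int)" where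
  "frag_mult u v = frag_extend (\<lambda>(a, b). frag_extend (\<lambda>(a', b'). frag_of (a \<otimes>\<^bsub>A\<^esub> a', b \<otimes>\<^bsub>B\<^esub> b')) v) u"

lemma frag_mult_diff_left: "frag_mult (u - u') v = frag_mult u v - frag_mult u' v"
  unfolding frag_mult_def by (rule frag_extend_diff)

lemma frag_mult_diff_right: "frag_mult u (v - v') = frag_mult u v - frag_mult u v'"
proof -
  have *: "frag_extend (\<lambda>p. f p - g p) u = frag_extend f u - frag_extend g u"
    for f g :: "'a \<times> 'b \<Rightarrow> ('a \<times> 'b \<Rightarrow>\<^sub>0 int)"
    unfolding frag_extend_def sum_subtractf[symmetric]
    by (rule sum.cong) (simp_all add: eq_diff_eq flip: frag_cmul_distrib2)
  show ?thesis
    unfolding frag_mult_def by (subst *[symmetric]) (simp add: frag_extend_diff case_prod_unfold)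
qed

lemma frag_mult_zero [simp]: "frag_mult 0 v = 0" "frag_mult u 0 = 0"
  using frag_mult_diff_left[of 0 0 v] frag_mult_diff_right[of u 0 0] by simp_all

lemma frag_mult_of [simp]: "frag_mult (frag_of (a, b)) (frag_of (a', b')) = frag_of (a \<otimes>\<^bsub>A\<^esub> a', b \<otimes>\<^bsub>B\<^esub> b')"
  by (simp add: frag_mult_def)

text \<open>
  Together with the next lemma: the kernel is a two-sided ideal, so the product of two cosets is
  well defined. On generators this is distributivity and the compatibility of the product with scalars.
\<close>

lemma frag_mult_kernel_left:
  assumes v: "Poly_Mapping.keys v \<subseteq> carrier A \<times> carrier B" and n: "n \<in> N"
  shows "frag_mult n v \<in> N"
  using v
proof (induction v rule: frag_induction)
  case (one x)
  then obtain c d where x: "x = (c, d)" and c: "c \<in> carrier A" and d: "d \<in> carrier B" by auto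
  show ?case using n unfolding x
  proof (induction rule: N_induct)
    case (left a a' b)
    then show ?case using N_relation(1)[of "a \<otimes>\<^bsub>A\<^esub> c" "a' \<otimes>\<^bsub>A\<^esub> c" "b \<otimes>\<^bsub>B\<^esub> d"] c d
      by (simp add: frag_mult_diff_left A.A.l_distr)
  next
    case (right a b b')
    then show ?case using N_relation(2)[of "a \<otimes>\<^bsub>A\<^esub> c" "b \<otimes>\<^bsub>B\<^esub> d" "b' \<otimes>\<^bsub>B\<^esub> d"] c d
      by (simp add: frag_mult_diff_left B.A.l_distr)
  next
    case (scalar r a b)
    then show ?case using N_relation(3)[of r "a \<otimes>\<^bsub>A\<^esub> c" "b \<otimes>\<^bsub>B\<^esub> d"] c d
      by (simp add: frag_mult_diff_left A.smult_mult_left B.smult_mult_left)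
  qed (simp_all add: N_zero frag_mult_diff_left N_diff)
qed (simp_all add: N_zero frag_mult_diff_right N_diff)

lemma frag_mult_kernel_right:
  assumes u: "Poly_Mapping.keys u \<subseteq> carrier A \<times> carrier B" and n: "n \<in> N"
  shows "frag_mult u n \<in> N"
  using u
proof (induction u rule: frag_induction)
  case (one x)
  then obtain c d where x: "x = (c, d)" and c: "c \<in> carrier A" and d: "d \<in> carrier B" by auto
  show ?case using n unfolding x
  proof (induction rule: N_induct)
    case (left a a' b)
    then show ?case using N_relation(1)[of "c \<otimes>\<^bsub>A\<^esub> a" "c \<otimes>\<^bsub>A\<^esub> a'" "d \<otimes>\<^bsub>B\<^esub> b"] c d
      by (simp add: frag_mult_diff_right A.A.r_distr)
  next
    case (right a b b')
    then show ?case using N_relation(2)[of "c \<otimes>\<^bsub>A\<^esub> a" "d \<otimes>\<^bsub>B\<^esub> b" "d \<otimes>\<^bsub>B\<^esub> b'"] c d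
      by (simp add: frag_mult_diff_right B.A.r_distr)
  next
    case (scalar r a b)
    then show ?case using N_relation(3)[of r "c \<otimes>\<^bsub>A\<^esub> a" "d \<otimes>\<^bsub>B\<^esub> b"] c d
      by (simp add: frag_mult_diff_right A.smult_mult_right B.smult_mult_right)
  qed (simp_all add: N_zero frag_mult_diff_right N_diff)
qed (simp_all add: N_zero frag_mult_diff_left N_diff)

lemma mult_cls:
  assumes u: "Poly_Mapping.keys u \<subseteq> carrier A \<times> carrier B" and v: "Poly_Mapping.keys v \<subseteq> carrier A \<times> carrier B"
  shows "cls u \<otimes>\<^bsub>T\<^esub> cls v = cls (frag_mult u v)"
proof -
  have eq: "cls (frag_mult u' v') = cls (frag_mult u v)" if u': "u' \<in> cls u" and v': "v' \<in> cls v" for u' v'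
  proof -
    \<comment> \<open>the telescoping sum \<open>u'v' - uv = (u' - u)v' + u(v' - v)\<close>\<close>
    have "frag_mult (u' - u) v' + frag_mult u (v' - v) \<in> N"
      using that u mem_cls_keys[OF v v'] by (intro N_add frag_mult_kernel_left frag_mult_kernel_right) (auto simp: mem_cls)
    then show ?thesis by (simp add: cls_eq frag_mult_diff_left frag_mult_diff_right algebra_simps)
  qed
  have "cls u \<otimes>\<^bsub>T\<^esub> cls v = (\<Union>u'\<in>cls u. \<Union>v'\<in>cls v. cls (frag_mult u' v'))"
    by (simp add: tensor_def Let_def frag_mult_def)
  also have "\<dots> = (\<Union>u'\<in>cls u. \<Union>v'\<in>cls v. cls (frag_mult u v))"
    by (intro SUP_cong refl eq)
  also have "\<dots> = (\<Union>u'\<in>cls u. cls (frag_mult u v))"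
    by (intro SUP_cong refl cSUP_const) (use cls_self in blast)
  also have "\<dots> = cls (frag_mult u v)"
    by (rule cSUP_const) (use cls_self in blast)
  finally show ?thesis .
qed

lemma mult_pure:
  "a \<in> carrier A \<Longrightarrow> b \<in> carrier B \<Longrightarrow> a' \<in> carrier A \<Longrightarrow> b' \<in> carrier B \<Longrightarrow>
    pure_tensor K A B a b \<otimes>\<^bsub>T\<^esub> pure_tensor K A B a' b' = pure_tensor K A B (a \<otimes>\<^bsub>A\<^esub> a') (b \<otimes>\<^bsub>B\<^esub> b')"
  unfolding pure_tensor_def by (subst mult_cls) (simp_all add: keys_frag_of)

lemma frag_mult_add:
  "frag_mult (u + u') v = frag_mult u v + frag_mult u' v"
  "frag_mult u (v + v') = frag_mult u v + frag_mult u v'"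
  using frag_mult_diff_left[of "u + u'" u' v] frag_mult_diff_right[of u "v + v'" v'] by (simp_all add: eq_diff_eq)

interpretation T: module K T by (rule module_tensor)

lemma tensor_distrib:
  assumes "U \<in> carrier T" "V \<in> carrier T" "W \<in> carrier T"
  shows "(U \<oplus>\<^bsub>T\<^esub> V) \<otimes>\<^bsub>T\<^esub> W = U \<otimes>\<^bsub>T\<^esub> W \<oplus>\<^bsub>T\<^esub> V \<otimes>\<^bsub>T\<^esub> W"
    and "W \<otimes>\<^bsub>T\<^esub> (U \<oplus>\<^bsub>T\<^esub> V) = W \<otimes>\<^bsub>T\<^esub> U \<oplus>\<^bsub>T\<^esub> W \<otimes>\<^bsub>T\<^esub> V"
  using assms
  by (elim tensor_cases; simp add: add_cls mult_cls frag_mult_add order_trans[OF keys_add])+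

lemma tensor_mult_closed:
  assumes U: "U \<in> carrier T" and V: "V \<in> carrier T"
  shows "U \<otimes>\<^bsub>T\<^esub> V \<in> carrier T"
  using U
proof (induction rule: tensor_induct)
  case (pure a b)
  show ?case using V by (induction rule: tensor_induct) (simp_all add: pure mult_pure tensor_distrib)
qed (use V in \<open>simp add: tensor_distrib\<close>)

lemma tensor_smult_mult:
  assumes U: "U \<in> carrier T" and V: "V \<in> carrier T" and r: "r \<in> carrier K"
  shows "(r \<odot>\<^bsub>T\<^esub> U) \<otimes>\<^bsub>T\<^esub> V = r \<odot>\<^bsub>T\<^esub> (U \<otimes>\<^bsub>T\<^esub> V)"
    and "U \<otimes>\<^bsub>T\<^esub> (r \<odot>\<^bsub>T\<^esub> V) = r \<odot>\<^bsub>T\<^esub> (U \<otimes>\<^bsub>T\<^esub> V)"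
proof -
  have "(r \<odot>\<^bsub>T\<^esub> U) \<otimes>\<^bsub>T\<^esub> V = r \<odot>\<^bsub>T\<^esub> (U \<otimes>\<^bsub>T\<^esub> V) \<and> U \<otimes>\<^bsub>T\<^esub> (r \<odot>\<^bsub>T\<^esub> V) = r \<odot>\<^bsub>T\<^esub> (U \<otimes>\<^bsub>T\<^esub> V)"
    using U
  proof (induction rule: tensor_induct)
    case (pure a b)
    show ?case using V
    proof (induction rule: tensor_induct)
      case (pure a' b')
      then show ?case using \<open>a \<in> carrier A\<close> \<open>b \<in> carrier B\<close> r
        by (simp flip: pure_smult_left add: mult_pure A.smult_mult_left A.smult_mult_right)
    qed (use pure r in \<open>simp add: tensor_distrib tensor_mult_closed T.smult_r_distr\<close>)
  qed (use V r in \<open>simp add: tensor_distrib tensor_mult_closed T.smult_r_distr\<close>)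
  then show "(r \<odot>\<^bsub>T\<^esub> U) \<otimes>\<^bsub>T\<^esub> V = r \<odot>\<^bsub>T\<^esub> (U \<otimes>\<^bsub>T\<^esub> V)" "U \<otimes>\<^bsub>T\<^esub> (r \<odot>\<^bsub>T\<^esub> V) = r \<odot>\<^bsub>T\<^esub> (U \<otimes>\<^bsub>T\<^esub> V)"
    by auto
qed

lemma tensor_mult_assoc:
  assumes U: "U \<in> carrier T" and V: "V \<in> carrier T" and W: "W \<in> carrier T"
  shows "(U \<otimes>\<^bsub>T\<^esub> V) \<otimes>\<^bsub>T\<^esub> W = U \<otimes>\<^bsub>T\<^esub> (V \<otimes>\<^bsub>T\<^esub> W)"
  using U
proof (induction rule: tensor_induct)
  case U: (pure a b)
  show ?case using V
  proof (induction rule: tensor_induct)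
    case V: (pure a' b')
    show ?case using W
    proof (induction rule: tensor_induct)
      case (pure a'' b'')
      then show ?case using U V by (simp add: mult_pure A.A.m_assoc B.A.m_assoc)
    qed (use U V in \<open>simp add: tensor_distrib tensor_mult_closed\<close>)
  qed (use U W in \<open>simp add: tensor_distrib tensor_mult_closed\<close>)
qed (use V W in \<open>simp add: tensor_distrib tensor_mult_closed\<close>)

lemma one_tensor: "\<one>\<^bsub>T\<^esub> = pure_tensor K A B \<one>\<^bsub>A\<^esub> \<one>\<^bsub>B\<^esub>"
  by (simp add: tensor_def Let_def)

lemma tensor_mult_one:
  assumes U: "U \<in> carrier T"
  shows "\<one>\<^bsub>T\<^esub> \<otimes>\<^bsub>T\<^esub> U = U" and "U \<otimes>\<^bsub>T\<^esub> \<one>\<^bsub>T\<^esub> = U"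
proof -
  have "\<one>\<^bsub>T\<^esub> \<otimes>\<^bsub>T\<^esub> U = U \<and> U \<otimes>\<^bsub>T\<^esub> \<one>\<^bsub>T\<^esub> = U"
    using U by (induction rule: tensor_induct) (simp_all add: one_tensor mult_pure tensor_distrib)
  then show "\<one>\<^bsub>T\<^esub> \<otimes>\<^bsub>T\<^esub> U = U" "U \<otimes>\<^bsub>T\<^esub> \<one>\<^bsub>T\<^esub> = U" by auto
qed

lemma unital_algebra_tensor: "unital_algebra K T"
proof -
  have "Group.monoid T"
    by (rule Group.monoid.intro) (simp_all add: tensor_mult_closed tensor_mult_assoc tensor_mult_one, simp add: one_tensor)
  then have "ring T"
    by (intro ringI abelian_group_tensor) (simp_all add: tensor_distrib)
  then show ?thesis
    by (simp add: unital_algebra_def unital_algebra_axioms_def A.K.field_axioms module_tensor tensor_smult_mult)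
qed

end

lemma algebra_pairI [simp, intro]: "unital_algebra K A \<Longrightarrow> unital_algebra K B \<Longrightarrow> algebra_pair K A B"
  by (simp add: algebra_pair_def)

lemmas unital_algebra_tensor = algebra_pair.unital_algebra_tensor[OF algebra_pairI]
lemmas tensor_mult_pure = algebra_pair.mult_pure[OF algebra_pairI]
lemmas tensor_one = algebra_pair.one_tensor[OF algebra_pairI]

text \<open>
  In Sweedler notation \<open>f((UV)\<^sub>1, (UV)\<^sub>2) = f(U\<^sub>1 V\<^sub>1, U\<^sub>2 V\<^sub>2)\<close>. Applied to \<open>\<Delta>(xy) = \<Delta>(x) \<Delta>(y)\<close>,
  it splits a sum over \<open>\<Delta>(xy)\<close> into sums over \<open>\<Delta>(x)\<close> and \<open>\<Delta>(y)\<close>.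
\<close>

lemma tensor_lift_mult:
  assumes A: "unital_algebra K A" and B: "unital_algebra K B" and M: "module K M" and f: "bilinear_map K A B M f"
    and U: "U \<in> carrier (tensor K A B)" and V: "V \<in> carrier (tensor K A B)"
  shows "tensor_lift M f (U \<otimes>\<^bsub>tensor K A B\<^esub> V) =
    tensor_lift M (\<lambda>a b. tensor_lift M (\<lambda>a' b'. f (a \<otimes>\<^bsub>A\<^esub> a') (b \<otimes>\<^bsub>B\<^esub> b')) V) U"
proof -
  note mA = unital_algebra_module[OF A] and mB = unital_algebra_module[OF B]
  note T = unital_algebra_tensor[OF A B]
  note l = linear_compose[OF tensor_lift_linear[OF mA mB M f]]
  have bil: "bilinear_map K A B M (\<lambda>a' b'. f (a \<otimes>\<^bsub>A\<^esub> a') (b \<otimes>\<^bsub>B\<^esub> b'))" if "a \<in> carrier A" "b \<in> carrier B" for a b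
    using that by (intro bilinear_compose[OF f] linear_mult linear_id A B)
  have mc: "a \<otimes>\<^bsub>A\<^esub> a' \<in> carrier A" if "a \<in> carrier A" "a' \<in> carrier A" for a a'
    using that linear_mapD(1)[OF linear_mult(1)[OF A _ linear_id]] by blast
  have mc': "a \<otimes>\<^bsub>B\<^esub> a' \<in> carrier B" if "a \<in> carrier B" "a' \<in> carrier B" for a a'
    using that linear_mapD(1)[OF linear_mult(1)[OF B _ linear_id]] by blast
  have bil2: "bilinear_map K A B M (\<lambda>a b. f (a \<otimes>\<^bsub>A\<^esub> a') (b \<otimes>\<^bsub>B\<^esub> b'))" if "a' \<in> carrier A" "b' \<in> carrier B" for a' b'
    using that by (intro bilinear_compose[OF f] linear_mult linear_id A B)
  have bil3: "bilinear_map K A B M (\<lambda>a b. tensor_lift M (\<lambda>a' b'. f (a \<otimes>\<^bsub>A\<^esub> a') (b \<otimes>\<^bsub>B\<^esub> b')) V)"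
    by (intro bilinear_mapI linear_lift_param[OF mA mB M] mA mB bil V;
      (assumption | rule bilinear_mapD[OF bil2]))
  show ?thesis
  proof (rule tensor_map_eqI[OF mA mB l _ _ U])
    fix a b assume ab: "a \<in> carrier A" "b \<in> carrier B"
    show "tensor_lift M f (pure_tensor K A B a b \<otimes>\<^bsub>tensor K A B\<^esub> V) =
      tensor_lift M (\<lambda>a b. tensor_lift M (\<lambda>a' b'. f (a \<otimes>\<^bsub>A\<^esub> a') (b \<otimes>\<^bsub>B\<^esub> b')) V) (pure_tensor K A B a b)"
      unfolding tensor_lift_pure[OF mA mB M bil3 ab]
      by (rule tensor_map_eqI[OF mA mB l tensor_lift_linear _ V])
        (use ab in \<open>auto intro!: linear_mult T linear_id pure_tensor_closed mA mB M bil
          simp: tensor_mult_pure A B mA mB M tensor_lift_pure f bil mc mc'\<close>)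
  qed (auto intro!: linear_mult T linear_id V tensor_lift_linear mA mB M bil3)
qed

text \<open>
  Results on tensor products with the dual as second factor are transferred along the flip to those with
  the dual as first factor.
\<close>

lemma tensor_flip_mult:
  assumes A: "unital_algebra K A" and B: "unital_algebra K B"
    and U: "U \<in> carrier (tensor K A B)" and V: "V \<in> carrier (tensor K A B)"
  shows "tensor_flip K A B (U \<otimes>\<^bsub>tensor K A B\<^esub> V) = tensor_flip K A B U \<otimes>\<^bsub>tensor K B A\<^esub> tensor_flip K A B V"
proof -
  interpret A: unital_algebra K A by (rule A)
  interpret B: unital_algebra K B by (rule B)
  note mA = A.module_axioms and mB = B.module_axioms
  note AB = unital_algebra_tensor[OF A B] and BA = unital_algebra_tensor[OF B A]
  note fl = tensor_flip_linear[OF mA mB]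
  note flc = linear_mapD(1)[OF fl]
  show ?thesis
  proof (rule tensor_map_eqI[OF mA mB linear_compose[OF fl linear_mult(1)[OF AB V linear_id]] linear_mult(1)[OF BA flc[OF V] fl] _ U])
    fix a b assume ab: "a \<in> carrier A" "b \<in> carrier B"
    note p = pure_tensor_closed[OF mA mB ab]
    show "tensor_flip K A B (pure_tensor K A B a b \<otimes>\<^bsub>tensor K A B\<^esub> V)
      = tensor_flip K A B (pure_tensor K A B a b) \<otimes>\<^bsub>tensor K B A\<^esub> tensor_flip K A B V"
      by (rule tensor_map_eqI[OF mA mB linear_compose[OF fl linear_mult(2)[OF AB p linear_id]] linear_mult(2)[OF BA flc[OF p] fl] _ V])
        (use ab in \<open>simp add: tensor_mult_pure[OF A B] tensor_mult_pure[OF B A] tensor_flip_pure[OF mA mB]\<close>)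
  qed
qed

section \<open>Convolution algebras\<close>

text \<open>
  The linear maps \<open>H \<rightarrow> Q\<close> with the convolution product \<open>(f * g)(h) = f(h\<^sub>1) g(h\<^sub>2)\<close>. For the
  field as \<open>Q\<close> this is the dual algebra; for \<open>Q = Hom(H, H)\<close> it is a curried form of
  \<open>Hom(H \<otimes> H, H)\<close>.
\<close>

definition conv_algebra ::
  "('k, 'c) ring_scheme \<Rightarrow> ('k, 'a, 'm) hopf_scheme \<Rightarrow> ('k, 'q, 'n) module_scheme \<Rightarrow> ('k, 'a \<Rightarrow> 'q) module" where
  "conv_algebra K H Q =
     \<lparr>carrier = {f \<in> extensional (carrier H). linear_map K H Q f},
      monoid.mult = (\<lambda>f g. \<lambda>h\<in>carrier H. tensor_lift Q (\<lambda>a b. f a \<otimes>\<^bsub>Q\<^esub> g b) (comult H h)),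
      monoid.one = (\<lambda>h\<in>carrier H. counit H h \<odot>\<^bsub>Q\<^esub> \<one>\<^bsub>Q\<^esub>),
      ring.zero = (\<lambda>h\<in>carrier H. \<zero>\<^bsub>Q\<^esub>),
      ring.add = (\<lambda>f g. \<lambda>h\<in>carrier H. f h \<oplus>\<^bsub>Q\<^esub> g h),
      smult = (\<lambda>r f. \<lambda>h\<in>carrier H. r \<odot>\<^bsub>Q\<^esub> f h)\<rparr>"

lemma bilinear_mult:
  assumes "unital_algebra K Q" "linear_map K A Q f" "linear_map K B Q g"
  shows "bilinear_map K A B Q (\<lambda>a b. f a \<otimes>\<^bsub>Q\<^esub> g b)"
  using assms by (intro bilinear_mapI linear_mult) (auto dest: linear_mapD)

lemma trilinear_mult:
  assumes Q: "unital_algebra K Q" and "linear_map K A Q f" "linear_map K B Q g" "linear_map K C Q k"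
  shows "trilinear_map K A B C Q (\<lambda>a b c. f a \<otimes>\<^bsub>Q\<^esub> (g b \<otimes>\<^bsub>Q\<^esub> k c))"
proof -
  interpret Q: unital_algebra K Q by fact
  show ?thesis
    using assms by (intro trilinear_mapI linear_mult Q) (auto dest: linear_mapD)
qed

lemma linear_restrict: "linear_map K A B f \<Longrightarrow> module K A \<Longrightarrow> linear_map K A B (restrict f (carrier A))"
  by (rule linear_cong) auto

context hopf_algebra
begin

lemma algebra_H: "unital_algebra K H" ..
lemma module_H: "module K H" ..
lemmas field_K = K.field_axioms
lemma comult_linear: "linear_map K H (tensor K H H) (comult H)"
  using comult_hom by (simp add: algebra_hom_def)
lemma comult_closed: "h \<in> carrier H \<Longrightarrow> comult H h \<in> carrier (tensor K H H)"
  by (rule linear_mapD(1)[OF comult_linear])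
lemma comult_mult: "h \<in> carrier H \<Longrightarrow> h' \<in> carrier H \<Longrightarrow>
    comult H (h \<otimes>\<^bsub>H\<^esub> h') = comult H h \<otimes>\<^bsub>tensor K H H\<^esub> comult H h'"
  using comult_hom by (auto simp: algebra_hom_def ring_hom_def)
lemma counit_linear: "linear_map K H (scalar_algebra K) (counit H)"
  using counit_hom by (simp add: algebra_hom_def)
lemma counit_closed: "h \<in> carrier H \<Longrightarrow> counit H h \<in> carrier K"
  using linear_mapD(1)[OF counit_linear] by simp
lemma counit_mult: "h \<in> carrier H \<Longrightarrow> h' \<in> carrier H \<Longrightarrow> counit H (h \<otimes>\<^bsub>H\<^esub> h') = counit H h \<otimes>\<^bsub>K\<^esub> counit H h'"
  using counit_hom by (auto simp: algebra_hom_def ring_hom_def)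
lemma antipode_closed: "h \<in> carrier H \<Longrightarrow> antipode H h \<in> carrier H"
  by (rule linear_mapD(1)[OF antipode_linear])

text \<open>The value of \<open>f(h\<^sub>1, h\<^sub>2)\<close> in Sweedler notation is \<open>tensor_lift M f (comult H h)\<close>.\<close>

lemma sweedler_linear: "module K M \<Longrightarrow> bilinear_map K H H M f \<Longrightarrow> linear_map K H M (\<lambda>h. tensor_lift M f (comult H h))"
  by (rule linear_lift[OF module_H module_H _ _ comult_linear])

lemma sweedler_coassoc:
  assumes M: "module K M" and g: "trilinear_map K H H H M g" and h: "h \<in> carrier H"
  shows "tensor_lift M (\<lambda>x c. tensor_lift M (\<lambda>a b. g a b c) (comult H x)) (comult H h)
    = tensor_lift M (\<lambda>a y. tensor_lift M (g a) (comult H y)) (comult H h)"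
  by (rule coassociative_lift[OF module_H module_H module_H M g module_H comult_linear comult_linear module_H
        comult_closed comult_closed coassoc]) (rule h)+

lemma sweedler_cong:
  assumes "h \<in> carrier H" "module K M"
    and "\<And>a b. a \<in> carrier H \<Longrightarrow> b \<in> carrier H \<Longrightarrow> f a b = g a b"
    and "\<And>a b. a \<in> carrier H \<Longrightarrow> b \<in> carrier H \<Longrightarrow> g a b \<in> carrier M"
  shows "tensor_lift M f (comult H h) = tensor_lift M g (comult H h)"
  by (rule tensor_lift_cong[OF module_H module_H comult_closed[OF assms(1)] assms(2-4)])

lemma sweedler_counit_left:
  assumes f: "linear_map K H M f" and M: "module K M" and h: "h \<in> carrier H"
  shows "tensor_lift M (\<lambda>a b. counit H a \<odot>\<^bsub>M\<^esub> f b) (comult H h) = f h"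
proof -
  have "f h = f (tensor_lift H (\<lambda>a b. counit H a \<odot>\<^bsub>H\<^esub> b) (comult H h))"
    using counit_left[OF h] by simp
  also have "\<dots> = tensor_lift M (\<lambda>a b. f (counit H a \<odot>\<^bsub>H\<^esub> b)) (comult H h)"
    by (rule linear_tensor_lift[OF module_H module_H module_H M _ f comult_closed[OF h]])
      (intro bilinear_mapI linear_smult_left linear_smult_right module_H counit_linear linear_id counit_closed)
  also have "\<dots> = tensor_lift M (\<lambda>a b. counit H a \<odot>\<^bsub>M\<^esub> f b) (comult H h)"
    by (rule sweedler_cong[OF h M])
      (simp_all add: linear_mapD[OF f] counit_closed module.smult_closed[OF M])
  finally show ?thesis by simp
qed

lemma sweedler_counit_right:
  assumes f: "linear_map K H M f" and M: "module K M" and h: "h \<in> carrier H"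
  shows "tensor_lift M (\<lambda>a b. counit H b \<odot>\<^bsub>M\<^esub> f a) (comult H h) = f h"
proof -
  have "f h = f (tensor_lift H (\<lambda>a b. counit H b \<odot>\<^bsub>H\<^esub> a) (comult H h))"
    using counit_right[OF h] by simp
  also have "\<dots> = tensor_lift M (\<lambda>a b. f (counit H b \<odot>\<^bsub>H\<^esub> a)) (comult H h)"
    by (rule linear_tensor_lift[OF module_H module_H module_H M _ f comult_closed[OF h]])
      (intro bilinear_mapI linear_smult_left linear_smult_right module_H counit_linear linear_id counit_closed)
  also have "\<dots> = tensor_lift M (\<lambda>a b. counit H b \<odot>\<^bsub>M\<^esub> f a) (comult H h)"
    by (rule sweedler_cong[OF h M])
      (simp_all add: linear_mapD[OF f] counit_closed module.smult_closed[OF M])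
  finally show ?thesis by simp
qed

context
  fixes Q :: "('k, 'q, 'n) module_scheme"
  assumes Q: "unital_algebra K Q"
begin

interpretation Q: unital_algebra K Q by (rule Q)

abbreviation "conv \<equiv> conv_algebra K H Q"

lemma conv_carrierD: "f \<in> carrier conv \<Longrightarrow> linear_map K H Q f"
  by (simp add: conv_algebra_def)

lemma conv_carrierI: "linear_map K H Q f \<Longrightarrow> restrict f (carrier H) \<in> carrier conv"
  by (simp add: conv_algebra_def linear_restrict module_H)

lemma conv_eqI: "f \<in> carrier conv \<Longrightarrow> g \<in> carrier conv \<Longrightarrow> (\<And>h. h \<in> carrier H \<Longrightarrow> f h = g h) \<Longrightarrow> f = g"
  by (rule extensionalityI[of f "carrier H" g]) (simp_all add: conv_algebra_def)

lemma conv_apply: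
  "h \<in> carrier H \<Longrightarrow> (f \<otimes>\<^bsub>conv\<^esub> g) h = tensor_lift Q (\<lambda>a b. f a \<otimes>\<^bsub>Q\<^esub> g b) (comult H h)"
  "h \<in> carrier H \<Longrightarrow> \<one>\<^bsub>conv\<^esub> h = counit H h \<odot>\<^bsub>Q\<^esub> \<one>\<^bsub>Q\<^esub>"
  "h \<in> carrier H \<Longrightarrow> \<zero>\<^bsub>conv\<^esub> h = \<zero>\<^bsub>Q\<^esub>"
  "h \<in> carrier H \<Longrightarrow> (f \<oplus>\<^bsub>conv\<^esub> g) h = f h \<oplus>\<^bsub>Q\<^esub> g h"
  "h \<in> carrier H \<Longrightarrow> (r \<odot>\<^bsub>conv\<^esub> f) h = r \<odot>\<^bsub>Q\<^esub> f h"
  by (simp_all add: conv_algebra_def)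

lemma conv_closed:
  assumes "f \<in> carrier conv" "g \<in> carrier conv"
  shows "f \<otimes>\<^bsub>conv\<^esub> g \<in> carrier conv" "f \<oplus>\<^bsub>conv\<^esub> g \<in> carrier conv" "\<one>\<^bsub>conv\<^esub> \<in> carrier conv" "\<zero>\<^bsub>conv\<^esub> \<in> carrier conv"
    "r \<in> carrier K \<Longrightarrow> r \<odot>\<^bsub>conv\<^esub> f \<in> carrier conv"
proof -
  note f = conv_carrierD[OF assms(1)] and g = conv_carrierD[OF assms(2)]
  have "linear_map K H Q (\<lambda>h. tensor_lift Q (\<lambda>a b. f a \<otimes>\<^bsub>Q\<^esub> g b) (comult H h))"
    by (intro sweedler_linear Q.module_axioms bilinear_mult Q f g)
  then show "f \<otimes>\<^bsub>conv\<^esub> g \<in> carrier conv" by (simp add: conv_algebra_def linear_restrict module_H)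
  have "linear_map K H Q (\<lambda>h. f h \<oplus>\<^bsub>Q\<^esub> g h)"
    by (rule linear_mapI) (simp_all add: linear_mapD[OF f] linear_mapD[OF g] Q.M.a_ac Q.smult_r_distr)
  then show "f \<oplus>\<^bsub>conv\<^esub> g \<in> carrier conv" by (simp add: conv_algebra_def linear_restrict module_H)
  have "linear_map K H Q (\<lambda>h. counit H h \<odot>\<^bsub>Q\<^esub> \<one>\<^bsub>Q\<^esub>)"
    by (intro linear_smult_left Q.module_axioms Q.A.one_closed counit_linear)
  then show "\<one>\<^bsub>conv\<^esub> \<in> carrier conv" by (simp add: conv_algebra_def linear_restrict module_H)
  have "linear_map K H Q (\<lambda>h. \<zero>\<^bsub>Q\<^esub>)" by (rule linear_mapI) simp_all
  then show "\<zero>\<^bsub>conv\<^esub> \<in> carrier conv" by (simp add: conv_algebra_def linear_restrict module_H)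
  show "r \<odot>\<^bsub>conv\<^esub> f \<in> carrier conv" if "r \<in> carrier K"
    using linear_smult_right[OF Q.module_axioms that f] by (simp add: conv_algebra_def linear_restrict module_H)
qed

text \<open>
  Both bracketings equal the sum of \<open>f(h\<^sub>1) g(h\<^sub>2) k(h\<^sub>3)\<close>, by coassociativity of \<open>H\<close> and
  associativity of \<open>Q\<close>.
\<close>

lemma conv_assoc:
  assumes "f \<in> carrier conv" "g \<in> carrier conv" "k \<in> carrier conv"
  shows "(f \<otimes>\<^bsub>conv\<^esub> g) \<otimes>\<^bsub>conv\<^esub> k = f \<otimes>\<^bsub>conv\<^esub> (g \<otimes>\<^bsub>conv\<^esub> k)"
proof (rule conv_eqI)
  note f = conv_carrierD[OF assms(1)] and g = conv_carrierD[OF assms(2)] and k = conv_carrierD[OF assms(3)]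
  note Qm = Q.module_axioms
  fix h assume h: "h \<in> carrier H"
  note c = linear_mapD(1)[OF f] linear_mapD(1)[OF g] linear_mapD(1)[OF k]
  have lift_mult_right: "tensor_lift Q (\<lambda>a b. f a \<otimes>\<^bsub>Q\<^esub> g b) U \<otimes>\<^bsub>Q\<^esub> y = tensor_lift Q (\<lambda>a b. f a \<otimes>\<^bsub>Q\<^esub> (g b \<otimes>\<^bsub>Q\<^esub> y)) U"
    if "y \<in> carrier Q" "U \<in> carrier (tensor K H H)" for y U
    by (subst linear_tensor_lift[OF module_H module_H Qm Qm _ linear_mult(1)[OF Q _ linear_id]])
      (use that in \<open>auto intro!: bilinear_mult f g tensor_lift_cong[OF module_H module_H _ Qm] simp: Q.A.m_assoc c Q\<close>)
  have lift_mult_left: "y \<otimes>\<^bsub>Q\<^esub> tensor_lift Q (\<lambda>a b. g a \<otimes>\<^bsub>Q\<^esub> k b) U = tensor_lift Q (\<lambda>a b. y \<otimes>\<^bsub>Q\<^esub> (g a \<otimes>\<^bsub>Q\<^esub> k b)) U"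
    if "y \<in> carrier Q" "U \<in> carrier (tensor K H H)" for y U
    by (rule linear_tensor_lift[OF module_H module_H Qm Qm _ linear_mult(2)[OF Q _ linear_id]])
      (use that in \<open>auto intro!: bilinear_mult g k Q\<close>)
  have "((f \<otimes>\<^bsub>conv\<^esub> g) \<otimes>\<^bsub>conv\<^esub> k) h
    = tensor_lift Q (\<lambda>x c. tensor_lift Q (\<lambda>a b. f a \<otimes>\<^bsub>Q\<^esub> (g b \<otimes>\<^bsub>Q\<^esub> k c)) (comult H x)) (comult H h)"
    unfolding conv_apply(1)[OF h]
    by (rule sweedler_cong[OF h Qm])
      (auto simp: conv_apply lift_mult_right c comult_closed
        intro!: tensor_lift_closed[OF module_H module_H Qm] bilinear_mult Q f linear_mult g)
  also have "\<dots> = tensor_lift Q (\<lambda>a y. tensor_lift Q (\<lambda>b c. f a \<otimes>\<^bsub>Q\<^esub> (g b \<otimes>\<^bsub>Q\<^esub> k c)) (comult H y)) (comult H h)"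
    by (rule sweedler_coassoc[OF Qm trilinear_mult[OF Q f g k] h])
  also have "\<dots> = (f \<otimes>\<^bsub>conv\<^esub> (g \<otimes>\<^bsub>conv\<^esub> k)) h"
    unfolding conv_apply(1)[OF h]
    by (rule sweedler_cong[OF h Qm])
      (auto simp: conv_apply lift_mult_left c comult_closed
        intro!: tensor_lift_closed[OF module_H module_H Qm] bilinear_mult Q f linear_mult[OF Q] bilinear_mapI g k Q.A.m_closed linear_compose[OF linear_mult(2)[OF Q _ linear_id]])
  finally show "((f \<otimes>\<^bsub>conv\<^esub> g) \<otimes>\<^bsub>conv\<^esub> k) h = (f \<otimes>\<^bsub>conv\<^esub> (g \<otimes>\<^bsub>conv\<^esub> k)) h" .
qed (intro conv_closed assms)+

lemma conv_one:
  assumes "f \<in> carrier conv"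
  shows "\<one>\<^bsub>conv\<^esub> \<otimes>\<^bsub>conv\<^esub> f = f" "f \<otimes>\<^bsub>conv\<^esub> \<one>\<^bsub>conv\<^esub> = f"
proof -
  note f = conv_carrierD[OF assms] and Qm = Q.module_axioms
  note c = linear_mapD(1)[OF f]
  show "\<one>\<^bsub>conv\<^esub> \<otimes>\<^bsub>conv\<^esub> f = f"
  proof (rule conv_eqI)
    fix h assume h: "h \<in> carrier H"
    have "(\<one>\<^bsub>conv\<^esub> \<otimes>\<^bsub>conv\<^esub> f) h = tensor_lift Q (\<lambda>a b. counit H a \<odot>\<^bsub>Q\<^esub> f b) (comult H h)"
      unfolding conv_apply(1)[OF h]
      by (rule sweedler_cong[OF h Qm]) (auto simp: conv_apply c counit_closed Q.smult_mult_left)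
    then show "(\<one>\<^bsub>conv\<^esub> \<otimes>\<^bsub>conv\<^esub> f) h = f h" by (simp add: sweedler_counit_left[OF f Qm h])
  qed (use assms conv_closed[OF assms assms] conv_closed(1) in auto)
  show "f \<otimes>\<^bsub>conv\<^esub> \<one>\<^bsub>conv\<^esub> = f"
  proof (rule conv_eqI)
    fix h assume h: "h \<in> carrier H"
    have "(f \<otimes>\<^bsub>conv\<^esub> \<one>\<^bsub>conv\<^esub>) h = tensor_lift Q (\<lambda>a b. counit H b \<odot>\<^bsub>Q\<^esub> f a) (comult H h)"
      unfolding conv_apply(1)[OF h]
      by (rule sweedler_cong[OF h Qm]) (auto simp: conv_apply c counit_closed Q.smult_mult_right)
    then show "(f \<otimes>\<^bsub>conv\<^esub> \<one>\<^bsub>conv\<^esub>) h = f h" by (simp add: sweedler_counit_right[OF f Qm h])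
  qed (use assms conv_closed[OF assms assms] conv_closed(1) in auto)
qed

lemma conv_eval_linear: "h \<in> carrier H \<Longrightarrow> linear_map K conv Q (\<lambda>f. f h)"
  by (rule linear_mapI) (auto simp: conv_apply dest: conv_carrierD linear_mapD(1))

lemma module_conv: "module K conv"
proof (rule moduleI)
  note cl = linear_mapD(1)[OF conv_carrierD]
  show "cring K" ..
  show "abelian_group conv"
  proof (rule abelian_groupI)
    have "restrict (\<lambda>_. \<zero>\<^bsub>Q\<^esub>) (carrier H) \<in> carrier conv"
      by (rule conv_carrierI) (rule linear_mapI, simp_all)
    from conv_closed(4)[OF this this] show "\<zero>\<^bsub>conv\<^esub> \<in> carrier conv" .
    then show "\<zero>\<^bsub>conv\<^esub> \<oplus>\<^bsub>conv\<^esub> x = x" if "x \<in> carrier conv" for x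
      using that by (intro conv_eqI conv_closed) (auto simp: conv_apply cl)
    show "\<exists>y\<in>carrier conv. y \<oplus>\<^bsub>conv\<^esub> x = \<zero>\<^bsub>conv\<^esub>" if x: "x \<in> carrier conv" for x
    proof
      show *: "(\<ominus>\<^bsub>K\<^esub> \<one>\<^bsub>K\<^esub>) \<odot>\<^bsub>conv\<^esub> x \<in> carrier conv" using x by (intro conv_closed(5)[OF x x]) simp
      show "(\<ominus>\<^bsub>K\<^esub> \<one>\<^bsub>K\<^esub>) \<odot>\<^bsub>conv\<^esub> x \<oplus>\<^bsub>conv\<^esub> x = \<zero>\<^bsub>conv\<^esub>"
        by (rule conv_eqI) (use conv_closed[OF * x] x cl in \<open>auto simp: conv_apply Q.smult_l_minus Q.M.l_neg\<close>)
    qed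
  qed (intro conv_eqI conv_closed; simp add: conv_apply cl conv_closed Q.M.a_ac)+
qed (intro conv_eqI conv_closed; simp add: conv_apply linear_mapD(1)[OF conv_carrierD] conv_closed
    Q.smult_l_distr Q.smult_r_distr Q.smult_assoc1)+

lemma unital_algebra_conv: "unital_algebra K conv"
proof (rule unital_algebraI)
  show "field K" by (rule field_K)
  show "module K conv" by (rule module_conv)
  interpret C: module K conv by (rule module_conv)
  show "\<one>\<^bsub>conv\<^esub> \<in> carrier conv" using conv_closed(3)[OF C.M.zero_closed C.M.zero_closed] .
  have bil: "bilinear_map K H H Q (\<lambda>a b. x a \<otimes>\<^bsub>Q\<^esub> y b)" if "x \<in> carrier conv" "y \<in> carrier conv" for x y
    using that by (intro bilinear_mult Q conv_carrierD)
  \<comment> \<open>linearity of a map into a space of functions is checked at each point\<close>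
  have linI: "linear_map K conv conv F"
    if F: "\<And>x. x \<in> carrier conv \<Longrightarrow> F x \<in> carrier conv"
      and lin: "\<And>h. h \<in> carrier H \<Longrightarrow> linear_map K conv Q (\<lambda>x. F x h)" for F
  proof (rule linear_mapI)
    show "F (x \<oplus>\<^bsub>conv\<^esub> y) = F x \<oplus>\<^bsub>conv\<^esub> F y" if "x \<in> carrier conv" "y \<in> carrier conv" for x y
      by (rule conv_eqI) (use that F in \<open>auto simp: conv_apply(4) linear_mapD(2)[OF lin]\<close>)
    show "F (r \<odot>\<^bsub>conv\<^esub> x) = r \<odot>\<^bsub>conv\<^esub> F x" if "r \<in> carrier K" "x \<in> carrier conv" for r x
      by (rule conv_eqI) (use that F in \<open>auto simp: conv_apply(5) linear_mapD(3)[OF lin]\<close>)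
  qed (rule F)
  show "linear_map K conv conv (\<lambda>y. x \<otimes>\<^bsub>conv\<^esub> y)" if x: "x \<in> carrier conv" for x
  proof (rule linI)
    show "linear_map K conv Q (\<lambda>y. (x \<otimes>\<^bsub>conv\<^esub> y) h)" if h: "h \<in> carrier H" for h
      unfolding conv_apply(1)[OF h]
      by (intro linear_lift_param[OF module_H module_H Q.module_axioms module_conv] bil x comult_closed h
          linear_mult[OF Q] conv_eval_linear linear_mapD(1)[OF conv_carrierD])
  qed (intro conv_closed x)
  show "linear_map K conv conv (\<lambda>x. x \<otimes>\<^bsub>conv\<^esub> y)" if y: "y \<in> carrier conv" for y
  proof (rule linI)
    show "linear_map K conv Q (\<lambda>x. (x \<otimes>\<^bsub>conv\<^esub> y) h)" if h: "h \<in> carrier H" for h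
      unfolding conv_apply(1)[OF h]
      by (intro linear_lift_param[OF module_H module_H Q.module_axioms module_conv] bil y comult_closed h
          linear_mult[OF Q] conv_eval_linear linear_mapD(1)[OF conv_carrierD])
  qed (intro conv_closed y)
qed (intro conv_closed conv_assoc conv_one; assumption)+

end

end

section \<open>The antipode\<close>

context hopf_algebra
begin

text \<open>
  A bilinear map \<open>H \<times> H \<rightarrow> H\<close> as an element of \<open>Hom(H, Hom(H, H))\<close>.
\<close>

definition conv2 :: "('a \<Rightarrow> 'a \<Rightarrow> 'a) \<Rightarrow> 'a \<Rightarrow> 'a \<Rightarrow> 'a" where
  "conv2 f = (\<lambda>x\<in>carrier H. \<lambda>y\<in>carrier H. f x y)"

abbreviation "E \<equiv> conv_algebra K H H"
abbreviation "E2 \<equiv> conv_algebra K H E"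

lemmas algebra_E = unital_algebra_conv[OF algebra_H]

lemma linear_conv2: "bilinear_map K H H H f \<Longrightarrow> linear_map K H E (\<lambda>x. \<lambda>y\<in>carrier H. f x y)"
proof (rule linear_mapI)
  assume f: "bilinear_map K H H H f"
  show *: "(\<lambda>y\<in>carrier H. f x y) \<in> carrier E" if "x \<in> carrier H" for x
    by (rule conv_carrierI[OF algebra_H bilinear_mapD(1)[OF f that]])
  show "(\<lambda>y\<in>carrier H. f (x \<oplus>\<^bsub>H\<^esub> x') y) = (\<lambda>y\<in>carrier H. f x y) \<oplus>\<^bsub>E\<^esub> (\<lambda>y\<in>carrier H. f x' y)"
    if "x \<in> carrier H" "x' \<in> carrier H" for x x'
    by (rule conv_eqI[OF algebra_H])
      (use that in \<open>auto intro!: * conv_closed[OF algebra_H] simp: conv_apply[OF algebra_H] linear_mapD(2)[OF bilinear_mapD(2)[OF f]]\<close>)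
  show "(\<lambda>y\<in>carrier H. f (r \<odot>\<^bsub>H\<^esub> x) y) = r \<odot>\<^bsub>E\<^esub> (\<lambda>y\<in>carrier H. f x y)"
    if "x \<in> carrier H" "r \<in> carrier K" for x r
    by (rule conv_eqI[OF algebra_H])
      (use that in \<open>auto intro!: * conv_closed[OF algebra_H] simp: conv_apply[OF algebra_H] linear_mapD(3)[OF bilinear_mapD(2)[OF f]]\<close>)
qed

lemma conv2_closed: "bilinear_map K H H H f \<Longrightarrow> conv2 f \<in> carrier E2"
  unfolding conv2_def by (intro conv_carrierI algebra_E linear_conv2)

text \<open>
  The iterated convolution is the convolution of \<open>Hom(H \<otimes> H, H)\<close>, with
  \<open>(f * g)(x, y) = f(x\<^sub>1, y\<^sub>1) g(x\<^sub>2, y\<^sub>2)\<close>.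
\<close>

lemma conv2_mult:
  assumes f: "bilinear_map K H H H f" and g: "bilinear_map K H H H g" and x: "x \<in> carrier H" and y: "y \<in> carrier H"
  shows "(conv2 f \<otimes>\<^bsub>E2\<^esub> conv2 g) x y =
    tensor_lift H (\<lambda>x1 x2. tensor_lift H (\<lambda>y1 y2. f x1 y1 \<otimes>\<^bsub>H\<^esub> g x2 y2) (comult H y)) (comult H x)"
proof -
  note mE = unital_algebra_module[OF algebra_E]
  have bil: "bilinear_map K H H E (\<lambda>a b. conv2 f a \<otimes>\<^bsub>E\<^esub> conv2 g b)"
    by (intro bilinear_mult algebra_E conv_carrierD[OF algebra_E] conv2_closed f g)
  have bil2: "bilinear_map K H H H (\<lambda>y1 y2. f x1 y1 \<otimes>\<^bsub>H\<^esub> g x2 y2)" if "x1 \<in> carrier H" "x2 \<in> carrier H" for x1 x2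
    using that by (intro bilinear_mult algebra_H bilinear_mapD(1)[OF f] bilinear_mapD(1)[OF g])
  have "(conv2 f \<otimes>\<^bsub>E2\<^esub> conv2 g) x y = tensor_lift H (\<lambda>a b. (conv2 f a \<otimes>\<^bsub>E\<^esub> conv2 g b) y) (comult H x)"
    unfolding conv_apply(1)[OF algebra_E x]
    by (rule linear_tensor_lift[OF module_H module_H mE module_H bil conv_eval_linear[OF algebra_H y] comult_closed[OF x]])
  also have "\<dots> = tensor_lift H (\<lambda>x1 x2. tensor_lift H (\<lambda>y1 y2. f x1 y1 \<otimes>\<^bsub>H\<^esub> g x2 y2) (comult H y)) (comult H x)"
  proof (rule sweedler_cong[OF x module_H])
    fix a b assume ab: "a \<in> carrier H" "b \<in> carrier H"
    show "tensor_lift H (\<lambda>y1 y2. f a y1 \<otimes>\<^bsub>H\<^esub> g b y2) (comult H y) \<in> carrier H"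
      by (intro tensor_lift_closed[OF module_H module_H module_H] bil2 ab comult_closed y)
    show "(conv2 f a \<otimes>\<^bsub>E\<^esub> conv2 g b) y = tensor_lift H (\<lambda>y1 y2. f a y1 \<otimes>\<^bsub>H\<^esub> g b y2) (comult H y)"
      unfolding conv_apply(1)[OF algebra_H y]
      by (rule sweedler_cong[OF y module_H])
        (use ab bilinear_mapD(3)[OF f] bilinear_mapD(3)[OF g] in \<open>auto simp: conv2_def\<close>)
  qed
  finally show ?thesis .
qed

lemma conv2_one: "x \<in> carrier H \<Longrightarrow> y \<in> carrier H \<Longrightarrow>
    \<one>\<^bsub>E2\<^esub> x y = counit H x \<odot>\<^bsub>H\<^esub> (counit H y \<odot>\<^bsub>H\<^esub> \<one>\<^bsub>H\<^esub>)"
  by (simp add: conv_apply[OF algebra_E] conv_apply[OF algebra_H])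

lemma conv2_mult_eq_one:
  assumes f: "bilinear_map K H H H f" and g: "bilinear_map K H H H g"
    and eq: "\<And>x y. x \<in> carrier H \<Longrightarrow> y \<in> carrier H \<Longrightarrow>
      tensor_lift H (\<lambda>x1 x2. tensor_lift H (\<lambda>y1 y2. f x1 y1 \<otimes>\<^bsub>H\<^esub> g x2 y2) (comult H y)) (comult H x)
        = counit H x \<odot>\<^bsub>H\<^esub> (counit H y \<odot>\<^bsub>H\<^esub> \<one>\<^bsub>H\<^esub>)"
  shows "conv2 f \<otimes>\<^bsub>E2\<^esub> conv2 g = \<one>\<^bsub>E2\<^esub>"
proof -
  interpret E2: unital_algebra K E2 by (rule unital_algebra_conv[OF algebra_E])
  have *: "conv2 f \<otimes>\<^bsub>E2\<^esub> conv2 g \<in> carrier E2" using conv2_closed f g by simp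
  show ?thesis
  proof (rule conv_eqI[OF algebra_E * E2.A.one_closed])
    fix x assume x: "x \<in> carrier H"
    show "(conv2 f \<otimes>\<^bsub>E2\<^esub> conv2 g) x = \<one>\<^bsub>E2\<^esub> x"
      by (rule conv_eqI[OF algebra_H])
        (use x linear_mapD(1)[OF conv_carrierD[OF algebra_E *]] linear_mapD(1)[OF conv_carrierD[OF algebra_E E2.A.one_closed]]
          in \<open>auto simp: conv2_mult[OF f g] conv2_one eq\<close>)
  qed
qed

lemmas bilinear_mult_H = bilinear_mult[OF algebra_H]

text \<open>
  In \<open>Hom(H \<otimes> H, H)\<close> the multiplication of \<open>H\<close> has the left inverse \<open>(x, y) \<mapsto> S(xy)\<close> and the
  right inverse \<open>(x, y) \<mapsto> S(y) S(x)\<close>; in a monoid the two coincide.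
\<close>

lemma antipode_mult:
  assumes x: "x \<in> carrier H" and y: "y \<in> carrier H"
  shows "antipode H (x \<otimes>\<^bsub>H\<^esub> y) = antipode H y \<otimes>\<^bsub>H\<^esub> antipode H x"
proof -
  let ?rho_mu = "\<lambda>x y. tensor_lift H (\<lambda>x1 x2. tensor_lift H (\<lambda>y1 y2. antipode H (x1 \<otimes>\<^bsub>H\<^esub> y1) \<otimes>\<^bsub>H\<^esub> (x2 \<otimes>\<^bsub>H\<^esub> y2)) (comult H y)) (comult H x)"
    and ?mu_nu = "\<lambda>x y. tensor_lift H (\<lambda>x1 x2. tensor_lift H (\<lambda>y1 y2. (x1 \<otimes>\<^bsub>H\<^esub> y1) \<otimes>\<^bsub>H\<^esub> (antipode H y2 \<otimes>\<^bsub>H\<^esub> antipode H x2)) (comult H y)) (comult H x)"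
  interpret E2: unital_algebra K E2 by (rule unital_algebra_conv[OF algebra_E])
  note S = antipode_linear
  have mu: "bilinear_map K H H H (\<lambda>x y. x \<otimes>\<^bsub>H\<^esub> y)" by (intro bilinear_mult_H linear_id)
  have rho: "bilinear_map K H H H (\<lambda>x y. antipode H (x \<otimes>\<^bsub>H\<^esub> y))"
    by (rule linear_bilinear_compose[OF S mu])
  have nu: "bilinear_map K H H H (\<lambda>x y. antipode H y \<otimes>\<^bsub>H\<^esub> antipode H x)"
    by (intro bilinear_mapI linear_mult algebra_H S antipode_closed)
  have SI: "bilinear_map K H H H (\<lambda>a b. antipode H a \<otimes>\<^bsub>H\<^esub> b)"
    by (intro bilinear_mult_H S linear_id)
  have IS: "bilinear_map K H H H (\<lambda>a b. a \<otimes>\<^bsub>H\<^esub> antipode H b)"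
    by (intro bilinear_mult_H S linear_id)
  have 1: "conv2 (\<lambda>x y. antipode H (x \<otimes>\<^bsub>H\<^esub> y)) \<otimes>\<^bsub>E2\<^esub> conv2 (\<lambda>x y. x \<otimes>\<^bsub>H\<^esub> y) = \<one>\<^bsub>E2\<^esub>"
  proof (rule conv2_mult_eq_one[OF rho mu])
    fix x y assume xy: "x \<in> carrier H" "y \<in> carrier H"
    have "?rho_mu x y
      = tensor_lift H (\<lambda>a b. antipode H a \<otimes>\<^bsub>H\<^esub> b) (comult H (x \<otimes>\<^bsub>H\<^esub> y))"
      unfolding comult_mult[OF xy]
      by (rule tensor_lift_mult[OF algebra_H algebra_H module_H SI comult_closed comult_closed, symmetric]) (rule xy)+
    also have "\<dots> = counit H x \<odot>\<^bsub>H\<^esub> (counit H y \<odot>\<^bsub>H\<^esub> \<one>\<^bsub>H\<^esub>)"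
      using xy by (simp add: antipode_left counit_mult smult_assoc1 counit_closed)
    finally show "?rho_mu x y
      = counit H x \<odot>\<^bsub>H\<^esub> (counit H y \<odot>\<^bsub>H\<^esub> \<one>\<^bsub>H\<^esub>)" .
  qed
  have 2: "conv2 (\<lambda>x y. x \<otimes>\<^bsub>H\<^esub> y) \<otimes>\<^bsub>E2\<^esub> conv2 (\<lambda>x y. antipode H y \<otimes>\<^bsub>H\<^esub> antipode H x) = \<one>\<^bsub>E2\<^esub>"
  proof (rule conv2_mult_eq_one[OF mu nu])
    fix x y assume x: "x \<in> carrier H" and y: "y \<in> carrier H"
    have inner: "tensor_lift H (\<lambda>y1 y2. (x1 \<otimes>\<^bsub>H\<^esub> y1) \<otimes>\<^bsub>H\<^esub> (antipode H y2 \<otimes>\<^bsub>H\<^esub> antipode H x2)) (comult H y)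
        = counit H y \<odot>\<^bsub>H\<^esub> (x1 \<otimes>\<^bsub>H\<^esub> antipode H x2)" if x12: "x1 \<in> carrier H" "x2 \<in> carrier H" for x1 x2
    proof -
      have lin: "linear_map K H H (\<lambda>z. x1 \<otimes>\<^bsub>H\<^esub> (z \<otimes>\<^bsub>H\<^esub> antipode H x2))"
        by (intro linear_mult algebra_H linear_id antipode_closed x12)
      have "tensor_lift H (\<lambda>y1 y2. (x1 \<otimes>\<^bsub>H\<^esub> y1) \<otimes>\<^bsub>H\<^esub> (antipode H y2 \<otimes>\<^bsub>H\<^esub> antipode H x2)) (comult H y)
        = tensor_lift H (\<lambda>y1 y2. x1 \<otimes>\<^bsub>H\<^esub> ((y1 \<otimes>\<^bsub>H\<^esub> antipode H y2) \<otimes>\<^bsub>H\<^esub> antipode H x2)) (comult H y)"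
        by (rule sweedler_cong[OF y module_H]) (simp_all add: A.m_assoc antipode_closed x12)
      also have "\<dots> = x1 \<otimes>\<^bsub>H\<^esub> (tensor_lift H (\<lambda>y1 y2. y1 \<otimes>\<^bsub>H\<^esub> antipode H y2) (comult H y) \<otimes>\<^bsub>H\<^esub> antipode H x2)"
        by (rule linear_tensor_lift[OF module_H module_H module_H module_H IS lin comult_closed[OF y], symmetric])
      also have "\<dots> = counit H y \<odot>\<^bsub>H\<^esub> (x1 \<otimes>\<^bsub>H\<^esub> antipode H x2)"
        using x12 y by (simp add: antipode_right smult_mult_left smult_mult_right counit_closed antipode_closed)
      finally show ?thesis .
    qed
    have "?mu_nu x y
      = tensor_lift H (\<lambda>x1 x2. counit H y \<odot>\<^bsub>H\<^esub> (x1 \<otimes>\<^bsub>H\<^esub> antipode H x2)) (comult H x)"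
      by (rule sweedler_cong[OF x module_H]) (simp_all add: inner counit_closed antipode_closed y)
    also have "\<dots> = counit H y \<odot>\<^bsub>H\<^esub> tensor_lift H (\<lambda>x1 x2. x1 \<otimes>\<^bsub>H\<^esub> antipode H x2) (comult H x)"
      by (rule linear_tensor_lift[OF module_H module_H module_H module_H IS linear_smult_right[OF module_H counit_closed[OF y] linear_id]
            comult_closed[OF x], symmetric])
    also have "\<dots> = counit H x \<odot>\<^bsub>H\<^esub> (counit H y \<odot>\<^bsub>H\<^esub> \<one>\<^bsub>H\<^esub>)"
      using x y by (simp add: antipode_right counit_closed smult_assoc1[symmetric] K.m_comm)
    finally show "?mu_nu x y
      = counit H x \<odot>\<^bsub>H\<^esub> (counit H y \<odot>\<^bsub>H\<^esub> \<one>\<^bsub>H\<^esub>)" .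
  qed
  have "conv2 (\<lambda>x y. antipode H (x \<otimes>\<^bsub>H\<^esub> y)) = conv2 (\<lambda>x y. antipode H y \<otimes>\<^bsub>H\<^esub> antipode H x)"
    by (rule E2.A.inv_unique[OF 1 2 conv2_closed[OF mu] conv2_closed[OF rho] conv2_closed[OF nu]])
  then have "conv2 (\<lambda>x y. antipode H (x \<otimes>\<^bsub>H\<^esub> y)) x y = conv2 (\<lambda>x y. antipode H y \<otimes>\<^bsub>H\<^esub> antipode H x) x y" by simp
  then show ?thesis using x y by (simp add: conv2_def)
qed

lemma comult_one: "comult H \<one>\<^bsub>H\<^esub> = pure_tensor K H H \<one>\<^bsub>H\<^esub> \<one>\<^bsub>H\<^esub>"
  using comult_hom by (auto simp: algebra_hom_def ring_hom_def tensor_one algebra_H)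

lemma counit_one: "counit H \<one>\<^bsub>H\<^esub> = \<one>\<^bsub>K\<^esub>"
  using counit_hom by (auto simp: algebra_hom_def ring_hom_def)

lemma antipode_one: "antipode H \<one>\<^bsub>H\<^esub> = \<one>\<^bsub>H\<^esub>"
proof -
  have "bilinear_map K H H H (\<lambda>a b. antipode H a \<otimes>\<^bsub>H\<^esub> b)"
    by (intro bilinear_mult_H antipode_linear linear_id)
  then show ?thesis
    using antipode_left[OF A.one_closed]
    by (simp add: comult_one tensor_lift_pure module_H counit_one antipode_closed)
qed

abbreviation "Sinv \<equiv> inv_into (carrier H) (antipode H)"

lemma Sinv: "h \<in> carrier H \<Longrightarrow> Sinv h \<in> carrier H" "h \<in> carrier H \<Longrightarrow> antipode H (Sinv h) = h"
    "h \<in> carrier H \<Longrightarrow> Sinv (antipode H h) = h"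
  using antipode_bij by (auto simp: bij_betw_def inv_into_into f_inv_into_f)

lemma antipode_inj: "x \<in> carrier H \<Longrightarrow> y \<in> carrier H \<Longrightarrow> antipode H x = antipode H y \<Longrightarrow> x = y"
  by (metis Sinv(3))

lemma Sinv_linear: "linear_map K H H Sinv"
proof (rule linear_mapI)
  show "Sinv (x \<oplus>\<^bsub>H\<^esub> y) = Sinv x \<oplus>\<^bsub>H\<^esub> Sinv y" if "x \<in> carrier H" "y \<in> carrier H" for x y
    by (rule antipode_inj) (use that in \<open>simp_all add: Sinv linear_mapD[OF antipode_linear]\<close>)
  show "Sinv (r \<odot>\<^bsub>H\<^esub> x) = r \<odot>\<^bsub>H\<^esub> Sinv x" if "r \<in> carrier K" "x \<in> carrier H" for r x
    by (rule antipode_inj) (use that in \<open>simp_all add: Sinv linear_mapD[OF antipode_linear]\<close>)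
qed (rule Sinv)

text \<open>
  \<open>S\<close> is injective and reverses products, and it turns the sum on the left into
  \<open>S(h\<^sub>1) h\<^sub>2\<close>. This identity and the next say that \<open>S\<inverse>\<close> is inverse to the identity map in the
  convolution algebra of maps from \<open>H\<close> to the opposite of \<open>H\<close>.
\<close>

lemma Sinv_left:
  assumes h: "h \<in> carrier H"
  shows "tensor_lift H (\<lambda>a b. Sinv b \<otimes>\<^bsub>H\<^esub> a) (comult H h) = counit H h \<odot>\<^bsub>H\<^esub> \<one>\<^bsub>H\<^esub>"
proof (rule antipode_inj)
  have bil: "bilinear_map K H H H (\<lambda>a b. Sinv b \<otimes>\<^bsub>H\<^esub> a)"
    by (intro bilinear_mapI linear_mult algebra_H Sinv_linear linear_id Sinv)
  show "tensor_lift H (\<lambda>a b. Sinv b \<otimes>\<^bsub>H\<^esub> a) (comult H h) \<in> carrier H"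
    by (intro tensor_lift_closed[OF module_H module_H module_H] bil comult_closed h)
  have "antipode H (tensor_lift H (\<lambda>a b. Sinv b \<otimes>\<^bsub>H\<^esub> a) (comult H h))
    = tensor_lift H (\<lambda>a b. antipode H (Sinv b \<otimes>\<^bsub>H\<^esub> a)) (comult H h)"
    by (rule linear_tensor_lift[OF module_H module_H module_H module_H bil antipode_linear comult_closed[OF h]])
  also have "\<dots> = tensor_lift H (\<lambda>a b. antipode H a \<otimes>\<^bsub>H\<^esub> b) (comult H h)"
    by (rule sweedler_cong[OF h module_H]) (simp_all add: antipode_mult Sinv antipode_closed)
  also have "\<dots> = antipode H (counit H h \<odot>\<^bsub>H\<^esub> \<one>\<^bsub>H\<^esub>)"
    using h by (simp add: antipode_left linear_mapD(3)[OF antipode_linear] counit_closed antipode_one)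
  finally show "antipode H (tensor_lift H (\<lambda>a b. Sinv b \<otimes>\<^bsub>H\<^esub> a) (comult H h)) = antipode H (counit H h \<odot>\<^bsub>H\<^esub> \<one>\<^bsub>H\<^esub>)" .
qed (use h counit_closed in auto)

lemma Sinv_right:
  assumes h: "h \<in> carrier H"
  shows "tensor_lift H (\<lambda>a b. b \<otimes>\<^bsub>H\<^esub> Sinv a) (comult H h) = counit H h \<odot>\<^bsub>H\<^esub> \<one>\<^bsub>H\<^esub>"
proof (rule antipode_inj)
  have bil: "bilinear_map K H H H (\<lambda>a b. b \<otimes>\<^bsub>H\<^esub> Sinv a)"
    by (intro bilinear_mapI linear_mult algebra_H Sinv_linear linear_id Sinv)
  show "tensor_lift H (\<lambda>a b. b \<otimes>\<^bsub>H\<^esub> Sinv a) (comult H h) \<in> carrier H"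
    by (intro tensor_lift_closed[OF module_H module_H module_H] bil comult_closed h)
  have "antipode H (tensor_lift H (\<lambda>a b. b \<otimes>\<^bsub>H\<^esub> Sinv a) (comult H h))
    = tensor_lift H (\<lambda>a b. antipode H (b \<otimes>\<^bsub>H\<^esub> Sinv a)) (comult H h)"
    by (rule linear_tensor_lift[OF module_H module_H module_H module_H bil antipode_linear comult_closed[OF h]])
  also have "\<dots> = tensor_lift H (\<lambda>a b. a \<otimes>\<^bsub>H\<^esub> antipode H b) (comult H h)"
    by (rule sweedler_cong[OF h module_H]) (simp_all add: antipode_mult Sinv antipode_closed)
  also have "\<dots> = antipode H (counit H h \<odot>\<^bsub>H\<^esub> \<one>\<^bsub>H\<^esub>)"
    using h by (simp add: antipode_right linear_mapD(3)[OF antipode_linear] counit_closed antipode_one)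
  finally show "antipode H (tensor_lift H (\<lambda>a b. b \<otimes>\<^bsub>H\<^esub> Sinv a) (comult H h)) = antipode H (counit H h \<odot>\<^bsub>H\<^esub> \<one>\<^bsub>H\<^esub>)" .
qed (use h counit_closed in auto)

end

section \<open>The opposite and the dual of a finite-dimensional Hopf algebra\<close>

locale finite_hopf_algebra = hopf_algebra K H
  for K :: "('k, 'c) ring_scheme" (structure) and H :: "('k, 'a) hopf" +
  assumes finite_dim: "finite_dim K H"
begin

abbreviation "P \<equiv> op_hopf H"
abbreviation "D \<equiv> dual_hopf K H"
abbreviation "S \<equiv> scalar_algebra K"

lemma op_simps [simp]:
  "carrier P = carrier H" "x \<otimes>\<^bsub>P\<^esub> y = y \<otimes>\<^bsub>H\<^esub> x" "\<one>\<^bsub>P\<^esub> = \<one>\<^bsub>H\<^esub>" "\<zero>\<^bsub>P\<^esub> = \<zero>\<^bsub>H\<^esub>"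
  "ring.add P = ring.add H" "smult P = smult H" "comult P = comult H" "counit P = counit H"
  by (simp_all add: op_hopf_def)

lemma algebra_P: "unital_algebra K P"
  by (rule unital_algebra_opposite[OF algebra_H]) (simp_all, simp add: op_hopf_def)

lemmas module_P = unital_algebra_module[OF algebra_P]

lemma linear_map_op [simp]: "linear_map K P M = linear_map K H M" "linear_map K M P = linear_map K M H"
  by (simp_all add: linear_map_def fun_eq_iff)

lemma tensor_kernel_op: "tensor_kernel K P V = tensor_kernel K H V"
  by (simp add: tensor_kernel_def tensor_relations_def)

lemma tensor_op_simps:
  "carrier (tensor K P V) = carrier (tensor K H V)" "ring.add (tensor K P V) = ring.add (tensor K H V)"
  "\<zero>\<^bsub>tensor K P V\<^esub> = \<zero>\<^bsub>tensor K H V\<^esub>" "pure_tensor K P V = pure_tensor K H V"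
  by (simp_all add: tensor_def Let_def tensor_kernel_op pure_tensor_def tensor_class_def fun_eq_iff)

lemma tensor_lift_op: "tensor_lift P = tensor_lift H" "tensor_lift (tensor K P V) = tensor_lift (tensor K H V)"
  by (intro tensor_lift_target_cong; simp add: tensor_op_simps)+

lemma algebra_S: "unital_algebra K S" by (rule unital_algebra_scalar[OF field_K])
lemmas module_S = unital_algebra_module[OF algebra_S]

lemma dual_algebra_conv: "dual_algebra K H = conv_algebra K H S"
  by (simp add: dual_algebra_def conv_algebra_def tensor_lift_scalar[of K] restrict_def counit_closed fun_eq_iff)

lemma dual_simps [simp]:
  "carrier D = carrier (conv_algebra K H S)" "monoid.mult D = monoid.mult (conv_algebra K H S)"
  "\<one>\<^bsub>D\<^esub> = \<one>\<^bsub>conv_algebra K H S\<^esub>" "\<zero>\<^bsub>D\<^esub> = \<zero>\<^bsub>conv_algebra K H S\<^esub>"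
  "ring.add D = ring.add (conv_algebra K H S)" "smult D = smult (conv_algebra K H S)"
  "comult D = dual_comult K H" "counit D = (\<lambda>\<theta>. \<theta> \<one>\<^bsub>H\<^esub>)"
  by (simp_all add: dual_hopf_def dual_algebra_conv[symmetric] module.defs hopf.defs)

lemma algebra_D: "unital_algebra K D"
  by (rule unital_algebra_cong[OF unital_algebra_conv[OF algebra_S]]) simp_all

lemmas module_D = unital_algebra_module[OF algebra_D]

text \<open>
  The coproduct of the dual is characterised by means of the dual algebra, but takes values in the tensor
  square of the dual Hopf algebra.
\<close>

lemma tensor_dual: "tensor K (dual_algebra K H) (dual_algebra K H) = tensor K D D"
  by (simp add: tensor_def Let_def pure_tensor_def tensor_class_def tensor_kernel_def tensor_relations_def
    dual_algebra_conv)

lemma dual_linear: "\<theta> \<in> carrier D \<Longrightarrow> linear_map K H S \<theta>"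
  using conv_carrierD[OF algebra_S] by simp

lemma dual_value: "\<theta> \<in> carrier D \<Longrightarrow> h \<in> carrier H \<Longrightarrow> \<theta> h \<in> carrier K"
  using linear_mapD(1)[OF dual_linear] by simp

lemma eval_linear: "h \<in> carrier H \<Longrightarrow> linear_map K D S (\<lambda>\<theta>. \<theta> h)"
  using conv_eval_linear[OF algebra_S] by (simp add: linear_map_def)

lemma dual_eqI: "\<theta> \<in> carrier D \<Longrightarrow> \<psi> \<in> carrier D \<Longrightarrow> (\<And>h. h \<in> carrier H \<Longrightarrow> \<theta> h = \<psi> h) \<Longrightarrow> \<theta> = \<psi>"
  using conv_eqI[OF algebra_S] by simp

text \<open>
  The basis that enters the definition of the canonical element.
\<close>

definition basis :: "'a set" where "basis = (SOME B. finite_basis K H B)"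

definition coord :: "'a \<Rightarrow> 'a \<Rightarrow> 'k" where "coord = coord_functional K H basis"

lemma finite_basis: "finite_basis K H basis"
  unfolding basis_def using finite_dim unfolding finite_dim_def by (rule someI_ex)

lemma basis_finite: "finite basis" and basis_closed: "b \<in> basis \<Longrightarrow> b \<in> carrier H"
  using finite_basis by (auto simp: finite_basis_def)

text \<open>
  The last part gives linearity of the coordinate functionals: the coordinates of a sum or a multiple are
  read off from the expansion that is obtained by adding or scaling the given ones.
\<close>

lemma coord_eq:
  assumes h: "h \<in> carrier H"
  shows "b \<in> basis \<Longrightarrow> coord b h \<in> carrier K"
    and "h = (\<Oplus>\<^bsub>H\<^esub>b\<in>basis. coord b h \<odot>\<^bsub>H\<^esub> b)"
    and "(\<And>b. b \<in> basis \<Longrightarrow> c b \<in> carrier K) \<Longrightarrow> h = (\<Oplus>\<^bsub>H\<^esub>b\<in>basis. c b \<odot>\<^bsub>H\<^esub> b) \<Longrightarrow> b \<in> basis \<Longrightarrow> coord b h = c b"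
proof -
  let ?P = "\<lambda>c. c \<in> basis \<rightarrow>\<^sub>E carrier K \<and> h = (\<Oplus>\<^bsub>H\<^esub>e\<in>basis. c e \<odot>\<^bsub>H\<^esub> e)"
  have ex1: "\<exists>!c. ?P c" using finite_basis h unfolding finite_basis_def by blast
  have P: "?P (THE c. ?P c)" by (rule theI'[OF ex1])
  have coord: "coord b h = (THE c. ?P c) b" for b
    using h by (simp add: coord_def coord_functional_def)
  show 1: "b \<in> basis \<Longrightarrow> coord b h \<in> carrier K"
    unfolding coord using P by auto
  show "h = (\<Oplus>\<^bsub>H\<^esub>b\<in>basis. coord b h \<odot>\<^bsub>H\<^esub> b)"
    unfolding coord using P by blast
  assume c: "\<And>b. b \<in> basis \<Longrightarrow> c b \<in> carrier K" and hc: "h = (\<Oplus>\<^bsub>H\<^esub>b\<in>basis. c b \<odot>\<^bsub>H\<^esub> b)" and b: "b \<in> basis"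
  have "h = (\<Oplus>\<^bsub>H\<^esub>b\<in>basis. restrict c basis b \<odot>\<^bsub>H\<^esub> b)"
    by (subst hc) (rule M.finsum_cong', use c basis_closed in auto)
  then have "?P (restrict c basis)" using c by auto
  then have "(THE c. ?P c) = restrict c basis" using ex1 P by blast
  then show "coord b h = c b" using b by (simp add: coord)
qed

lemma coord_closed:
  assumes b: "b \<in> basis" shows "coord b \<in> carrier D"
proof -
  have "linear_map K H S (coord b)"
  proof (rule linear_mapI)
    show "coord b x \<in> carrier S" if "x \<in> carrier H" for x using coord_eq(1)[OF that b] by simp
    show "coord b (x \<oplus>\<^bsub>H\<^esub> y) = coord b x \<oplus>\<^bsub>S\<^esub> coord b y" if x: "x \<in> carrier H" and y: "y \<in> carrier H" for x y
    proof -
      have "x \<oplus>\<^bsub>H\<^esub> y = (\<Oplus>\<^bsub>H\<^esub>b\<in>basis. coord b x \<odot>\<^bsub>H\<^esub> b) \<oplus>\<^bsub>H\<^esub> (\<Oplus>\<^bsub>H\<^esub>b\<in>basis. coord b y \<odot>\<^bsub>H\<^esub> b)"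
        using coord_eq(2)[OF x] coord_eq(2)[OF y] by simp
      also have "\<dots> = (\<Oplus>\<^bsub>H\<^esub>b\<in>basis. coord b x \<odot>\<^bsub>H\<^esub> b \<oplus>\<^bsub>H\<^esub> coord b y \<odot>\<^bsub>H\<^esub> b)"
        by (rule M.finsum_addf[symmetric]) (use coord_eq(1) x y basis_closed in auto)
      also have "\<dots> = (\<Oplus>\<^bsub>H\<^esub>b\<in>basis. (coord b x \<oplus> coord b y) \<odot>\<^bsub>H\<^esub> b)"
        by (rule M.finsum_cong') (use coord_eq(1) x y basis_closed in \<open>auto simp: smult_l_distr\<close>)
      finally have eq: "x \<oplus>\<^bsub>H\<^esub> y = (\<Oplus>\<^bsub>H\<^esub>b\<in>basis. (coord b x \<oplus> coord b y) \<odot>\<^bsub>H\<^esub> b)" .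
      have "coord b (x \<oplus>\<^bsub>H\<^esub> y) = coord b x \<oplus> coord b y"
        by (rule coord_eq(3)[where c="\<lambda>b. coord b x \<oplus> coord b y", OF M.a_closed[OF x y] _ eq b])
          (use x y coord_eq(1) in auto)
      then show ?thesis by simp
    qed
    show "coord b (r \<odot>\<^bsub>H\<^esub> x) = r \<odot>\<^bsub>S\<^esub> coord b x" if r: "r \<in> carrier K" and x: "x \<in> carrier H" for r x
    proof -
      have "r \<odot>\<^bsub>H\<^esub> x = r \<odot>\<^bsub>H\<^esub> (\<Oplus>\<^bsub>H\<^esub>b\<in>basis. coord b x \<odot>\<^bsub>H\<^esub> b)"
        using coord_eq(2)[OF x] by simp
      also have "\<dots> = (\<Oplus>\<^bsub>H\<^esub>b\<in>basis. r \<odot>\<^bsub>H\<^esub> (coord b x \<odot>\<^bsub>H\<^esub> b))"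
        by (rule finsum_smult_ldistr) (use coord_eq(1) x r basis_closed basis_finite in auto)
      also have "\<dots> = (\<Oplus>\<^bsub>H\<^esub>b\<in>basis. (r \<otimes> coord b x) \<odot>\<^bsub>H\<^esub> b)"
        by (rule M.finsum_cong') (use coord_eq(1) x r basis_closed in \<open>auto simp: smult_assoc1\<close>)
      finally have eq: "r \<odot>\<^bsub>H\<^esub> x = (\<Oplus>\<^bsub>H\<^esub>b\<in>basis. (r \<otimes> coord b x) \<odot>\<^bsub>H\<^esub> b)" .
      have "coord b (r \<odot>\<^bsub>H\<^esub> x) = r \<otimes> coord b x"
        by (rule coord_eq(3)[where c="\<lambda>b. r \<otimes> coord b x", OF smult_closed[OF r x] _ eq b])
          (use x r coord_eq(1) in auto)
      then show ?thesis by simp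
    qed
  qed
  moreover have "coord b \<in> extensional (carrier H)" by (simp add: coord_def coord_functional_def)
  ultimately show ?thesis by (simp add: conv_algebra_def)
qed

text \<open>
  Pairing of the factor \<open>H\<^sup>*\<close> of a tensor with \<open>h\<close>. The map \<open>h \<mapsto> ev V h t\<close> is the linear map
  \<open>H \<rightarrow> V\<close> that corresponds to \<open>t\<close>.
\<close>

definition ev :: "('k, 'v, 'n) module_scheme \<Rightarrow> 'a \<Rightarrow> ('v, 'a \<Rightarrow> 'k) tens \<Rightarrow> 'v" where
  "ev V h = tensor_lift V (\<lambda>v \<theta>. \<theta> h \<odot>\<^bsub>V\<^esub> v)"

text \<open>
  Inverse to \<open>t \<mapsto> (h \<mapsto> ev V h t)\<close>. The canonical element is its value at the identity map.
\<close>

definition tensor_of_map :: "('k, 'v, 'n) module_scheme \<Rightarrow> ('a \<Rightarrow> 'v) \<Rightarrow> ('v, 'a \<Rightarrow> 'k) tens" where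
  "tensor_of_map V f = (\<Oplus>\<^bsub>tensor K V D\<^esub>b\<in>basis. pure_tensor K V D (f b) (coord b))"

context
  fixes V :: "('k, 'v, 'n) module_scheme"
  assumes V: "module K V"
begin

interpretation V: module K V by (rule V)

lemma ev_bilinear: "h \<in> carrier H \<Longrightarrow> bilinear_map K V D V (\<lambda>v \<theta>. \<theta> h \<odot>\<^bsub>V\<^esub> v)"
  by (intro bilinear_mapI linear_smult_left linear_smult_right linear_id eval_linear V dual_value)

lemma ev_linear: "h \<in> carrier H \<Longrightarrow> linear_map K (tensor K V D) V (ev V h)"
  unfolding ev_def by (intro tensor_lift_linear V module_D ev_bilinear)

lemma ev_pure: "h \<in> carrier H \<Longrightarrow> v \<in> carrier V \<Longrightarrow> \<theta> \<in> carrier D \<Longrightarrow> ev V h (pure_tensor K V D v \<theta>) = \<theta> h \<odot>\<^bsub>V\<^esub> v"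
  unfolding ev_def by (rule tensor_lift_pure[OF V module_D V ev_bilinear])

lemma ev_linear_right: "t \<in> carrier (tensor K V D) \<Longrightarrow> linear_map K H V (\<lambda>h. ev V h t)"
  unfolding ev_def
  by (intro linear_lift_param[OF V module_D V module_H] ev_bilinear linear_smult_left dual_linear V)

lemma tensor_of_map_closed:
  assumes f: "linear_map K H V f"
  shows "tensor_of_map V f \<in> carrier (tensor K V D)"
proof -
  interpret T: module K "tensor K V D" by (intro module_tensor V module_D)
  show ?thesis
    unfolding tensor_of_map_def
    by (rule T.M.finsum_closed) (auto intro!: pure_tensor_closed V module_D coord_closed linear_mapD(1)[OF f] basis_closed
      simp del: dual_simps)
qed

lemma ev_tensor_of_map:
  assumes f: "linear_map K H V f" and h: "h \<in> carrier H"
  shows "ev V h (tensor_of_map V f) = f h"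
proof -
  note fc = linear_mapD(1)[OF f]
  have "ev V h (tensor_of_map V f) = (\<Oplus>\<^bsub>V\<^esub>b\<in>basis. ev V h (pure_tensor K V D (f b) (coord b)))"
    unfolding tensor_of_map_def
    by (rule linear_map_finsum[OF module_tensor[OF V module_D] V ev_linear[OF h]])
      (use fc in \<open>auto intro!: pure_tensor_closed V module_D coord_closed basis_closed simp del: dual_simps\<close>)
  also have "\<dots> = (\<Oplus>\<^bsub>V\<^esub>b\<in>basis. f (coord b h \<odot>\<^bsub>H\<^esub> b))"
    by (rule V.M.finsum_cong')
      (use h in \<open>auto simp: ev_pure fc basis_closed coord_closed linear_mapD(3)[OF f] coord_eq(1) simp del: dual_simps\<close>)
  also have "\<dots> = f (\<Oplus>\<^bsub>H\<^esub>b\<in>basis. coord b h \<odot>\<^bsub>H\<^esub> b)"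
    by (rule linear_map_finsum[OF module_H V f, symmetric]) (use h in \<open>auto simp: basis_closed coord_eq(1)\<close>)
  also have "\<dots> = f h" using coord_eq(2)[OF h] by simp
  finally show ?thesis .
qed

text \<open>
  On \<open>v \<otimes> \<theta>\<close> this is \<open>\<Sum>\<^sub>b \<theta>(b) v \<otimes> b\<^sup>* = v \<otimes> \<Sum>\<^sub>b \<theta>(b) b\<^sup>* = v \<otimes> \<theta>\<close>.
\<close>

lemma tensor_of_map_ev:
  assumes t: "t \<in> carrier (tensor K V D)"
  shows "tensor_of_map V (\<lambda>h. ev V h t) = t"
proof (rule tensor_map_eqI[OF V module_D _ linear_id _ t])
  note T = module_tensor[OF V module_D]
  interpret T: module K "tensor K V D" by (rule T)
  interpret D: module K D by (rule module_D)
  show "linear_map K (tensor K V D) (tensor K V D) (\<lambda>t. tensor_of_map V (\<lambda>h. ev V h t))"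
    unfolding tensor_of_map_def
    by (intro linear_finsum T basis_finite linear_pure V module_D coord_closed ev_linear basis_closed)
  fix v \<theta> assume v: "v \<in> carrier V" and \<theta>: "\<theta> \<in> carrier D"
  have closed: "\<theta> b \<odot>\<^bsub>D\<^esub> coord b \<in> carrier D" if "b \<in> basis" for b
    using that by (intro D.smult_closed dual_value \<theta> coord_closed basis_closed)
  have "(\<Oplus>\<^bsub>D\<^esub>b\<in>basis. \<theta> b \<odot>\<^bsub>D\<^esub> coord b) = \<theta>"
  proof (rule dual_eqI[OF _ \<theta>])
    show "(\<Oplus>\<^bsub>D\<^esub>b\<in>basis. \<theta> b \<odot>\<^bsub>D\<^esub> coord b) \<in> carrier D"
      by (rule D.M.finsum_closed) (use closed in auto)
    fix h assume h: "h \<in> carrier H"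
    have "(\<Oplus>\<^bsub>D\<^esub>b\<in>basis. \<theta> b \<odot>\<^bsub>D\<^esub> coord b) h = (\<Oplus>\<^bsub>S\<^esub>b\<in>basis. (\<theta> b \<odot>\<^bsub>D\<^esub> coord b) h)"
      by (rule linear_map_finsum[OF module_D module_S eval_linear[OF h]]) (use closed in auto)
    also have "\<dots> = (\<Oplus>\<^bsub>S\<^esub>b\<in>basis. \<theta> (coord b h \<odot>\<^bsub>H\<^esub> b))"
      by (rule abelian_monoid.finsum_cong')
        (use h module_S \<theta> in \<open>auto simp: module_def abelian_group_def linear_mapD[OF dual_linear[OF \<theta>]] linear_mapD[OF eval_linear]
           coord_closed basis_closed coord_eq(1) dual_value[OF \<theta>] K.m_comm simp del: dual_simps\<close>)
    also have "\<dots> = \<theta> (\<Oplus>\<^bsub>H\<^esub>b\<in>basis. coord b h \<odot>\<^bsub>H\<^esub> b)"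
      by (rule linear_map_finsum[OF module_H module_S dual_linear[OF \<theta>], symmetric]) (use h in \<open>auto simp: basis_closed coord_eq(1)\<close>)
    also have "\<dots> = \<theta> h" using coord_eq(2)[OF h] by simp
    finally show "(\<Oplus>\<^bsub>D\<^esub>b\<in>basis. \<theta> b \<odot>\<^bsub>D\<^esub> coord b) h = \<theta> h" .
  qed
  then have "pure_tensor K V D v \<theta> = pure_tensor K V D v (\<Oplus>\<^bsub>D\<^esub>b\<in>basis. \<theta> b \<odot>\<^bsub>D\<^esub> coord b)" by simp
  also have "\<dots> = (\<Oplus>\<^bsub>tensor K V D\<^esub>b\<in>basis. pure_tensor K V D v (\<theta> b \<odot>\<^bsub>D\<^esub> coord b))"
    by (rule linear_map_finsum[OF module_D T linear_pure(2)[OF V module_D v linear_id]]) (use closed in auto)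
  also have "\<dots> = tensor_of_map V (\<lambda>h. ev V h (pure_tensor K V D v \<theta>))"
    unfolding tensor_of_map_def
  proof (rule T.M.finsum_cong')
    fix b assume b: "b \<in> basis"
    show "pure_tensor K V D v (\<theta> b \<odot>\<^bsub>D\<^esub> coord b) = pure_tensor K V D (ev V b (pure_tensor K V D v \<theta>)) (coord b)"
      using linear_mapD(3)[OF linear_pure(2)[OF V module_D v linear_id] dual_value[OF \<theta> basis_closed[OF b]] coord_closed[OF b]]
        linear_mapD(3)[OF linear_pure(1)[OF V module_D coord_closed[OF b] linear_id] dual_value[OF \<theta> basis_closed[OF b]] v]
        ev_pure[OF basis_closed[OF b] v \<theta>]
      by simp
  qed (use v \<theta> in \<open>auto intro!: pure_tensor_closed V module_D coord_closed linear_mapD(1)[OF ev_linear] basis_closed simp del: dual_simps\<close>)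
  finally show "tensor_of_map V (\<lambda>h. ev V h (pure_tensor K V D v \<theta>)) = pure_tensor K V D v \<theta>" by simp
qed

lemma ev_eqI:
  assumes "t \<in> carrier (tensor K V D)" "t' \<in> carrier (tensor K V D)"
    and eq: "\<And>h. h \<in> carrier H \<Longrightarrow> ev V h t = ev V h t'"
  shows "t = t'"
proof -
  interpret T: module K "tensor K V D" by (intro module_tensor V module_D)
  have "tensor_of_map V (\<lambda>h. ev V h t) = tensor_of_map V (\<lambda>h. ev V h t')"
    unfolding tensor_of_map_def
    by (rule T.M.finsum_cong')
      (use assms in \<open>auto simp: eq basis_closed intro!: pure_tensor_closed V module_D coord_closed linear_mapD(1)[OF ev_linear] simp del: dual_simps\<close>)
  then show ?thesis using assms(1,2) by (simp add: tensor_of_map_ev)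
qed

end

end

section \<open>The canonical element\<close>

context finite_hopf_algebra
begin

text \<open>
  The product of the dual is defined by the coproduct of \<open>H\<close>, so \<open>V \<otimes> H\<^sup>* \<rightarrow> Hom(H, V)\<close> is
  multiplicative for the convolution.
\<close>

lemma ev_mult:
  assumes V: "unital_algebra K V" and U: "U \<in> carrier (tensor K V D)" and W: "W \<in> carrier (tensor K V D)"
    and h: "h \<in> carrier H"
  shows "ev V h (U \<otimes>\<^bsub>tensor K V D\<^esub> W) = tensor_lift V (\<lambda>a b. ev V a U \<otimes>\<^bsub>V\<^esub> ev V b W) (comult H h)"
proof -
  let ?conv = "\<lambda>U W. tensor_lift V (\<lambda>a b. ev V a U \<otimes>\<^bsub>V\<^esub> ev V b W) (comult H h)"
  interpret V: unital_algebra K V by fact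
  note mV = V.module_axioms
  note T = unital_algebra_tensor[OF V algebra_D]
  note mT = module_tensor[OF mV module_D]
  have bil: "bilinear_map K H H V (\<lambda>a b. ev V a U \<otimes>\<^bsub>V\<^esub> ev V b W)"
    if "U \<in> carrier (tensor K V D)" "W \<in> carrier (tensor K V D)" for U W
    by (intro bilinear_mult V ev_linear_right mV that)
  note evc = linear_mapD(1)[OF ev_linear[OF mV]]
  show ?thesis
  proof (rule tensor_map_eqI[OF mV module_D _ _ _ U])
    show "linear_map K (tensor K V D) V (\<lambda>U. ev V h (U \<otimes>\<^bsub>tensor K V D\<^esub> W))"
      by (rule linear_compose[OF ev_linear[OF mV h] linear_mult(1)[OF T W linear_id]])
    show "linear_map K (tensor K V D) V (\<lambda>U. ?conv U W)"
      by (intro linear_lift_param[OF module_H module_H mV mT] bil W comult_closed h linear_mult(1)[OF V] ev_linear mV evc)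
    fix v \<theta> assume v: "v \<in> carrier V" and \<theta>: "\<theta> \<in> carrier D"
    note p = pure_tensor_closed[OF mV module_D v \<theta>]
    show "ev V h (pure_tensor K V D v \<theta> \<otimes>\<^bsub>tensor K V D\<^esub> W)
      = ?conv (pure_tensor K V D v \<theta>) W"
    proof (rule tensor_map_eqI[OF mV module_D _ _ _ W])
      show "linear_map K (tensor K V D) V (\<lambda>W. ev V h (pure_tensor K V D v \<theta> \<otimes>\<^bsub>tensor K V D\<^esub> W))"
        by (rule linear_compose[OF ev_linear[OF mV h] linear_mult(2)[OF T p linear_id]])
      show "linear_map K (tensor K V D) V (\<lambda>W. ?conv (pure_tensor K V D v \<theta>) W)"
        by (intro linear_lift_param[OF module_H module_H mV mT] bil p comult_closed h linear_mult(2)[OF V] ev_linear mV evc)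
      fix v' \<psi> assume v': "v' \<in> carrier V" and \<psi>: "\<psi> \<in> carrier D"
      have prod: "\<theta> \<otimes>\<^bsub>D\<^esub> \<psi> \<in> carrier D"
        using linear_mapD(1)[OF linear_mult(1)[OF algebra_D \<psi> linear_id] \<theta>] .
      have "ev V h (pure_tensor K V D v \<theta> \<otimes>\<^bsub>tensor K V D\<^esub> pure_tensor K V D v' \<psi>)
        = (\<theta> \<otimes>\<^bsub>D\<^esub> \<psi>) h \<odot>\<^bsub>V\<^esub> (v \<otimes>\<^bsub>V\<^esub> v')"
        unfolding tensor_mult_pure[OF V algebra_D v \<theta> v' \<psi>] by (rule ev_pure[OF mV h _ prod]) (use v v' in simp)
      also have "\<dots> = tensor_lift S (\<lambda>a b. \<theta> a \<otimes>\<^bsub>S\<^esub> \<psi> b) (comult H h) \<odot>\<^bsub>V\<^esub> (v \<otimes>\<^bsub>V\<^esub> v')"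
        using conv_apply(1)[OF algebra_S h, of \<theta> \<psi>] by simp
      also have "\<dots> = tensor_lift V (\<lambda>a b. (\<theta> a \<otimes>\<^bsub>S\<^esub> \<psi> b) \<odot>\<^bsub>V\<^esub> (v \<otimes>\<^bsub>V\<^esub> v')) (comult H h)"
        by (rule linear_tensor_lift[OF module_H module_H module_S mV
              bilinear_mult[OF algebra_S dual_linear[OF \<theta>] dual_linear[OF \<psi>]]
              linear_smult_left[OF mV V.A.m_closed[OF v v'] linear_id] comult_closed[OF h]])
      also have "\<dots> = ?conv (pure_tensor K V D v \<theta>) (pure_tensor K V D v' \<psi>)"
        by (rule sweedler_cong[OF h mV])
          (use v v' in \<open>auto simp: ev_pure[OF mV _ v \<theta>] ev_pure[OF mV _ v' \<psi>] V.smult_mult_left V.smult_mult_right V.smult_assoc1[symmetric]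
            K.m_comm dual_value[OF \<theta>] dual_value[OF \<psi>]\<close>)
      finally show "ev V h (pure_tensor K V D v \<theta> \<otimes>\<^bsub>tensor K V D\<^esub> pure_tensor K V D v' \<psi>)
        = ?conv (pure_tensor K V D v \<theta>) (pure_tensor K V D v' \<psi>)" .
    qed
  qed
qed

abbreviation "PD \<equiv> tensor K P D"
lemmas algebra_PD = unital_algebra_tensor[OF algebra_P algebra_D]
lemmas module_PD = module_tensor[OF module_P module_D]

abbreviation "w \<equiv> canonical_op K H"

lemma canonical_op_eq: "w = tensor_of_map P (\<lambda>h. h)"
  by (simp add: canonical_op_def tensor_of_map_def basis_def coord_def Let_def)

lemma canonical_op_closed: "w \<in> carrier PD"
  unfolding canonical_op_eq by (rule tensor_of_map_closed[OF module_P]) (simp add: linear_id)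

lemma ev_canonical_op: "h \<in> carrier H \<Longrightarrow> ev P h w = h"
  unfolding canonical_op_eq by (rule ev_tensor_of_map[OF module_P]) (simp_all add: linear_id)

text \<open>
  Under the pairing the canonical element is the identity map. Its inverse is therefore the tensor that
  corresponds to the inverse of the antipode, by \<open>Sinv_left\<close> and \<open>Sinv_right\<close>.
\<close>

lemma canonical_op_unit: "w \<in> Units PD"
proof -
  interpret PD: unital_algebra K PD by (rule algebra_PD)
  define w' where "w' = tensor_of_map P Sinv"
  have w': "w' \<in> carrier PD" unfolding w'_def by (rule tensor_of_map_closed[OF module_P]) (simp add: Sinv_linear)
  have evw': "ev P h w' = Sinv h" if "h \<in> carrier H" for h
    unfolding w'_def by (rule ev_tensor_of_map[OF module_P _ that]) (simp add: Sinv_linear)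
  have ev_one: "ev P h \<one>\<^bsub>PD\<^esub> = counit H h \<odot>\<^bsub>H\<^esub> \<one>\<^bsub>H\<^esub>" if h: "h \<in> carrier H" for h
  proof -
    interpret D: unital_algebra K D by (rule algebra_D)
    have "ev P h \<one>\<^bsub>PD\<^esub> = \<one>\<^bsub>D\<^esub> h \<odot>\<^bsub>P\<^esub> \<one>\<^bsub>P\<^esub>"
      unfolding tensor_one[OF algebra_P algebra_D]
      by (rule ev_pure[OF module_P h]) (use D.A.one_closed in simp_all)
    then show ?thesis using h by (simp add: conv_apply(2)[OF algebra_S] counit_closed)
  qed
  have "w \<otimes>\<^bsub>PD\<^esub> w' = \<one>\<^bsub>PD\<^esub>"
  proof (rule ev_eqI[OF module_P])
    fix h assume h: "h \<in> carrier H"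
    have "ev P h (w \<otimes>\<^bsub>PD\<^esub> w') = tensor_lift H (\<lambda>a b. ev P b w' \<otimes>\<^bsub>H\<^esub> ev P a w) (comult H h)"
      using ev_mult[OF algebra_P canonical_op_closed w' h] by (simp add: tensor_lift_op)
    also have "\<dots> = tensor_lift H (\<lambda>a b. Sinv b \<otimes>\<^bsub>H\<^esub> a) (comult H h)"
      by (rule sweedler_cong[OF h module_H]) (auto simp: ev_canonical_op evw' Sinv)
    finally show "ev P h (w \<otimes>\<^bsub>PD\<^esub> w') = ev P h \<one>\<^bsub>PD\<^esub>" by (simp add: Sinv_left h ev_one)
  qed (use canonical_op_closed w' in auto)
  moreover have "w' \<otimes>\<^bsub>PD\<^esub> w = \<one>\<^bsub>PD\<^esub>"
  proof (rule ev_eqI[OF module_P])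
    fix h assume h: "h \<in> carrier H"
    have "ev P h (w' \<otimes>\<^bsub>PD\<^esub> w) = tensor_lift H (\<lambda>a b. ev P b w \<otimes>\<^bsub>H\<^esub> ev P a w') (comult H h)"
      using ev_mult[OF algebra_P w' canonical_op_closed h] by (simp add: tensor_lift_op)
    also have "\<dots> = tensor_lift H (\<lambda>a b. b \<otimes>\<^bsub>H\<^esub> Sinv a) (comult H h)"
      by (rule sweedler_cong[OF h module_H]) (auto simp: ev_canonical_op evw' Sinv)
    finally show "ev P h (w' \<otimes>\<^bsub>PD\<^esub> w) = ev P h \<one>\<^bsub>PD\<^esub>" by (simp add: Sinv_right h ev_one)
  qed (use canonical_op_closed w' in auto)
  ultimately show ?thesis using canonical_op_closed w' unfolding Units_def by blast
qed

section \<open>The coproduct of the dual\<close>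

lemma pairing_bilinear:
  "h \<in> carrier H \<Longrightarrow> h' \<in> carrier H \<Longrightarrow> bilinear_map K D D S (\<lambda>\<phi> \<psi>. \<phi> h \<otimes>\<^bsub>K\<^esub> \<psi> h')"
  using bilinear_mult[OF algebra_S eval_linear eval_linear] by simp

lemma pairing_eq_ev:
  assumes t: "t \<in> carrier (tensor K D D)" and h: "h \<in> carrier H" and h': "h' \<in> carrier H"
  shows "tensor_lift S (\<lambda>\<phi> \<psi>. \<phi> h \<otimes>\<^bsub>K\<^esub> \<psi> h') t = ev D h' t h"
  by (rule tensor_map_eqI[OF module_D module_D tensor_lift_linear[OF module_D module_D module_S pairing_bilinear[OF h h']]
        linear_compose[OF eval_linear[OF h] ev_linear[OF module_D h']] _ t])
    (use h h' in \<open>simp add: tensor_lift_pure[OF module_D module_D module_S pairing_bilinear] ev_pure[OF module_D] 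
      linear_mapD(3)[OF eval_linear] dual_value K.m_comm del: dual_simps\<close>)

lemma pairing_eqI:
  assumes "t \<in> carrier (tensor K D D)" "t' \<in> carrier (tensor K D D)"
    and "\<And>h h'. h \<in> carrier H \<Longrightarrow> h' \<in> carrier H \<Longrightarrow>
      tensor_lift S (\<lambda>\<phi> \<psi>. \<phi> h \<otimes>\<^bsub>K\<^esub> \<psi> h') t = tensor_lift S (\<lambda>\<phi> \<psi>. \<phi> h \<otimes>\<^bsub>K\<^esub> \<psi> h') t'"
  shows "t = t'"
  by (rule ev_eqI[OF module_D assms(1,2)], rule dual_eqI)
    (use assms in \<open>simp_all add: pairing_eq_ev linear_mapD(1)[OF ev_linear[OF module_D]] del: dual_simps\<close>)

text \<open>
  The tensor \<open>\<Sum>\<^sub>b \<theta>(\<cdot> b) \<otimes> b\<^sup>*\<close> has the required pairings, and it is the only one because an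
  element of \<open>H\<^sup>* \<otimes> H\<^sup>*\<close> is determined by its pairings with \<open>h\<close> and \<open>h'\<close>. Hence the
  definite description of the coproduct denotes this tensor.
\<close>

lemma dual_comult:
  assumes \<theta>: "\<theta> \<in> carrier D"
  shows "dual_comult K H \<theta> \<in> carrier (tensor K D D)"
    and "\<And>h h'. h \<in> carrier H \<Longrightarrow> h' \<in> carrier H \<Longrightarrow>
      tensor_lift S (\<lambda>\<phi> \<psi>. \<phi> h \<otimes>\<^bsub>K\<^esub> \<psi> h') (dual_comult K H \<theta>) = \<theta> (h \<otimes>\<^bsub>H\<^esub> h')"
proof -
  let ?P = "\<lambda>t. t \<in> carrier (tensor K D D) \<and> (\<forall>h\<in>carrier H. \<forall>h'\<in>carrier H.
           tensor_lift S (\<lambda>\<phi> \<psi>. \<phi> h \<otimes>\<^bsub>K\<^esub> \<psi> h') t = \<theta> (h \<otimes>\<^bsub>H\<^esub> h'))"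
  \<comment> \<open>\<open>h'\<close> belongs to the second factor, on which \<open>ev\<close> acts\<close>
  let ?f = "\<lambda>h'. \<lambda>h\<in>carrier H. \<theta> (h \<otimes>\<^bsub>H\<^esub> h')"
  have fc: "?f h' \<in> carrier D" if "h' \<in> carrier H" for h'
    using conv_carrierI[OF algebra_S linear_compose[OF dual_linear[OF \<theta>] linear_mult(1)[OF algebra_H that linear_id]]] by simp
  interpret D: unital_algebra K D by (rule algebra_D)
  have f: "linear_map K H D ?f"
  proof (rule linear_mapI)
    show "?f h' \<in> carrier D" if "h' \<in> carrier H" for h' using fc[OF that] .
    show "?f (x \<oplus>\<^bsub>H\<^esub> y) = ?f x \<oplus>\<^bsub>D\<^esub> ?f y" if "x \<in> carrier H" "y \<in> carrier H" for x y
      by (rule dual_eqI)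
        (use that fc in \<open>simp_all add: linear_mapD(2)[OF eval_linear] linear_mapD(2)[OF dual_linear[OF \<theta>]] A.r_distr del: dual_simps\<close>)
    show "?f (r \<odot>\<^bsub>H\<^esub> x) = r \<odot>\<^bsub>D\<^esub> ?f x" if "r \<in> carrier K" "x \<in> carrier H" for r x
      by (rule dual_eqI)
        (use that fc in \<open>simp_all add: linear_mapD(3)[OF eval_linear] linear_mapD(3)[OF dual_linear[OF \<theta>]] smult_mult_right del: dual_simps\<close>)
  qed
  have "?P (tensor_of_map D ?f)"
    using tensor_of_map_closed[OF module_D f] by (simp add: pairing_eq_ev ev_tensor_of_map[OF module_D f])
  moreover have "t = t'" if "?P t" "?P t'" for t t'
    by (rule pairing_eqI) (use that in auto)
  ultimately have ex1: "\<exists>!t. ?P t" by blast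
  have eq: "dual_comult K H \<theta> = (THE t. ?P t)"
    unfolding dual_comult_def tensor_dual tensor_lift_scalar[of K] ..
  have "?P (dual_comult K H \<theta>)" unfolding eq by (rule theI'[OF ex1])
  then show "dual_comult K H \<theta> \<in> carrier (tensor K D D)"
    "\<And>h h'. h \<in> carrier H \<Longrightarrow> h' \<in> carrier H \<Longrightarrow>
      tensor_lift S (\<lambda>\<phi> \<psi>. \<phi> h \<otimes>\<^bsub>K\<^esub> \<psi> h') (dual_comult K H \<theta>) = \<theta> (h \<otimes>\<^bsub>H\<^esub> h')" by blast+
qed

lemma dual_comult_linear: "linear_map K D (tensor K D D) (dual_comult K H)"
proof (rule linear_mapI)
  interpret D: unital_algebra K D by (rule algebra_D)
  interpret DD: module K "tensor K D D" by (intro module_tensor module_D)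
  note l = tensor_lift_linear[OF module_D module_D module_S pairing_bilinear]
  show "dual_comult K H \<theta> \<in> carrier (tensor K D D)" if "\<theta> \<in> carrier D" for \<theta> using dual_comult(1)[OF that] .
  show "dual_comult K H (\<theta> \<oplus>\<^bsub>D\<^esub> \<psi>) = dual_comult K H \<theta> \<oplus>\<^bsub>tensor K D D\<^esub> dual_comult K H \<psi>"
    if "\<theta> \<in> carrier D" "\<psi> \<in> carrier D" for \<theta> \<psi>
    by (rule pairing_eqI)
      (use that in \<open>simp_all add: dual_comult linear_mapD(2)[OF l] linear_mapD(2)[OF eval_linear] del: dual_simps\<close>)
  show "dual_comult K H (r \<odot>\<^bsub>D\<^esub> \<theta>) = r \<odot>\<^bsub>tensor K D D\<^esub> dual_comult K H \<theta>"
    if "\<theta> \<in> carrier D" "r \<in> carrier K" for r \<theta>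
    by (rule pairing_eqI)
      (use that in \<open>simp_all add: dual_comult linear_mapD(3)[OF l] linear_mapD(3)[OF eval_linear] del: dual_simps\<close>)
qed

end

section \<open>Evaluation of the dual factor in a triple tensor product\<close>

context finite_hopf_algebra
begin

definition ev_id where
  "ev_id V A h = tensor_map K V A (ev V h) id"

context
  fixes V :: "('k, 'v, 'n) module_scheme" and A :: "('k, 'x, 'o) module_scheme"
  assumes V: "module K V" and A: "module K A"
begin

interpretation V: module K V by (rule V)
interpretation A: module K A by (rule A)

lemmas VD = module_tensor[OF V module_D]
lemmas VDA = module_tensor[OF VD A]
lemmas VA = module_tensor[OF V A]

lemma ev_id_linear: "h \<in> carrier H \<Longrightarrow> linear_map K (tensor K (tensor K V D) A) (tensor K V A) (ev_id V A h)"
  unfolding ev_id_def by (intro tensor_map_linear VD A V ev_linear linear_map_id)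

lemma ev_id_pure: "h \<in> carrier H \<Longrightarrow> u \<in> carrier (tensor K V D) \<Longrightarrow> a \<in> carrier A \<Longrightarrow>
    ev_id V A h (pure_tensor K (tensor K V D) A u a) = pure_tensor K V A (ev V h u) a"
  unfolding ev_id_def by (simp add: tensor_map_pure[OF VD A V A ev_linear[OF V] linear_map_id])

lemma ev_id_linear_right:
  assumes Z: "Z \<in> carrier (tensor K (tensor K V D) A)"
  shows "linear_map K H (tensor K V A) (\<lambda>h. ev_id V A h Z)"
  unfolding ev_id_def tensor_map_def
  by (intro linear_lift_param[OF VD A VA module_H] Z bilinear_compose[OF bilinear_pure] V A ev_linear linear_map_id
      linear_pure ev_linear_right) (use linear_mapD(1)[OF linear_map_id] in auto)

text \<open>
  The sum over the basis of \<open>(\<cdot> \<otimes> b\<^sup>*) \<otimes> id\<close>, applied to the value of \<open>ev_id\<close> at \<open>b\<close>,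
  recovers \<open>Z\<close>; on \<open>u \<otimes> a\<close> this is \<open>tensor_of_map_ev\<close>.
\<close>

lemma ev_id_eqI:
  assumes Z: "Z \<in> carrier (tensor K (tensor K V D) A)" and Z': "Z' \<in> carrier (tensor K (tensor K V D) A)"
    and eq: "\<And>h. h \<in> carrier H \<Longrightarrow> ev_id V A h Z = ev_id V A h Z'"
  shows "Z = Z'"
proof -
  interpret VDA: module K "tensor K (tensor K V D) A" by (rule VDA)
  interpret VD: module K "tensor K V D" by (rule VD)
  define R where "R b = tensor_map K (tensor K V D) A (\<lambda>v. pure_tensor K V D v (coord b)) id" for b
  have p_lin: "linear_map K V (tensor K V D) (\<lambda>v. pure_tensor K V D v (coord b))" if "b \<in> basis" for b
    by (rule linear_pure(1)[OF V module_D coord_closed[OF that] linear_id])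
  have R_lin: "linear_map K (tensor K V A) (tensor K (tensor K V D) A) (R b)" if "b \<in> basis" for b
    unfolding R_def by (intro tensor_map_linear V A VD p_lin that linear_map_id)
  define F where "F Z = (\<Oplus>\<^bsub>tensor K (tensor K V D) A\<^esub>b\<in>basis. R b (ev_id V A b Z))" for Z
  have rec: "F Z = Z" if Z: "Z \<in> carrier (tensor K (tensor K V D) A)" for Z
  proof (rule tensor_map_eqI[OF VD A _ linear_id _ Z])
    show "linear_map K (tensor K (tensor K V D) A) (tensor K (tensor K V D) A) F"
      unfolding F_def
      by (intro linear_finsum VDA basis_finite linear_compose[OF R_lin ev_id_linear] basis_closed)
    fix u a assume u: "u \<in> carrier (tensor K V D)" and a: "a \<in> carrier A"
    have closed: "pure_tensor K V D (ev V b u) (coord b) \<in> carrier (tensor K V D)" if "b \<in> basis" for b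
      by (intro pure_tensor_closed V module_D linear_mapD(1)[OF ev_linear[OF V]] basis_closed coord_closed that u)
    have R: "R b (ev_id V A b (pure_tensor K (tensor K V D) A u a))
        = pure_tensor K (tensor K V D) A (pure_tensor K V D (ev V b u) (coord b)) a" if b: "b \<in> basis" for b
      unfolding ev_id_pure[OF basis_closed[OF b] u a] R_def
      by (subst tensor_map_pure[OF V A VD A p_lin[OF b] linear_map_id linear_mapD(1)[OF ev_linear[OF V basis_closed[OF b]] u] a]) simp
    have "F (pure_tensor K (tensor K V D) A u a)
      = (\<Oplus>\<^bsub>tensor K (tensor K V D) A\<^esub>b\<in>basis. pure_tensor K (tensor K V D) A (pure_tensor K V D (ev V b u) (coord b)) a)"
      unfolding F_def
      by (rule VDA.M.finsum_cong') (use R closed a in \<open>auto intro!: pure_tensor_closed[OF VD A]\<close>)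
    also have "\<dots> = pure_tensor K (tensor K V D) A (\<Oplus>\<^bsub>tensor K V D\<^esub>b\<in>basis. pure_tensor K V D (ev V b u) (coord b)) a"
      by (rule linear_map_finsum[OF VD VDA linear_pure(1)[OF VD A a linear_id], symmetric]) (use closed in auto)
    also have "\<dots> = pure_tensor K (tensor K V D) A u a"
      using tensor_of_map_ev[OF V u] by (simp add: tensor_of_map_def)
    finally show "F (pure_tensor K (tensor K V D) A u a) = pure_tensor K (tensor K V D) A u a" .
  qed
  have "F Z = F Z'"
    unfolding F_def
    by (rule VDA.M.finsum_cong')
      (use eq Z Z' linear_mapD(1)[OF R_lin] linear_mapD(1)[OF ev_id_linear] basis_closed in auto)
  then show ?thesis using rec Z Z' by simp
qed

end

context
  fixes V :: "('k, 'v, 'n) module_scheme" and A :: "('k, 'x, 'o) module_scheme"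
  assumes V: "unital_algebra K V" and A: "module K A"
begin

interpretation V: unital_algebra K V by (rule V)

lemmas mV = unital_algebra_module[OF V]

text \<open>
  The version of \<open>ev_mult\<close> with a further tensor factor that is not touched: one of the two factors is
  \<open>u \<otimes> 1\<close>. It translates the products with the canonical element in the left-left condition.
\<close>

lemma ev_id_mult:
  assumes u: "u \<in> carrier (tensor K V D)" and Z: "Z \<in> carrier (tensor K (tensor K V D) A)" and h: "h \<in> carrier H"
  shows "ev_id V A h (tensor_map K (tensor K V D) A (\<lambda>z. u \<otimes>\<^bsub>tensor K V D\<^esub> z) id Z) =
      tensor_lift (tensor K V A) (\<lambda>a b. tensor_map K V A (\<lambda>v. ev V a u \<otimes>\<^bsub>V\<^esub> v) id (ev_id V A b Z)) (comult H h)"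
    and "ev_id V A h (tensor_map K (tensor K V D) A (\<lambda>z. z \<otimes>\<^bsub>tensor K V D\<^esub> u) id Z) =
      tensor_lift (tensor K V A) (\<lambda>a b. tensor_map K V A (\<lambda>v. v \<otimes>\<^bsub>V\<^esub> ev V b u) id (ev_id V A a Z)) (comult H h)"
proof -
  let ?VD = "tensor K V D" and ?VA = "tensor K V A"
  let ?VDA = "tensor K ?VD A"
  let ?l1 = "\<lambda>Z. ev_id V A h (tensor_map K ?VD A (\<lambda>z. u \<otimes>\<^bsub>?VD\<^esub> z) id Z)"
    and ?r1 = "\<lambda>a b Z. tensor_map K V A (\<lambda>v. ev V a u \<otimes>\<^bsub>V\<^esub> v) id (ev_id V A b Z)"
  let ?l2 = "\<lambda>Z. ev_id V A h (tensor_map K ?VD A (\<lambda>z. z \<otimes>\<^bsub>?VD\<^esub> u) id Z)"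
    and ?r2 = "\<lambda>a b Z. tensor_map K V A (\<lambda>v. v \<otimes>\<^bsub>V\<^esub> ev V b u) id (ev_id V A a Z)"
  let ?sum = "\<lambda>f. tensor_lift ?VA f (comult H h)"
  note VD = module_tensor[OF mV module_D] and VA = module_tensor[OF mV A]
  note VDA = module_tensor[OF VD A]
  note T = unital_algebra_tensor[OF V algebra_D]
  interpret T: unital_algebra K "?VD" by (rule T)
  note evl = ev_linear_right[OF mV]
  note evc = linear_mapD(1)[OF ev_linear[OF mV]]
  note L = linear_mult(2)[OF V _ linear_id] and R = linear_mult(1)[OF V _ linear_id]
  note LT = linear_mult(2)[OF T u linear_id] and RT = linear_mult(1)[OF T u linear_id]
  have bilL: "bilinear_map K H H ?VA (\<lambda>a b. ?r1 a b Z)"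
    if Z: "Z \<in> carrier ?VDA" for Z
  proof (rule bilinear_mapI)
    fix a assume a: "a \<in> carrier H"
    show "linear_map K H ?VA (\<lambda>b. ?r1 a b Z)"
      by (rule linear_compose[OF tensor_map_linear[OF mV A mV A L[OF evc[OF a u]] linear_map_id] ev_id_linear_right[OF mV A Z]])
  next
    fix b assume b: "b \<in> carrier H"
    have Zb: "ev_id V A b Z \<in> carrier ?VA" by (rule linear_mapD(1)[OF ev_id_linear[OF mV A b] Z])
    show "linear_map K H ?VA (\<lambda>a. ?r1 a b Z)"
      unfolding tensor_map_def
      by (rule linear_lift_param[OF mV A VA module_H bilinear_compose[OF bilinear_pure[OF mV A] L[OF evc[OF _ u]] linear_map_id] _ Zb])
        (auto intro!: linear_pure[OF mV A] R[THEN linear_compose] linear_mult(1)[OF V] evl u)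
  qed
  have bilR: "bilinear_map K H H ?VA (\<lambda>a b. ?r2 a b Z)"
    if Z: "Z \<in> carrier ?VDA" for Z
  proof (rule bilinear_mapI)
    fix b assume b: "b \<in> carrier H"
    show "linear_map K H ?VA (\<lambda>a. ?r2 a b Z)"
      by (rule linear_compose[OF tensor_map_linear[OF mV A mV A R[OF evc[OF b u]] linear_map_id] ev_id_linear_right[OF mV A Z]])
  next
    fix a assume a: "a \<in> carrier H"
    have Za: "ev_id V A a Z \<in> carrier ?VA" by (rule linear_mapD(1)[OF ev_id_linear[OF mV A a] Z])
    show "linear_map K H ?VA (\<lambda>b. ?r2 a b Z)"
      unfolding tensor_map_def
      by (rule linear_lift_param[OF mV A VA module_H bilinear_compose[OF bilinear_pure[OF mV A] R[OF evc[OF _ u]] linear_map_id] _ Za])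
        (auto intro!: linear_pure[OF mV A] linear_mult(2)[OF V] evl u)
  qed
  show "?l1 Z = ?sum (\<lambda>a b. ?r1 a b Z)"
  proof (rule tensor_map_eqI[OF VD A _ _ _ Z])
    show "linear_map K ?VDA ?VA (\<lambda>Z. ?l1 Z)"
      by (intro linear_compose[OF ev_id_linear[OF mV A h]] tensor_map_linear VD A LT linear_map_id)
    show "linear_map K ?VDA ?VA (\<lambda>Z. ?sum (\<lambda>a b. ?r1 a b Z))"
      by (intro linear_lift_param[OF module_H module_H VA VDA] bilL comult_closed h
          linear_compose[OF tensor_map_linear[OF mV A mV A L linear_map_id] ev_id_linear[OF mV A]] evc u)
    fix z x assume z: "z \<in> carrier ?VD" and x: "x \<in> carrier A"
    have bil: "bilinear_map K H H V (\<lambda>a b. ev V a u \<otimes>\<^bsub>V\<^esub> ev V b z)" by (intro bilinear_mult V evl u z)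
    have "?l1 (pure_tensor K ?VD A z x)
      = pure_tensor K V A (tensor_lift V (\<lambda>a b. ev V a u \<otimes>\<^bsub>V\<^esub> ev V b z) (comult H h)) x"
      using u z x h by (simp add: tensor_map_pure[OF VD A VD A LT linear_map_id] ev_id_pure[OF mV A] ev_mult[OF V])
    also have "\<dots> = ?sum (\<lambda>a b. pure_tensor K V A (ev V a u \<otimes>\<^bsub>V\<^esub> ev V b z) x)"
      by (rule linear_tensor_lift[OF module_H module_H mV VA bil linear_pure(1)[OF mV A x linear_id] comult_closed[OF h]])
    also have "\<dots> = ?sum (\<lambda>a b. ?r1 a b (pure_tensor K ?VD A z x))"
      by (rule sweedler_cong[OF h VA])
        (use u z x evc in \<open>simp_all add: ev_id_pure[OF mV A] tensor_map_pure[OF mV A mV A L linear_map_id] pure_tensor_closed mV A\<close>)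
    finally show "?l1 (pure_tensor K ?VD A z x)
      = ?sum (\<lambda>a b. ?r1 a b (pure_tensor K ?VD A z x))" .
  qed
  show "?l2 Z = ?sum (\<lambda>a b. ?r2 a b Z)"
  proof (rule tensor_map_eqI[OF VD A _ _ _ Z])
    show "linear_map K ?VDA ?VA (\<lambda>Z. ?l2 Z)"
      by (intro linear_compose[OF ev_id_linear[OF mV A h]] tensor_map_linear VD A RT linear_map_id)
    show "linear_map K ?VDA ?VA (\<lambda>Z. ?sum (\<lambda>a b. ?r2 a b Z))"
      by (intro linear_lift_param[OF module_H module_H VA VDA] bilR comult_closed h
          linear_compose[OF tensor_map_linear[OF mV A mV A R linear_map_id] ev_id_linear[OF mV A]] evc u)
    fix z x assume z: "z \<in> carrier ?VD" and x: "x \<in> carrier A"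
    have bil: "bilinear_map K H H V (\<lambda>a b. ev V a z \<otimes>\<^bsub>V\<^esub> ev V b u)" by (intro bilinear_mult V evl u z)
    have "?l2 (pure_tensor K ?VD A z x)
      = pure_tensor K V A (tensor_lift V (\<lambda>a b. ev V a z \<otimes>\<^bsub>V\<^esub> ev V b u) (comult H h)) x"
      using u z x h by (simp add: tensor_map_pure[OF VD A VD A RT linear_map_id] ev_id_pure[OF mV A] ev_mult[OF V])
    also have "\<dots> = ?sum (\<lambda>a b. pure_tensor K V A (ev V a z \<otimes>\<^bsub>V\<^esub> ev V b u) x)"
      by (rule linear_tensor_lift[OF module_H module_H mV VA bil linear_pure(1)[OF mV A x linear_id] comult_closed[OF h]])
    also have "\<dots> = ?sum (\<lambda>a b. ?r2 a b (pure_tensor K ?VD A z x))"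
      by (rule sweedler_cong[OF h VA])
        (use u z x evc in \<open>simp_all add: ev_id_pure[OF mV A] tensor_map_pure[OF mV A mV A R linear_map_id] pure_tensor_closed mV A\<close>)
    finally show "?l2 (pure_tensor K ?VD A z x)
      = ?sum (\<lambda>a b. ?r2 a b (pure_tensor K ?VD A z x))" .
  qed
qed

end

end

section \<open>The action induced by a coaction of the dual\<close>

context finite_hopf_algebra
begin

context
  fixes A :: "('k, 'x, 'o) module_scheme"
  assumes A: "unital_algebra K A"
begin

interpretation A: unital_algebra K A by (rule A)

text \<open>
  The pairing for tensors whose first factor is \<open>H\<^sup>*\<close>: the induced action is
  \<open>x \<lhd> h = evl h (\<beta> x)\<close>.
\<close>

definition evl :: "'a \<Rightarrow> ('a \<Rightarrow> 'k, 'x) tens \<Rightarrow> 'x" where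
  "evl h = tensor_lift A (\<lambda>\<theta> y. \<theta> h \<odot>\<^bsub>A\<^esub> y)"

lemma mA: "module K A" by (rule A.module_axioms)

abbreviation "PA \<equiv> tensor K P A"
abbreviation "DA \<equiv> tensor K D A"
abbreviation "PDA \<equiv> tensor K PD A"
abbreviation "DP \<equiv> tensor K D P"
abbreviation "DPA \<equiv> tensor K DP A"

lemmas mPA = module_tensor[OF module_P mA]
lemmas mDA = module_tensor[OF module_D mA]
lemmas mDP = module_tensor[OF module_D module_P]

lemma evl_bilinear: "h \<in> carrier H \<Longrightarrow> bilinear_map K D A A (\<lambda>\<theta> y. \<theta> h \<odot>\<^bsub>A\<^esub> y)"
  by (intro bilinear_mapI linear_smult_left linear_smult_right linear_id eval_linear mA dual_value)

lemma evl_linear: "h \<in> carrier H \<Longrightarrow> linear_map K DA A (evl h)"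
  unfolding evl_def by (intro tensor_lift_linear mA module_D evl_bilinear)

lemma evl_pure: "h \<in> carrier H \<Longrightarrow> \<theta> \<in> carrier D \<Longrightarrow> y \<in> carrier A \<Longrightarrow>
    evl h (pure_tensor K D A \<theta> y) = \<theta> h \<odot>\<^bsub>A\<^esub> y"
  unfolding evl_def by (rule tensor_lift_pure[OF module_D mA mA evl_bilinear])

lemma evl_linear_right: "t \<in> carrier DA \<Longrightarrow> linear_map K H A (\<lambda>h. evl h t)"
  unfolding evl_def
  by (intro linear_lift_param[OF module_D mA mA module_H] evl_bilinear linear_smult_left dual_linear mA)

lemma evl_flip: "h \<in> carrier H \<Longrightarrow> t \<in> carrier DA \<Longrightarrow> evl h t = ev A h (tensor_flip K D A t)"
  by (rule tensor_map_eqI[OF module_D mA evl_linear linear_compose[OF ev_linear[OF mA] tensor_flip_linear[OF module_D mA]]])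
    (simp_all add: evl_pure tensor_flip_pure[OF module_D mA] ev_pure[OF mA] del: dual_simps)

lemma evl_mult:
  assumes U: "U \<in> carrier DA" and W: "W \<in> carrier DA" and h: "h \<in> carrier H"
  shows "evl h (U \<otimes>\<^bsub>DA\<^esub> W) = tensor_lift A (\<lambda>a b. evl a U \<otimes>\<^bsub>A\<^esub> evl b W) (comult H h)"
proof -
  note flc = linear_mapD(1)[OF tensor_flip_linear[OF module_D mA]]
  interpret DA: unital_algebra K DA by (rule unital_algebra_tensor[OF algebra_D A])
  have "evl h (U \<otimes>\<^bsub>DA\<^esub> W) = tensor_lift A (\<lambda>a b. ev A a (tensor_flip K D A U) \<otimes>\<^bsub>A\<^esub> ev A b (tensor_flip K D A W)) (comult H h)"
    using U W h by (simp add: evl_flip tensor_flip_mult[OF algebra_D A] ev_mult[OF A flc[OF U] flc[OF W]])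
  also have "\<dots> = tensor_lift A (\<lambda>a b. evl a U \<otimes>\<^bsub>A\<^esub> evl b W) (comult H h)"
    by (rule sweedler_cong[OF h mA])
      (use U W linear_mapD(1)[OF evl_linear] in \<open>auto simp: evl_flip[symmetric]\<close>)
  finally show ?thesis .
qed

text \<open>
  Each axiom is dual to one for \<open>\<beta>\<close>. Associativity comes from coassociativity, since pairing the
  coproduct of \<open>\<theta>\<close> with \<open>h\<close> and \<open>h'\<close> gives \<open>\<theta>(h h')\<close>; the unit law comes from the counit of the
  dual, which is evaluation at \<open>1\<close>. The rule for \<open>(xy) \<lhd> h\<close> comes from multiplicativity of \<open>\<beta>\<close>, since
  the product of the dual is convolution.
\<close>

lemma right_action_induced:
  assumes \<beta>: "left_coaction K D A \<beta>"
  shows "right_action K H A (induced_action A \<beta>)"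
proof -
  have hom: "algebra_hom K A DA \<beta>"
    and co: "\<And>x. x \<in> carrier A \<Longrightarrow> tensor_assoc K D D A (tensor_map K D DA id \<beta> (\<beta> x))
          = tensor_map K (tensor K D D) A (dual_comult K H) id (\<beta> x)"
    and cou: "\<And>x. x \<in> carrier A \<Longrightarrow> tensor_lift A (\<lambda>c y. c \<one>\<^bsub>H\<^esub> \<odot>\<^bsub>A\<^esub> y) (\<beta> x) = x"
    using \<beta> by (auto simp: left_coaction_def)
  have lin: "linear_map K A DA \<beta>" using hom by (simp add: algebra_hom_def)
  note \<beta>c = linear_mapD(1)[OF lin]
  have act: "induced_action A \<beta> = (\<lambda>x h. evl h (\<beta> x))"
    by (simp add: induced_action_def evl_def fun_eq_iff)
  note evlc = linear_mapD(1)[OF evl_linear]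
  have assoc: "evl h' (\<beta> (evl h (\<beta> x))) = evl (h \<otimes>\<^bsub>H\<^esub> h') (\<beta> x)"
    if x: "x \<in> carrier A" and h: "h \<in> carrier H" and h': "h' \<in> carrier H" for x h h'
  proof -
    have g: "trilinear_map K D D A A (\<lambda>\<phi> \<psi> y. (\<phi> h \<otimes>\<^bsub>K\<^esub> \<psi> h') \<odot>\<^bsub>A\<^esub> y)"
      by (intro trilinear_mapI linear_smult_right linear_smult_left mA linear_id linear_scalar_mult field_K
          eval_linear h h' dual_value K.m_closed)
    have "evl (h \<otimes>\<^bsub>H\<^esub> h') (\<beta> x)
      = tensor_lift A (\<lambda>\<theta> y. tensor_lift A (\<lambda>\<phi> \<psi>. (\<phi> h \<otimes>\<^bsub>K\<^esub> \<psi> h') \<odot>\<^bsub>A\<^esub> y) (dual_comult K H \<theta>)) (\<beta> x)"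
      unfolding evl_def
    proof (rule tensor_lift_cong[OF module_D mA \<beta>c[OF x] mA])
      fix \<theta> y assume \<theta>: "\<theta> \<in> carrier D" and y: "y \<in> carrier A"
      have "tensor_lift A (\<lambda>\<phi> \<psi>. (\<phi> h \<otimes>\<^bsub>K\<^esub> \<psi> h') \<odot>\<^bsub>A\<^esub> y) (dual_comult K H \<theta>)
        = tensor_lift S (\<lambda>\<phi> \<psi>. \<phi> h \<otimes>\<^bsub>K\<^esub> \<psi> h') (dual_comult K H \<theta>) \<odot>\<^bsub>A\<^esub> y"
        by (rule linear_tensor_lift[OF module_D module_D module_S mA pairing_bilinear[OF h h'] linear_smult_left[OF mA y linear_id]
              dual_comult(1)[OF \<theta>], symmetric])
      then show "\<theta> (h \<otimes>\<^bsub>H\<^esub> h') \<odot>\<^bsub>A\<^esub> y = tensor_lift A (\<lambda>\<phi> \<psi>. (\<phi> h \<otimes>\<^bsub>K\<^esub> \<psi> h') \<odot>\<^bsub>A\<^esub> y) (dual_comult K H \<theta>)"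
        by (simp add: dual_comult(2)[OF \<theta> h h'])
      then show "tensor_lift A (\<lambda>\<phi> \<psi>. (\<phi> h \<otimes>\<^bsub>K\<^esub> \<psi> h') \<odot>\<^bsub>A\<^esub> y) (dual_comult K H \<theta>) \<in> carrier A"
        using dual_value[OF \<theta>] h h' y by (metis A.smult_closed A.m_closed)
    qed
    also have "\<dots> = tensor_lift A (\<lambda>\<phi> z. tensor_lift A (\<lambda>\<psi> y. (\<phi> h \<otimes>\<^bsub>K\<^esub> \<psi> h') \<odot>\<^bsub>A\<^esub> y) (\<beta> z)) (\<beta> x)"
      by (rule coassociative_lift[OF module_D module_D mA mA g module_D dual_comult_linear lin mA \<beta>c[OF x] \<beta>c[OF x] co[OF x]])
    also have "\<dots> = tensor_lift A (\<lambda>\<phi> z. evl h' (\<beta> (\<phi> h \<odot>\<^bsub>A\<^esub> z))) (\<beta> x)"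
    proof (rule tensor_lift_cong[OF module_D mA \<beta>c[OF x] mA])
      fix \<phi> z assume \<phi>: "\<phi> \<in> carrier D" and z: "z \<in> carrier A"
      have "tensor_lift A (\<lambda>\<psi> y. (\<phi> h \<otimes>\<^bsub>K\<^esub> \<psi> h') \<odot>\<^bsub>A\<^esub> y) (\<beta> z)
        = tensor_lift A (\<lambda>\<psi> y. \<phi> h \<odot>\<^bsub>A\<^esub> (\<psi> h' \<odot>\<^bsub>A\<^esub> y)) (\<beta> z)"
        by (rule tensor_lift_cong[OF module_D mA \<beta>c[OF z] mA])
          (simp_all add: A.smult_assoc1 dual_value[OF \<phi>] dual_value h h' del: dual_simps)
      also have "\<dots> = \<phi> h \<odot>\<^bsub>A\<^esub> evl h' (\<beta> z)"
        unfolding evl_def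
        by (rule linear_tensor_lift[OF module_D mA mA mA evl_bilinear[OF h'] linear_smult_right[OF mA dual_value[OF \<phi> h] linear_id] \<beta>c[OF z], symmetric])
      also have "\<dots> = evl h' (\<beta> (\<phi> h \<odot>\<^bsub>A\<^esub> z))"
        using linear_mapD(3)[OF linear_compose[OF evl_linear[OF h'] lin] dual_value[OF \<phi> h] z] by simp
      finally show "tensor_lift A (\<lambda>\<psi> y. (\<phi> h \<otimes>\<^bsub>K\<^esub> \<psi> h') \<odot>\<^bsub>A\<^esub> y) (\<beta> z) = evl h' (\<beta> (\<phi> h \<odot>\<^bsub>A\<^esub> z))" .
      show "evl h' (\<beta> (\<phi> h \<odot>\<^bsub>A\<^esub> z)) \<in> carrier A"
        by (intro evlc h' \<beta>c A.smult_closed dual_value \<phi> h z)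
    qed
    also have "\<dots> = evl h' (\<beta> (evl h (\<beta> x)))"
      unfolding evl_def[of h]
      by (rule linear_tensor_lift[OF module_D mA mA mA evl_bilinear[OF h] linear_compose[OF evl_linear[OF h'] lin] \<beta>c[OF x], symmetric])
    finally show ?thesis by simp
  qed
  have mult: "evl h (\<beta> (x \<otimes>\<^bsub>A\<^esub> y)) = tensor_lift A (\<lambda>a b. evl a (\<beta> x) \<otimes>\<^bsub>A\<^esub> evl b (\<beta> y)) (comult H h)"
    if "x \<in> carrier A" "y \<in> carrier A" "h \<in> carrier H" for x y h
    using hom that evl_mult[OF \<beta>c \<beta>c] by (simp add: algebra_hom_def ring_hom_def)
  have one: "evl h (\<beta> \<one>\<^bsub>A\<^esub>) = counit H h \<odot>\<^bsub>A\<^esub> \<one>\<^bsub>A\<^esub>" if h: "h \<in> carrier H" for h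
  proof -
    interpret D: unital_algebra K D by (rule algebra_D)
    have "\<beta> \<one>\<^bsub>A\<^esub> = pure_tensor K D A \<one>\<^bsub>D\<^esub> \<one>\<^bsub>A\<^esub>"
      using hom by (simp add: algebra_hom_def ring_hom_def tensor_one[OF algebra_D A])
    then show ?thesis
      using h evl_pure[OF h D.A.one_closed A.A.one_closed] by (simp add: conv_apply(2)[OF algebra_S] counit_closed)
  qed
  have unit: "evl \<one>\<^bsub>H\<^esub> (\<beta> x) = x" if "x \<in> carrier A" for x
    using cou[OF that] by (simp add: evl_def)
  show ?thesis
    unfolding right_action_def act
    using assoc mult one unit by (auto intro: linear_compose[OF evl_linear lin] evl_linear_right \<beta>c)
qed

section \<open>Comparison of the two Yetter--Drinfeld conditions\<close>

text \<open>
  The scalar \<open>\<theta>(h)\<close> moves from the factor \<open>P\<close> to the factor \<open>A\<close>. For \<open>t = \<alpha> x\<close> the value is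
  \<open>x\<^sub>[\<^sub>-\<^sub>1\<^sub>] \<otimes> (x\<^sub>[\<^sub>0\<^sub>] \<lhd> h)\<close>.
\<close>

lemma ev_id_assoc_right:
  assumes lin: "linear_map K A DA \<beta>" and t: "t \<in> carrier PA" and h: "h \<in> carrier H"
  shows "ev_id P A h (tensor_assoc K P D A (tensor_map K P DA id \<beta> t)) = tensor_map K P A id (\<lambda>y. evl h (\<beta> y)) t"
proof (rule tensor_map_eqI[OF module_P mA _ _ _ t])
  let ?g = "\<lambda>v. ev_id P A h (tensor_assoc K P D A v)"
  note as = linear_compose[OF ev_id_linear[OF module_P mA h] tensor_assoc_linear[OF module_P module_D mA]]
  have act: "linear_map K A A (\<lambda>y. evl h (\<beta> y))" by (rule linear_compose[OF evl_linear[OF h] lin])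
  show "linear_map K PA PA (\<lambda>t. ?g (tensor_map K P DA id \<beta> t))"
    by (rule linear_compose[OF as tensor_map_linear[OF module_P mA module_P mDA linear_map_id lin]])
  show "linear_map K PA PA (tensor_map K P A id (\<lambda>y. evl h (\<beta> y)))"
    by (rule tensor_map_linear[OF module_P mA module_P mA linear_map_id act])
  fix p y assume p: "p \<in> carrier P" and y: "y \<in> carrier A"
  note \<beta>y = linear_mapD(1)[OF lin y]
  have "?g (pure_tensor K P DA p v) = pure_tensor K P A p (evl h v)"
    if v: "v \<in> carrier DA" for v
  proof (rule tensor_map_eqI[OF module_D mA linear_compose[OF as linear_pure(2)[OF module_P mDA p linear_id]]
          linear_pure(2)[OF module_P mA p evl_linear[OF h]] _ v])
    fix \<theta> a assume \<theta>: "\<theta> \<in> carrier D" and a: "a \<in> carrier A"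
    have "?g (pure_tensor K P DA p (pure_tensor K D A \<theta> a))
      = pure_tensor K P A (\<theta> h \<odot>\<^bsub>P\<^esub> p) a"
      unfolding tensor_assoc_pure[OF module_P module_D mA p \<theta> a]
        ev_id_pure[OF module_P mA h pure_tensor_closed[OF module_P module_D p \<theta>] a] ev_pure[OF module_P h p \<theta>] ..
    also have "\<dots> = pure_tensor K P A p (\<theta> h \<odot>\<^bsub>A\<^esub> a)"
      using linear_mapD(3)[OF linear_pure(1)[OF module_P mA a linear_id] dual_value[OF \<theta> h] p]
        linear_mapD(3)[OF linear_pure(2)[OF module_P mA p linear_id] dual_value[OF \<theta> h] a] by metis
    finally show "?g (pure_tensor K P DA p (pure_tensor K D A \<theta> a))
      = pure_tensor K P A p (evl h (pure_tensor K D A \<theta> a))"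
      unfolding evl_pure[OF h \<theta> a] .
  qed
  from this[OF \<beta>y]
  show "?g (tensor_map K P DA id \<beta> (pure_tensor K P A p y))
    = tensor_map K P A id (\<lambda>y. evl h (\<beta> y)) (pure_tensor K P A p y)"
    unfolding tensor_map_pure[OF module_P mA module_P mDA linear_map_id lin p y]
      tensor_map_pure[OF module_P mA module_P mA linear_map_id act p y] id_apply .
qed

text \<open>
  On \<open>\<theta> \<otimes> y\<close> both sides are \<open>\<theta>(h) \<alpha>(y)\<close>. For \<open>t = \<beta> x\<close> the value is \<open>\<alpha>(x \<lhd> h)\<close>.
\<close>

lemma ev_id_assoc_left:
  assumes lin: "linear_map K A PA \<alpha>" and t: "t \<in> carrier DA" and h: "h \<in> carrier H"
  shows "ev_id P A h (tensor_map K PD A (tensor_flip K D P) id (tensor_assoc K D P A (tensor_map K D PA id \<alpha> t)))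
    = \<alpha> (evl h t)"
proof (rule tensor_map_eqI[OF module_D mA _ _ _ t])
  let ?g = "\<lambda>v. ev_id P A h (tensor_map K PD A (tensor_flip K D P) id (tensor_assoc K D P A v))"
  note fl = tensor_flip_linear[OF module_D module_P]
  note as = linear_compose[OF ev_id_linear[OF module_P mA h]
      linear_compose[OF tensor_map_linear[OF mDP mA module_PD mA fl linear_map_id] tensor_assoc_linear[OF module_D module_P mA]]]
  show "linear_map K DA PA (\<lambda>t. ?g (tensor_map K D PA id \<alpha> t))"
    by (rule linear_compose[OF as tensor_map_linear[OF module_D mA module_D mPA linear_map_id lin]])
  show "linear_map K DA PA (\<lambda>t. \<alpha> (evl h t))" by (rule linear_compose[OF lin evl_linear[OF h]])
  fix \<theta> y assume \<theta>: "\<theta> \<in> carrier D" and y: "y \<in> carrier A"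
  note \<alpha>y = linear_mapD(1)[OF lin y]
  have "?g (pure_tensor K D PA \<theta> q)
    = \<theta> h \<odot>\<^bsub>PA\<^esub> q" if q: "q \<in> carrier PA" for q
  proof (rule tensor_map_eqI[OF module_P mA linear_compose[OF as linear_pure(2)[OF module_D mPA \<theta> linear_id]]
          linear_smult_right[OF mPA dual_value[OF \<theta> h] linear_id] _ q])
    fix p a assume p: "p \<in> carrier P" and a: "a \<in> carrier A"
    have "?g (pure_tensor K D PA \<theta> (pure_tensor K P A p a))
      = pure_tensor K P A (\<theta> h \<odot>\<^bsub>P\<^esub> p) a"
      unfolding tensor_assoc_pure[OF module_D module_P mA \<theta> p a]
        tensor_map_pure[OF mDP mA module_PD mA fl linear_map_id pure_tensor_closed[OF module_D module_P \<theta> p] a] id_apply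
        tensor_flip_pure[OF module_D module_P \<theta> p]
        ev_id_pure[OF module_P mA h pure_tensor_closed[OF module_P module_D p \<theta>] a] ev_pure[OF module_P h p \<theta>] ..
    also have "\<dots> = \<theta> h \<odot>\<^bsub>PA\<^esub> pure_tensor K P A p a"
      by (rule linear_mapD(3)[OF linear_pure(1)[OF module_P mA a linear_id] dual_value[OF \<theta> h] p])
    finally show "?g (pure_tensor K D PA \<theta> (pure_tensor K P A p a))
      = \<theta> h \<odot>\<^bsub>PA\<^esub> pure_tensor K P A p a" .
  qed
  from this[OF \<alpha>y]
  show "?g (tensor_map K D PA id \<alpha> (pure_tensor K D A \<theta> y))
    = \<alpha> (evl h (pure_tensor K D A \<theta> y))"
    unfolding tensor_map_pure[OF module_D mA module_D mPA linear_map_id lin \<theta> y] evl_pure[OF h \<theta> y] id_apply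
      linear_mapD(3)[OF lin dual_value[OF \<theta> h] y] .
qed

text \<open>
  Move the flip and the inverse of the canonical element \<open>w\<close> to the other side, and pair the factor
  \<open>D\<close> with \<open>h\<close>. As \<open>w\<close> pairs to the identity, the products with \<open>w\<close> turn into products with
  \<open>h\<^sub>1\<close> on one side and with \<open>h\<^sub>2\<close> on the other.
\<close>

lemma compatibility_iff:
  assumes \<alpha>: "linear_map K A PA \<alpha>" and \<beta>: "linear_map K A DA \<beta>" and x: "x \<in> carrier A"
  shows "tensor_assoc K D P A (tensor_map K D PA id \<alpha> (\<beta> x))
         = tensor_map K DP A (tensor_flip K P D) id (tensor_map K PD A (Ad PD w) id
               (tensor_assoc K P D A (tensor_map K P DA id \<beta> (\<alpha> x)))) \<longleftrightarrow>
    (\<forall>h\<in>carrier H.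
      tensor_lift PA (\<lambda>h1 h2. tensor_lift PA (\<lambda>y x0. pure_tensor K P A (y \<otimes>\<^bsub>P\<^esub> h2) x0) (\<alpha> (evl h1 (\<beta> x)))) (comult H h)
      = tensor_lift PA (\<lambda>y x0. tensor_lift PA (\<lambda>h1 h2. pure_tensor K P A (h1 \<otimes>\<^bsub>P\<^esub> y) (evl h2 (\<beta> x0))) (comult H h)) (\<alpha> x))"
proof -
  let ?R1 = "\<lambda>h. tensor_lift PA (\<lambda>h1 h2. tensor_lift PA (\<lambda>y x0. pure_tensor K P A (y \<otimes>\<^bsub>P\<^esub> h2) x0) (\<alpha> (evl h1 (\<beta> x)))) (comult H h)"
    and ?R2 = "\<lambda>h. tensor_lift PA (\<lambda>y x0. tensor_lift PA (\<lambda>h1 h2. pure_tensor K P A (h1 \<otimes>\<^bsub>P\<^esub> y) (evl h2 (\<beta> x0))) (comult H h)) (\<alpha> x)"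
  interpret PD: unital_algebra K PD by (rule algebra_PD)
  note \<alpha>x = linear_mapD(1)[OF \<alpha> x] and \<beta>x = linear_mapD(1)[OF \<beta> x]
  note fl = tensor_flip_linear[OF module_P module_D] and fl' = tensor_flip_linear[OF module_D module_P]
  note flip = tensor_map_linear[OF module_PD mA mDP mA fl linear_map_id] and flip' = tensor_map_linear[OF mDP mA module_PD mA fl' linear_map_id]
  let ?Z = "tensor_assoc K P D A (tensor_map K P DA id \<beta> (\<alpha> x))"
    and ?L = "tensor_assoc K D P A (tensor_map K D PA id \<alpha> (\<beta> x))"
  let ?Ad = "tensor_map K PD A (Ad PD w) id" and ?flip = "tensor_map K DP A (tensor_flip K P D) id"
  let ?flip' = "tensor_map K PD A (tensor_flip K D P) id"
  let ?right = "tensor_map K PD A (\<lambda>z. z \<otimes>\<^bsub>PD\<^esub> w) id" and ?left = "tensor_map K PD A (\<lambda>z. w \<otimes>\<^bsub>PD\<^esub> z) id"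
  let ?right' = "tensor_map K PD A (\<lambda>z. z \<otimes>\<^bsub>PD\<^esub> inv\<^bsub>PD\<^esub> w) id"
  note w = canonical_op_closed and w' = PD.A.Units_inv_closed[OF canonical_op_unit]
  note right = linear_mult(1)[OF algebra_PD w linear_id] and right' = linear_mult(1)[OF algebra_PD w' linear_id]
    and left = linear_mult(2)[OF algebra_PD w linear_id]
  have Ad: "linear_map K PD PD (Ad PD w)"
    unfolding Ad_def by (rule linear_compose[OF right' left])
  have Z: "?Z \<in> carrier PDA"
    by (rule linear_mapD(1)[OF linear_compose[OF tensor_assoc_linear[OF module_P module_D mA]
          tensor_map_linear[OF module_P mA module_P mDA linear_map_id \<beta>]] \<alpha>x])
  have L: "?L \<in> carrier DPA"
    by (rule linear_mapD(1)[OF linear_compose[OF tensor_assoc_linear[OF module_D module_P mA]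
          tensor_map_linear[OF module_D mA module_D mPA linear_map_id \<alpha>]] \<beta>x])
  have AdZ: "?Ad ?Z \<in> carrier PDA"
    by (rule linear_mapD(1)[OF tensor_map_linear[OF module_PD mA module_PD mA Ad linear_map_id] Z])
  have L': "?flip' ?L \<in> carrier PDA" by (rule linear_mapD(1)[OF flip' L])
  \<comment> \<open>functoriality of \<open>f \<mapsto> f \<otimes> id\<close>, for composites known only on the carrier\<close>
  have comp_id: "tensor_map K E A g id (tensor_map K C A f id U) = tensor_map K E A k id U"
    if "module K B" "module K C" "module K E" "linear_map K B C f" "linear_map K C E g" "linear_map K B E k"
      "\<And>b. b \<in> carrier B \<Longrightarrow> g (f b) = k b" "U \<in> carrier (tensor K B A)"
    for B :: "('k, 'b1, 'm1) module_scheme" and C :: "('k, 'b2, 'm2) module_scheme" and E :: "('k, 'b3, 'm3) module_scheme" and f g k U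
    unfolding tensor_map_compose[OF that(1) mA that(2) mA that(3) mA that(4) linear_map_id that(5) linear_map_id that(8)]
    by (rule tensor_map_cong[OF that(1) mA that(3) mA that(6) linear_map_id that(8)]) (simp_all add: that)
  have id_id: "tensor_map K B A (\<lambda>b. b) id U = U" if "module K B" "U \<in> carrier (tensor K B A)" for B :: "('k, 'b1, 'm1) module_scheme" and U
    using tensor_map_id[OF that(1) mA that(2)] by (simp add: id_def)
  have "?flip' (?flip U) = U" if U: "U \<in> carrier PDA" for U
    by (subst comp_id[OF module_PD mDP module_PD fl fl' linear_id _ U])
      (simp_all add: tensor_flip_flip[OF module_P module_D] id_id[OF module_PD U])
  moreover have "?flip (?flip' U) = U" if U: "U \<in> carrier DPA" for U
    by (subst comp_id[OF mDP module_PD mDP fl' fl linear_id _ U])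
      (simp_all add: tensor_flip_flip[OF module_D module_P] id_id[OF mDP U])
  ultimately have "?L = ?flip (?Ad ?Z) \<longleftrightarrow> ?flip' ?L = ?Ad ?Z" using L AdZ by metis
  also have "\<dots> \<longleftrightarrow> ?right (?flip' ?L) = ?left ?Z"
  proof -
    \<comment> \<open>multiplication by \<open>w\<close> from the right cancels the inverse in \<open>Ad w\<close> and is injective\<close>
    have "?right (?Ad ?Z) = ?left ?Z"
      by (rule comp_id[OF module_PD module_PD module_PD Ad right left _ Z])
        (simp add: Ad_def PD.A.m_assoc w w' PD.A.Units_l_inv[OF canonical_op_unit])
    moreover have "?right' (?right U) = U" if U: "U \<in> carrier PDA" for U
      by (subst comp_id[OF module_PD module_PD module_PD right right' linear_id _ U])
        (simp_all add: PD.A.m_assoc w w' PD.A.Units_r_inv[OF canonical_op_unit] id_id[OF module_PD U])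
    ultimately show ?thesis using L' AdZ by metis
  qed
  also have "\<dots> \<longleftrightarrow> (\<forall>h\<in>carrier H. ev_id P A h (?right (?flip' ?L)) = ev_id P A h (?left ?Z))"
    by (rule iffI, simp, rule ev_id_eqI[OF module_P mA linear_mapD(1)[OF tensor_map_linear[OF module_PD mA module_PD mA right linear_map_id] L']
      linear_mapD(1)[OF tensor_map_linear[OF module_PD mA module_PD mA left linear_map_id] Z]], erule bspec)
  also have "\<dots> \<longleftrightarrow> (\<forall>h\<in>carrier H. ?R1 h = ?R2 h)"
  proof (rule ball_cong[OF refl])
    fix h assume h: "h \<in> carrier H"
    note act = linear_compose[OF evl_linear \<beta>]
    have "ev_id P A h (?right (?flip' ?L))
      = tensor_lift PA (\<lambda>a b. tensor_map K P A (\<lambda>v. v \<otimes>\<^bsub>P\<^esub> ev P b w) id (ev_id P A a (?flip' ?L))) (comult H h)"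
      by (rule ev_id_mult(2)[OF algebra_P mA w L' h])
    also have "\<dots> = ?R1 h"
    proof (rule sweedler_cong[OF h mPA])
      fix a b assume a: "a \<in> carrier H" and b: "b \<in> carrier H"
      have b': "b \<in> carrier P" using b by simp
      have "tensor_map K P A (\<lambda>v. v \<otimes>\<^bsub>P\<^esub> b) id (\<alpha> (evl a (\<beta> x))) \<in> carrier PA"
        by (rule linear_mapD(1)[OF tensor_map_linear[OF module_P mA module_P mA linear_mult(1)[OF algebra_P b' linear_id] linear_map_id]
              linear_mapD(1)[OF \<alpha> linear_mapD(1)[OF act[OF a] x]]])
      then show "tensor_lift PA (\<lambda>y x0. pure_tensor K P A (y \<otimes>\<^bsub>P\<^esub> b) x0) (\<alpha> (evl a (\<beta> x))) \<in> carrier PA"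
        by (simp add: tensor_map_def)
      show "tensor_map K P A (\<lambda>v. v \<otimes>\<^bsub>P\<^esub> ev P b w) id (ev_id P A a (?flip' ?L))
        = tensor_lift PA (\<lambda>y x0. pure_tensor K P A (y \<otimes>\<^bsub>P\<^esub> b) x0) (\<alpha> (evl a (\<beta> x)))"
        unfolding ev_canonical_op[OF b] ev_id_assoc_left[OF \<alpha> \<beta>x a] by (simp add: tensor_map_def)
    qed
    finally have lhs: "ev_id P A h (?right (?flip' ?L)) = \<dots>" .
    have pure_bil: "bilinear_map K P A PA (\<lambda>y x0. pure_tensor K P A (a \<otimes>\<^bsub>P\<^esub> y) (evl b (\<beta> x0)))"
      if "a \<in> carrier H" "b \<in> carrier H" for a b
    proof (rule bilinear_compose[OF bilinear_pure[OF module_P mA] _ act[OF that(2)]])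
      show "linear_map K P P (\<lambda>y. a \<otimes>\<^bsub>P\<^esub> y)" by (rule linear_mult(2)[OF algebra_P _ linear_id]) (simp add: that)
    qed
    have pure_bil': "bilinear_map K H H PA (\<lambda>h1 h2. pure_tensor K P A (h1 \<otimes>\<^bsub>P\<^esub> y) (evl h2 (\<beta> x0)))"
      if "y \<in> carrier P" "x0 \<in> carrier A" for y x0
    proof (rule bilinear_compose[OF bilinear_pure[OF module_P mA] _ evl_linear_right[OF linear_mapD(1)[OF \<beta> that(2)]]])
      have "linear_map K P P (\<lambda>h1. h1 \<otimes>\<^bsub>P\<^esub> y)" by (rule linear_mult(1)[OF algebra_P that(1) linear_id])
      then show "linear_map K H P (\<lambda>h1. h1 \<otimes>\<^bsub>P\<^esub> y)" unfolding linear_map_op .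
    qed
    have "ev_id P A h (?left ?Z)
      = tensor_lift PA (\<lambda>a b. tensor_map K P A (\<lambda>v. ev P a w \<otimes>\<^bsub>P\<^esub> v) id (ev_id P A b ?Z)) (comult H h)"
      by (rule ev_id_mult(1)[OF algebra_P mA w Z h])
    also have "\<dots> = tensor_lift PA (\<lambda>h1 h2. tensor_lift PA (\<lambda>y x0. pure_tensor K P A (h1 \<otimes>\<^bsub>P\<^esub> y) (evl h2 (\<beta> x0))) (\<alpha> x)) (comult H h)"
    proof (rule sweedler_cong[OF h mPA])
      fix a b assume a: "a \<in> carrier H" and b: "b \<in> carrier H"
      have a': "a \<in> carrier P" using a by simp
      show "tensor_lift PA (\<lambda>y x0. pure_tensor K P A (a \<otimes>\<^bsub>P\<^esub> y) (evl b (\<beta> x0))) (\<alpha> x) \<in> carrier PA"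
        by (rule tensor_lift_closed[OF module_P mA mPA pure_bil[OF a b] \<alpha>x])
      have "tensor_map K P A (\<lambda>v. a \<otimes>\<^bsub>P\<^esub> v) id (tensor_map K P A id (\<lambda>y. evl b (\<beta> y)) (\<alpha> x))
        = tensor_map K P A (\<lambda>v. a \<otimes>\<^bsub>P\<^esub> id v) (\<lambda>y. id (evl b (\<beta> y))) (\<alpha> x)"
        by (rule tensor_map_compose[OF module_P mA module_P mA module_P mA linear_map_id act[OF b]
              linear_mult(2)[OF algebra_P a' linear_id] linear_map_id \<alpha>x])
      then show "tensor_map K P A (\<lambda>v. ev P a w \<otimes>\<^bsub>P\<^esub> v) id (ev_id P A b ?Z)
        = tensor_lift PA (\<lambda>y x0. pure_tensor K P A (a \<otimes>\<^bsub>P\<^esub> y) (evl b (\<beta> x0))) (\<alpha> x)"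
        unfolding ev_canonical_op[OF a] ev_id_assoc_right[OF \<beta> \<alpha>x b] by (simp add: tensor_map_def)
    qed
    also have "\<dots> = ?R2 h"
      by (rule tensor_lift_swap[OF module_H module_H module_P mA mPA pure_bil pure_bil' comult_closed[OF h] \<alpha>x])
    finally show "(ev_id P A h (?right (?flip' ?L)) = ev_id P A h (?left ?Z)) \<longleftrightarrow> (?R1 h = ?R2 h)"
      unfolding lhs by simp
  qed
  finally show ?thesis .
qed

theorem left_left_YD_iff_right_left_YD:
  assumes \<alpha>: "left_coaction K P A \<alpha>" and \<beta>: "left_coaction K D A \<beta>"
  shows "left_left_YD_algebra K H A \<alpha> \<beta> \<longleftrightarrow> right_left_YD_algebra K H A (induced_action A \<beta>) \<alpha>"
proof -
  have \<alpha>l: "linear_map K A PA \<alpha>" and \<beta>l: "linear_map K A DA \<beta>"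
    using \<alpha> \<beta> by (simp_all add: left_coaction_def algebra_hom_def)
  have act: "induced_action A \<beta> = (\<lambda>x h. evl h (\<beta> x))"
    by (simp add: induced_action_def evl_def fun_eq_iff)
  have "left_left_YD_algebra K H A \<alpha> \<beta> \<longleftrightarrow> (\<forall>x\<in>carrier A. \<forall>h\<in>carrier H.
      tensor_lift PA (\<lambda>h1 h2. tensor_lift PA (\<lambda>y x0. pure_tensor K P A (y \<otimes>\<^bsub>P\<^esub> h2) x0) (\<alpha> (evl h1 (\<beta> x)))) (comult H h)
      = tensor_lift PA (\<lambda>y x0. tensor_lift PA (\<lambda>h1 h2. pure_tensor K P A (h1 \<otimes>\<^bsub>P\<^esub> y) (evl h2 (\<beta> x0))) (comult H h)) (\<alpha> x))"
    unfolding left_left_YD_algebra_def Let_def using \<alpha> \<beta>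
    by (simp only: compatibility_iff[OF \<alpha>l \<beta>l] simp_thms cong: ball_cong)
  also have "\<dots> \<longleftrightarrow> right_left_YD_algebra K H A (induced_action A \<beta>) \<alpha>"
    unfolding right_left_YD_algebra_def act using \<alpha> right_action_induced[OF \<beta>, unfolded act]
    by (auto simp: tensor_lift_op tensor_op_simps)
  finally show ?thesis .
qed

end

end

theorem proposition4p35:
  fixes K :: "'k ring" and H :: "('k, 'h) hopf" and A :: "('k, 'x) module"
    and \<alpha> :: "'x \<Rightarrow> ('h, 'x) tens" and \<beta> :: "'x \<Rightarrow> ('h \<Rightarrow> 'k, 'x) tens"
  assumes "field K" and "hopf_algebra K H" and "finite_dim K H" and "unital_algebra K A"
    and "left_coaction K (op_hopf H) A \<alpha>" and "left_coaction K (dual_hopf K H) A \<beta>"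
  shows "left_left_YD_algebra K H A \<alpha> \<beta>
    \<longleftrightarrow> right_left_YD_algebra K H A (induced_action A \<beta>) \<alpha>"
proof -
  interpret finite_hopf_algebra K H
    using assms(2,3) by (simp add: finite_hopf_algebra_def finite_hopf_algebra_axioms_def)
  show ?thesis by (rule left_left_YD_iff_right_left_YD[OF assms(4-6)])
qed

end
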